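(* Let $P$ be a countable discrete right LCM monoid, let $\mathcal{H}$ be a Hilbert space, let $T:P\to\mathcal{B}(\mathcal{H})$ be a contractive representation, and let $S_1,S_2\in\mathcal{B}(\mathcal{H})$ be commuting contractions, each of which commutes with $T(p)$ for every $p\in P$, so that $(S_1\times S_2)\times T$ is a contractive representation of $\mathbb{N}^2\times P$ on $\mathcal{H}$. Suppose that for each $i=1,2$ the representation $S_i\times T$ of $\mathbb{N}\times P$ has a $*$-regular dilation. Then there exists an isometric dilation of $(S_1\times S_2)\times T$ of the form $(V_1\times V_2)\times W$; that is, there exist a Hilbert space $\mathcal{K}\supset\mathcal{H}$, commuting isometries $V_1,V_2\in\mathcal{B}(\mathcal{K})$, and an isometric representation $W:P\to\mathcal{B}(\mathcal{K})$ such that $V_1$ and $V_2$ commute with $W(p)$ for all $p\in P$ and \[ P_{\mathcal{H}}V_1^nV_2^mW(p)|_{\mathcal{H}}=S_1^nS_2^mT(p)\quad\text{for all } n,m\ge 0,\ p\in P . \] Moreover, $V_1,V_2,W$ can be chosen so that, for both $i=1,2$, the representation $V_i\times W$ of $\mathbb{N}\times P$ is an isometric Nica-covariant co-extension of $S_i\times T$.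
   Context: A right LCM monoid $P$ is a unital left-cancellative semigroup such that for all $p,q\in P$ the set $pP\cap qP$ is either empty or equal to $rP$ for some $r\in P$. If $r\in pP$, then $p^{-1}r$ denotes the unique element $s\in P$ with $ps=r$. Here $\mathbb{N}=\{0,1,2,\dots\}$ under addition; if $P$ is right LCM, so are the Cartesian products $\mathbb{N}\times P$ and $\mathbb{N}^2\times P$. For a right LCM monoid $P$: - A contractive representation is a unital monoid homomorphism $T:P\to\mathcal{B}(\mathcal{H})$ with $\|T(p)\|\le 1$ for all $p$. It is isometric if each $T(p)$ is an isometry. - An isometric representation $V$ is Nica-covariant if for all $p,q\in P$, $V(p)V(p)^*V(q)V(q)^*=V(r)V(r)^*$ when $pP\cap qP=rP$, and $V(p)V(p)^*V(q)V(q)^*=0$ when $pP\cap qP=\emptyset$. - An isometric dilation of $T:P\to\mathcal{B}(\mathcal{H})$ is an isometric representation $V:P\to\mathcal{B}(\mathcal{K})$ on a Hilbert space $\mathcal{K}\supset\mathcal{H}$ with $T(p)=P_{\mathcal{H}}V(p)|_{\mathcal{H}}$ for all $p\in P$, where $P_{\mathcal{H}}$ is the orthogonal projection onto $\mathcal{H}$. It is a co-extension of $T$ if $\mathcal{H}$ is invariant for $V(p)^*$ for all $p\in P$ (equivalently, $\mathcal{H}^\perp$ is invariant for $V$). An isometric Nica-covariant co-extension is a co-extension that is an isometric Nica-covariant representation. - An isometric dilation $V$ of $T$ is a $*$-regular dilation if for all $p,q\in P$, $P_{\mathcal{H}}V(p)^*V(q)|_{\mathcal{H}}=T(p^{-1}r)T(q^{-1}r)^*$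 when $pP\cap qP=rP$, and $P_{\mathcal{H}}V(p)^*V(q)|_{\mathcal{H}}=0$ when $pP\cap qP=\emptyset$. If $S$ is an operator commuting with all $T(p)$, $S\times T$ is the representation of $\mathbb{N}\times P$ given by $(S\times T)(n,p)=S^nT(p)$. If $S_1,S_2$ commute with each other and with all $T(p)$, $(S_1\times S_2)\times T$ is the representation of $\mathbb{N}^2\times P$ given by $(n,m,p)\mapsto S_1^nS_2^mT(p)$. The same notation is used for $V_1,V_2,W$. *)

theory Defs
  imports "HOL-Analysis.Analysis" "HOL-Algebra.Coset"
begin

section \<open>Complex Hilbert spaces\<close>

class complex_inner = real_inner +
  fixes scaleC :: "complex \<Rightarrow> 'a \<Rightarrow> 'a" (infixr \<open>*\<^sub>C\<close> 75)
    and cinner :: "'a \<Rightarrow> 'a \<Rightarrow> complex"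
  assumes scaleC_add_right: "c *\<^sub>C (x + y) = c *\<^sub>C x + c *\<^sub>C y"
    and scaleC_add_left: "(c + d) *\<^sub>C x = c *\<^sub>C x + d *\<^sub>C x"
    and scaleC_scaleC: "c *\<^sub>C d *\<^sub>C x = (c * d) *\<^sub>C x"
    and scaleR_scaleC: "r *\<^sub>R x = complex_of_real r *\<^sub>C x"
    and cinner_add_left: "cinner (x + y) z = cinner x z + cinner y z"
    and cinner_scaleC_left: "cinner (c *\<^sub>C x) y = c * cinner x y"
    and cinner_commute: "cinner x y = cnj (cinner y x)"
    and inner_eq_Re_cinner: "inner x y = Re (cinner x y)"

text \<open>The norm and the topology of a Hilbert space are those of the underlying real inner product
  space; positive definiteness of \<^term>\<open>cinner\<close> is inherited from \<^term>\<open>inner\<close>.\<close>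

class chilbert_space = complex_inner + complete_space

lemma scaleC_one: "1 *\<^sub>C x = (x :: 'a::complex_inner)"
  by (metis scaleR_one scaleR_scaleC of_real_1)

global_interpretation complex_vector: vector_space "scaleC :: complex \<Rightarrow> 'a \<Rightarrow> 'a::complex_inner"
  by unfold_locales (simp_all add: scaleC_add_right scaleC_add_left scaleC_scaleC scaleC_one)

lemma cinner_add_right: "cinner x (y + z) = cinner x y + cinner x (z :: 'a::complex_inner)"
  by (metis cinner_add_left cinner_commute complex_cnj_add)

lemma cinner_scaleC_right: "cinner x (c *\<^sub>C y) = cnj c * cinner x (y :: 'a::complex_inner)"
  by (metis cinner_scaleC_left cinner_commute complex_cnj_mult)

lemma norm_scaleC: "norm (c *\<^sub>C x) = cmod c * norm (x :: 'a::complex_inner)"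
proof -
  have "cinner (c *\<^sub>C x) (c *\<^sub>C x) = complex_of_real ((cmod c)\<^sup>2) * cinner x x"
    unfolding cinner_scaleC_left cinner_scaleC_right complex_norm_square by (simp add: mult_ac)
  then have "(norm (c *\<^sub>C x))\<^sup>2 = (cmod c * norm x)\<^sup>2"
    by (simp add: power2_norm_eq_inner inner_eq_Re_cinner power_mult_distrib)
  then show ?thesis by (simp add: power2_eq_iff_nonneg)
qed

lemma Im_cinner: "Im (cinner x y) = inner ((- \<i>) *\<^sub>C x) (y :: 'a::complex_inner)"
  by (simp only: inner_eq_Re_cinner cinner_scaleC_left) simp

section \<open>Square-summable sequences in a Hilbert space\<close>

lemma summable_sq_add:
  fixes f g :: "nat \<Rightarrow> 'a::real_inner"
  assumes "summable (\<lambda>n. (norm (f n))\<^sup>2)" "summable (\<lambda>n. (norm (g n))\<^sup>2)"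
  shows "summable (\<lambda>n. (norm (f n + g n))\<^sup>2)"
proof (rule summable_comparison_test')
  show "summable (\<lambda>n. 2 * (norm (f n))\<^sup>2 + 2 * (norm (g n))\<^sup>2)"
    using assms by (intro summable_add summable_mult)
  fix n
  have "(norm (f n + g n))\<^sup>2 \<le> (norm (f n) + norm (g n))\<^sup>2"
    by (intro power_mono norm_triangle_ineq norm_ge_zero)
  also have "\<dots> \<le> 2 * (norm (f n))\<^sup>2 + 2 * (norm (g n))\<^sup>2"
    using sum_squares_bound[of "norm (f n)" "norm (g n)"] by (simp add: power2_sum)
  finally show "norm ((norm (f n + g n))\<^sup>2) \<le> 2 * (norm (f n))\<^sup>2 + 2 * (norm (g n))\<^sup>2"
    by simp
qed

lemma summable_inner_of_sq:
  fixes f g :: "nat \<Rightarrow> 'a::real_inner"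
  assumes "summable (\<lambda>n. (norm (f n))\<^sup>2)" "summable (\<lambda>n. (norm (g n))\<^sup>2)"
  shows "summable (\<lambda>n. inner (f n) (g n))"
proof (rule summable_comparison_test')
  show "summable (\<lambda>n. (norm (f n))\<^sup>2 + (norm (g n))\<^sup>2)"
    using assms by (intro summable_add)
  fix n
  have "norm (inner (f n) (g n)) \<le> norm (f n) * norm (g n)"
    using Cauchy_Schwarz_ineq2 by simp
  also have "\<dots> \<le> 2 * norm (f n) * norm (g n)" by simp
  also have "\<dots> \<le> (norm (f n))\<^sup>2 + (norm (g n))\<^sup>2" by (rule sum_squares_bound)
  finally show "norm (inner (f n) (g n)) \<le> (norm (f n))\<^sup>2 + (norm (g n))\<^sup>2" .
qed

lemma summable_sq_scaleC:
  fixes f :: "nat \<Rightarrow> 'a::complex_inner"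
  assumes "summable (\<lambda>n. (norm (f n))\<^sup>2)"
  shows "summable (\<lambda>n. (norm (c *\<^sub>C f n))\<^sup>2)"
  using summable_mult[OF assms, of "(cmod c)\<^sup>2"] by (simp add: norm_scaleC power_mult_distrib)

lemma summable_cinner_of_sq:
  fixes f g :: "nat \<Rightarrow> 'a::complex_inner"
  assumes "summable (\<lambda>n. (norm (f n))\<^sup>2)" "summable (\<lambda>n. (norm (g n))\<^sup>2)"
  shows "summable (\<lambda>n. cinner (f n) (g n))"
  unfolding summable_complex_iff Im_cinner inner_eq_Re_cinner[symmetric]
  by (intro conjI summable_inner_of_sq summable_sq_scaleC assms)

typedef (overloaded) 'a ell2 = "{f :: nat \<Rightarrow> 'a::chilbert_space. summable (\<lambda>n. (norm (f n))\<^sup>2)}"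
  by (rule exI[of _ "\<lambda>_. 0"]) simp

lemma summable_Rep_ell2: "summable (\<lambda>n. (norm (Rep_ell2 x n))\<^sup>2)"
  using Rep_ell2 by auto

lemma ell2_eqI: "(\<And>n. Rep_ell2 x n = Rep_ell2 y n) \<Longrightarrow> x = y"
  by (metis Rep_ell2_inject ext)

instantiation ell2 :: (chilbert_space) real_vector
begin

definition "0 = Abs_ell2 (\<lambda>_. 0)"
definition "x + y = Abs_ell2 (\<lambda>n. Rep_ell2 x n + Rep_ell2 y n)"
definition "r *\<^sub>R x = Abs_ell2 (\<lambda>n. r *\<^sub>R Rep_ell2 x n)"
definition "- (x :: 'a ell2) = Abs_ell2 (\<lambda>n. - Rep_ell2 x n)"
definition "x - (y :: 'a ell2) = x + (- y)"

lemma Rep_zero: "Rep_ell2 0 n = 0"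
  by (simp add: zero_ell2_def Abs_ell2_inverse)

lemma Rep_add: "Rep_ell2 (x + y) n = Rep_ell2 x n + Rep_ell2 y n"
  by (simp add: plus_ell2_def Abs_ell2_inverse summable_sq_add summable_Rep_ell2)

lemma Rep_scaleR: "Rep_ell2 (r *\<^sub>R x) n = r *\<^sub>R Rep_ell2 x n"
  using summable_mult[OF summable_Rep_ell2, of "r\<^sup>2" x]
  by (simp add: scaleR_ell2_def Abs_ell2_inverse power_mult_distrib)

lemma Rep_minus: "Rep_ell2 (- x) n = - Rep_ell2 x n"
  by (simp add: uminus_ell2_def Abs_ell2_inverse summable_Rep_ell2)

lemma Rep_diff: "Rep_ell2 (x - y) n = Rep_ell2 x n - Rep_ell2 y n"
  by (simp add: minus_ell2_def Rep_add Rep_minus)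

instance
proof
  fix x y z :: "'a ell2" and r s :: real
  show "x + y + z = x + (y + z)" "x + y = y + x" "0 + x = x" "- x + x = 0" "x - y = x + - y"
    by (rule ell2_eqI, simp add: Rep_add Rep_zero Rep_minus Rep_diff add_ac)+
  show "r *\<^sub>R (x + y) = r *\<^sub>R x + r *\<^sub>R y" "(r + s) *\<^sub>R x = r *\<^sub>R x + s *\<^sub>R x"
    "r *\<^sub>R s *\<^sub>R x = (r * s) *\<^sub>R x" "1 *\<^sub>R x = x"
    by (rule ell2_eqI, simp add: Rep_add Rep_scaleR scaleR_add_right scaleR_add_left)+
qed

end

instantiation ell2 :: (chilbert_space) complex_inner
begin

definition "c *\<^sub>C x = Abs_ell2 (\<lambda>n. c *\<^sub>C Rep_ell2 x n)"
definition "cinner x y = (\<Sum>n. cinner (Rep_ell2 x n) (Rep_ell2 y n))"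
definition "inner (x :: 'a ell2) y = Re (cinner x y)"
definition "norm (x :: 'a ell2) = sqrt (inner x x)"
definition "sgn (x :: 'a ell2) = x /\<^sub>R norm x"
definition "dist (x :: 'a ell2) y = norm (x - y)"
definition "uniformity = (INF e\<in>{0 <..}. principal {(x :: 'a ell2, y). dist x y < e})"
definition "open U = (\<forall>x\<in>U. eventually (\<lambda>(x', y). x' = (x :: 'a ell2) \<longrightarrow> y \<in> U) uniformity)"

lemma Rep_scaleC: "Rep_ell2 (c *\<^sub>C x) n = c *\<^sub>C Rep_ell2 x n"
  by (simp add: scaleC_ell2_def Abs_ell2_inverse summable_sq_scaleC summable_Rep_ell2)

lemma summable_cinner_ell2: "summable (\<lambda>n. cinner (Rep_ell2 x n) (Rep_ell2 y n))"
  by (intro summable_cinner_of_sq summable_Rep_ell2)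

lemma inner_ell2_eq: "inner x y = (\<Sum>n. inner (Rep_ell2 x n) (Rep_ell2 y n))"
  by (simp add: inner_ell2_def cinner_ell2_def Re_suminf[OF summable_cinner_ell2]
      inner_eq_Re_cinner)

lemma inner_self_ell2: "inner x x = (\<Sum>n. (norm (Rep_ell2 x n))\<^sup>2)"
  by (simp add: inner_ell2_eq power2_norm_eq_inner)

instance
proof
  fix x y z :: "'a ell2" and r :: real and c d :: complex
  show "c *\<^sub>C (x + y) = c *\<^sub>C x + c *\<^sub>C y" "(c + d) *\<^sub>C x = c *\<^sub>C x + d *\<^sub>C x"
    "c *\<^sub>C d *\<^sub>C x = (c * d) *\<^sub>C x"
    by (rule ell2_eqI,
        simp add: Rep_add Rep_scaleC scaleC_add_left scaleC_add_right scaleC_scaleC)+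
  show real_complex: "r *\<^sub>R x = complex_of_real r *\<^sub>C x" for r
    by (rule ell2_eqI) (simp add: Rep_scaleR Rep_scaleC scaleR_scaleC)
  show "sgn x = x /\<^sub>R norm x" by (rule sgn_ell2_def)
  show "dist x y = norm (x - y)" by (rule dist_ell2_def)
  show "uniformity = (INF e\<in>{0 <..}. principal {(x :: 'a ell2, y). dist x y < e})"
    by (rule uniformity_ell2_def)
  show "open U = (\<forall>x\<in>U. eventually (\<lambda>(x', y). x' = (x :: 'a ell2) \<longrightarrow> y \<in> U) uniformity)" for U
    by (rule open_ell2_def)
  show cadd: "cinner (x + y) z = cinner x z + cinner y z"
    by (simp add: cinner_ell2_def Rep_add cinner_add_left suminf_add[OF summable_cinner_ell2 summable_cinner_ell2])
  show cscale: "cinner (c *\<^sub>C x) y = c * cinner x y" for c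
    by (simp add: cinner_ell2_def Rep_scaleC cinner_scaleC_left suminf_mult[OF summable_cinner_ell2])
  have "(\<lambda>n. cnj (cinner (Rep_ell2 y n) (Rep_ell2 x n))) sums cnj (cinner y x)"
    unfolding cinner_ell2_def sums_cnj by (rule summable_sums[OF summable_cinner_ell2])
  then show ccomm: "cinner x y = cnj (cinner y x)"
    unfolding cinner_commute[symmetric] by (simp add: cinner_ell2_def sums_iff)
  show re: "inner x y = Re (cinner x y)" by (rule inner_ell2_def)
  show "inner x y = inner y x" by (metis ccomm inner_ell2_def cnj.simps(1))
  show "inner (x + y) z = inner x z + inner y z" by (simp add: inner_ell2_def cadd)
  show "inner (r *\<^sub>R x) y = r * inner x y" by (simp add: inner_ell2_def real_complex cscale)
  show "0 \<le> inner x x" unfolding inner_self_ell2 by (rule suminf_nonneg[OF summable_Rep_ell2]) simp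
  have "(\<Sum>n. (norm (Rep_ell2 x n))\<^sup>2) = 0 \<longleftrightarrow> (\<forall>n. (norm (Rep_ell2 x n))\<^sup>2 = 0)"
    by (rule suminf_eq_zero_iff[OF summable_Rep_ell2]) simp
  then show "inner x x = 0 \<longleftrightarrow> x = 0"
    unfolding inner_self_ell2 by (auto simp: Rep_zero intro: ell2_eqI)
  show "norm x = sqrt (inner x x)" by (rule norm_ell2_def)
qed

end

lemma norm_ell2_sq: "(norm (x :: 'a::chilbert_space ell2))\<^sup>2 = (\<Sum>n. (norm (Rep_ell2 x n))\<^sup>2)"
  by (simp add: power2_norm_eq_inner inner_self_ell2)

lemma sum_le_norm_ell2_sq: "(\<Sum>n<N. (norm (Rep_ell2 x n))\<^sup>2) \<le> (norm (x :: 'a::chilbert_space ell2))\<^sup>2"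
  unfolding norm_ell2_sq by (rule sum_le_suminf[OF summable_Rep_ell2]) auto

lemma norm_Rep_ell2_le: "norm (Rep_ell2 x n) \<le> norm (x :: 'a::chilbert_space ell2)"
proof -
  have "(norm (Rep_ell2 x n))\<^sup>2 \<le> (\<Sum>k<Suc n. (norm (Rep_ell2 x k))\<^sup>2)"
    by (intro member_le_sum) auto
  also have "\<dots> \<le> (norm x)\<^sup>2" by (rule sum_le_norm_ell2_sq)
  finally show ?thesis by (rule power2_le_imp_le) simp
qed

instance ell2 :: (chilbert_space) chilbert_space
proof
  fix X :: "nat \<Rightarrow> 'a ell2"
  assume C: "Cauchy X"
  have "Cauchy (\<lambda>k. Rep_ell2 (X k) n)" for n
  proof (rule CauchyI)
    fix e :: real assume "0 < e"
    then obtain M where "\<forall>k\<ge>M. \<forall>l\<ge>M. norm (X k - X l) < e" using CauchyD[OF C] by blast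
    then show "\<exists>M. \<forall>k\<ge>M. \<forall>l\<ge>M. norm (Rep_ell2 (X k) n - Rep_ell2 (X l) n) < e"
      by (metis Rep_diff norm_Rep_ell2_le order_le_less_trans)
  qed
  then have "\<forall>n. \<exists>f. (\<lambda>k. Rep_ell2 (X k) n) \<longlonglongrightarrow> f"
    using Cauchy_convergent convergent_def by blast
  then obtain f where f: "\<And>n. (\<lambda>k. Rep_ell2 (X k) n) \<longlonglongrightarrow> f n" by metis
  have bound: "\<exists>M. \<forall>k\<ge>M. \<forall>N. (\<Sum>n<N. (norm (Rep_ell2 (X k) n - f n))\<^sup>2) \<le> e\<^sup>2"
    if e: "0 < e" for e :: real
  proof -
    obtain M where M: "\<And>k l. k \<ge> M \<Longrightarrow> l \<ge> M \<Longrightarrow> norm (X k - X l) < e"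
      using CauchyD[OF C e] by blast
    have "(\<Sum>n<N. (norm (Rep_ell2 (X k) n - f n))\<^sup>2) \<le> e\<^sup>2" if k: "k \<ge> M" for k N
    proof (rule LIMSEQ_le_const2)
      show "(\<lambda>l. \<Sum>n<N. (norm (Rep_ell2 (X k) n - Rep_ell2 (X l) n))\<^sup>2)
              \<longlonglongrightarrow> (\<Sum>n<N. (norm (Rep_ell2 (X k) n - f n))\<^sup>2)"
        by (intro tendsto_intros f)
      have "(\<Sum>n<N. (norm (Rep_ell2 (X k) n - Rep_ell2 (X l) n))\<^sup>2) \<le> e\<^sup>2" if "l \<ge> M" for l
      proof -
        have "(\<Sum>n<N. (norm (Rep_ell2 (X k) n - Rep_ell2 (X l) n))\<^sup>2) \<le> (norm (X k - X l))\<^sup>2"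
          using sum_le_norm_ell2_sq[of "X k - X l" N] by (simp add: Rep_diff)
        also have "\<dots> \<le> e\<^sup>2" using M[OF k that] by (intro power_mono) auto
        finally show ?thesis .
      qed
      then show "\<exists>L. \<forall>l\<ge>L. (\<Sum>n<N. (norm (Rep_ell2 (X k) n - Rep_ell2 (X l) n))\<^sup>2) \<le> e\<^sup>2" by blast
    qed
    then show ?thesis by blast
  qed
  have summ: "summable (\<lambda>n. (norm (Rep_ell2 (X k) n - f n))\<^sup>2)"
    if "\<forall>N. (\<Sum>n<N. (norm (Rep_ell2 (X k) n - f n))\<^sup>2) \<le> e\<^sup>2" for k e
    using that by (intro summableI_nonneg_bounded[where x = "e\<^sup>2"]) auto
  obtain k0 where k0: "\<forall>N. (\<Sum>n<N. (norm (Rep_ell2 (X k0) n - f n))\<^sup>2) \<le> 1\<^sup>2"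
    using bound[of 1] by auto
  have "summable (\<lambda>n. (norm (Rep_ell2 (- X k0) n + (Rep_ell2 (X k0) n - f n)))\<^sup>2)"
    by (intro summable_sq_add summable_Rep_ell2 summ[OF k0])
  then have sf: "summable (\<lambda>n. (norm (f n))\<^sup>2)" by (simp add: Rep_minus)
  define F where "F = Abs_ell2 f"
  have RF: "Rep_ell2 F = f" using sf by (simp add: F_def Abs_ell2_inverse)
  have "X \<longlonglongrightarrow> F"
  proof (rule LIMSEQ_I)
    fix e :: real assume e: "0 < e"
    obtain M where M: "\<And>k N. k \<ge> M \<Longrightarrow> (\<Sum>n<N. (norm (Rep_ell2 (X k) n - f n))\<^sup>2) \<le> (e/2)\<^sup>2"
      using bound[of "e/2"] e by auto
    have "norm (X k - F) < e" if "k \<ge> M" for k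
    proof -
      have "(norm (X k - F))\<^sup>2 = (\<Sum>n. (norm (Rep_ell2 (X k) n - f n))\<^sup>2)"
        by (simp add: norm_ell2_sq Rep_diff RF)
      also have "\<dots> \<le> (e/2)\<^sup>2"
        using M[OF that] by (intro suminf_le_const summ[where e = "e/2"]) auto
      finally have "norm (X k - F) \<le> e/2" by (rule power2_le_imp_le) (use e in simp)
      then show ?thesis using e by simp
    qed
    then show "\<exists>M. \<forall>k\<ge>M. norm (X k - F) < e" by blast
  qed
  then show "convergent X" by (auto simp: convergent_def)
qed

section \<open>Operators on a closed subspace\<close>

text \<open>A Hilbert space is either a whole type of class \<^class>\<open>chilbert_space\<close> or, where it is
  existentially quantified, a closed complex subspace \<open>K\<close> of such a type.  An operator on \<open>K\<close> is a
  function on the ambient type of which only the restriction to \<open>K\<close> matters; operators on the whole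
  space are the case \<open>K = UNIV\<close>.\<close>

definition hilbert_subspace :: "'a::chilbert_space set \<Rightarrow> bool" where
  "hilbert_subspace K \<longleftrightarrow> complex_vector.subspace K \<and> closed K"

definition bounded_op_on :: "'a::chilbert_space set \<Rightarrow> ('a \<Rightarrow> 'a) \<Rightarrow> bool" where
  "bounded_op_on K A \<longleftrightarrow>
     (\<forall>x\<in>K. A x \<in> K) \<and>
     (\<forall>x\<in>K. \<forall>y\<in>K. A (x + y) = A x + A y) \<and>
     (\<forall>c. \<forall>x\<in>K. A (c *\<^sub>C x) = c *\<^sub>C A x) \<and>
     (\<exists>b. \<forall>x\<in>K. norm (A x) \<le> b * norm x)"

definition contraction_on :: "'a::chilbert_space set \<Rightarrow> ('a \<Rightarrow> 'a) \<Rightarrow> bool" where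
  "contraction_on K A \<longleftrightarrow> bounded_op_on K A \<and> (\<forall>x\<in>K. norm (A x) \<le> norm x)"

definition isometry_on :: "'a::chilbert_space set \<Rightarrow> ('a \<Rightarrow> 'a) \<Rightarrow> bool" where
  "isometry_on K A \<longleftrightarrow> bounded_op_on K A \<and> (\<forall>x\<in>K. norm (A x) = norm x)"

definition commute_on :: "'a set \<Rightarrow> ('a \<Rightarrow> 'a) \<Rightarrow> ('a \<Rightarrow> 'a) \<Rightarrow> bool" where
  "commute_on K A B \<longleftrightarrow> (\<forall>x\<in>K. A (B x) = B (A x))"

text \<open>By the Riesz representation theorem the description below determines \<open>adj_on K A y\<close> uniquely
  when \<open>K\<close> is a Hilbert subspace, \<open>A\<close> is a bounded operator on \<open>K\<close> and \<open>y \<in> K\<close>; by the projection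
  theorem the same holds for the orthogonal projection onto a Hilbert subspace.\<close>

definition adj_on :: "'a::chilbert_space set \<Rightarrow> ('a \<Rightarrow> 'a) \<Rightarrow> 'a \<Rightarrow> 'a" where
  "adj_on K A y = (THE x. x \<in> K \<and> (\<forall>z\<in>K. cinner z x = cinner (A z) y))"

definition oproj :: "'a::chilbert_space set \<Rightarrow> 'a \<Rightarrow> 'a" where
  "oproj M x = (THE y. y \<in> M \<and> (\<forall>z\<in>M. cinner (x - y) z = 0))"

definition isometric_embedding ::
  "('h::chilbert_space \<Rightarrow> 'k::chilbert_space) \<Rightarrow> 'k set \<Rightarrow> bool" where
  "isometric_embedding J K \<longleftrightarrow>
     (\<forall>h. J h \<in> K) \<and> (\<forall>x y. J (x + y) = J x + J y) \<and> (\<forall>c x. J (c *\<^sub>C x) = c *\<^sub>C J x) \<and>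
     (\<forall>h. norm (J h) = norm h)"

section \<open>Right LCM monoids\<close>

locale right_LCM_monoid = monoid P for P (structure) +
  assumes left_cancel:
    "\<lbrakk>p \<in> carrier P; x \<in> carrier P; y \<in> carrier P; p \<otimes> x = p \<otimes> y\<rbrakk> \<Longrightarrow> x = y"
  and right_LCM:
    "\<lbrakk>p \<in> carrier P; q \<in> carrier P\<rbrakk> \<Longrightarrow>
       (p <# carrier P) \<inter> (q <# carrier P) = {} \<or>
       (\<exists>r\<in>carrier P. (p <# carrier P) \<inter> (q <# carrier P) = r <# carrier P)"

text \<open>\<open>lquot P p r\<close> is $p^{-1}r$; it is meaningful for \<open>r \<in> pP\<close>.\<close>

definition lquot :: "('p, 'm) monoid_scheme \<Rightarrow> 'p \<Rightarrow> 'p \<Rightarrow> 'p" where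
  "lquot P p r = (THE s. s \<in> carrier P \<and> p \<otimes>\<^bsub>P\<^esub> s = r)"

definition nat_add :: "nat monoid" where
  "nat_add = \<lparr>carrier = UNIV, mult = (+), one = 0\<rparr>"

section \<open>Representations and dilations\<close>

definition representation_on ::
  "('p, 'm) monoid_scheme \<Rightarrow> 'a::chilbert_space set \<Rightarrow> ('p \<Rightarrow> 'a \<Rightarrow> 'a) \<Rightarrow> bool" where
  "representation_on P K V \<longleftrightarrow>
     (\<forall>p\<in>carrier P. bounded_op_on K (V p)) \<and>
     (\<forall>x\<in>K. V \<one>\<^bsub>P\<^esub> x = x) \<and>
     (\<forall>p\<in>carrier P. \<forall>q\<in>carrier P. \<forall>x\<in>K. V (p \<otimes>\<^bsub>P\<^esub> q) x = V p (V q x))"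

definition contractive_rep ::
  "('p, 'm) monoid_scheme \<Rightarrow> 'a::chilbert_space set \<Rightarrow> ('p \<Rightarrow> 'a \<Rightarrow> 'a) \<Rightarrow> bool" where
  "contractive_rep P K V \<longleftrightarrow>
     representation_on P K V \<and> (\<forall>p\<in>carrier P. contraction_on K (V p))"

definition isometric_rep ::
  "('p, 'm) monoid_scheme \<Rightarrow> 'a::chilbert_space set \<Rightarrow> ('p \<Rightarrow> 'a \<Rightarrow> 'a) \<Rightarrow> bool" where
  "isometric_rep P K V \<longleftrightarrow>
     representation_on P K V \<and> (\<forall>p\<in>carrier P. isometry_on K (V p))"

definition Nica_covariant ::
  "('p, 'm) monoid_scheme \<Rightarrow> 'a::chilbert_space set \<Rightarrow> ('p \<Rightarrow> 'a \<Rightarrow> 'a) \<Rightarrow> bool" where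
  "Nica_covariant P K V \<longleftrightarrow>
     (\<forall>p\<in>carrier P. \<forall>q\<in>carrier P. \<forall>r\<in>carrier P.
        (p <#\<^bsub>P\<^esub> carrier P) \<inter> (q <#\<^bsub>P\<^esub> carrier P) = r <#\<^bsub>P\<^esub> carrier P \<longrightarrow>
        (\<forall>x\<in>K. V p (adj_on K (V p) (V q (adj_on K (V q) x))) = V r (adj_on K (V r) x))) \<and>
     (\<forall>p\<in>carrier P. \<forall>q\<in>carrier P.
        (p <#\<^bsub>P\<^esub> carrier P) \<inter> (q <#\<^bsub>P\<^esub> carrier P) = {} \<longrightarrow>
        (\<forall>x\<in>K. V p (adj_on K (V p) (V q (adj_on K (V q) x))) = 0))"

text \<open>In the following definitions \<open>T\<close> acts on the whole type \<open>'h\<close>, \<open>V\<close> acts on \<open>K\<close>, and \<open>'h\<close> is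
  regarded as a subspace of \<open>K\<close> by means of the isometric embedding \<open>J\<close>.\<close>

definition isometric_dilation ::
  "('p, 'm) monoid_scheme \<Rightarrow> ('p \<Rightarrow> 'h \<Rightarrow> 'h::chilbert_space) \<Rightarrow>
   'k::chilbert_space set \<Rightarrow> ('h \<Rightarrow> 'k) \<Rightarrow> ('p \<Rightarrow> 'k \<Rightarrow> 'k) \<Rightarrow> bool" where
  "isometric_dilation P T K J V \<longleftrightarrow>
     hilbert_subspace K \<and> isometric_embedding J K \<and> isometric_rep P K V \<and>
     (\<forall>p\<in>carrier P. \<forall>h. oproj (range J) (V p (J h)) = J (T p h))"

definition coextension ::
  "('p, 'm) monoid_scheme \<Rightarrow> ('p \<Rightarrow> 'h \<Rightarrow> 'h::chilbert_space) \<Rightarrow>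
   'k::chilbert_space set \<Rightarrow> ('h \<Rightarrow> 'k) \<Rightarrow> ('p \<Rightarrow> 'k \<Rightarrow> 'k) \<Rightarrow> bool" where
  "coextension P T K J V \<longleftrightarrow>
     isometric_dilation P T K J V \<and>
     (\<forall>p\<in>carrier P. \<forall>h. adj_on K (V p) (J h) \<in> range J)"

definition isometric_Nica_coextension ::
  "('p, 'm) monoid_scheme \<Rightarrow> ('p \<Rightarrow> 'h \<Rightarrow> 'h::chilbert_space) \<Rightarrow>
   'k::chilbert_space set \<Rightarrow> ('h \<Rightarrow> 'k) \<Rightarrow> ('p \<Rightarrow> 'k \<Rightarrow> 'k) \<Rightarrow> bool" where
  "isometric_Nica_coextension P T K J V \<longleftrightarrow> coextension P T K J V \<and> Nica_covariant P K V"

definition star_regular_dilation ::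
  "('p, 'm) monoid_scheme \<Rightarrow> ('p \<Rightarrow> 'h \<Rightarrow> 'h::chilbert_space) \<Rightarrow>
   'k::chilbert_space set \<Rightarrow> ('h \<Rightarrow> 'k) \<Rightarrow> ('p \<Rightarrow> 'k \<Rightarrow> 'k) \<Rightarrow> bool" where
  "star_regular_dilation P T K J V \<longleftrightarrow>
     isometric_dilation P T K J V \<and>
     (\<forall>p\<in>carrier P. \<forall>q\<in>carrier P. \<forall>r\<in>carrier P.
        (p <#\<^bsub>P\<^esub> carrier P) \<inter> (q <#\<^bsub>P\<^esub> carrier P) = r <#\<^bsub>P\<^esub> carrier P \<longrightarrow>
        (\<forall>h. oproj (range J) (adj_on K (V p) (V q (J h))) =
             J (T (lquot P p r) (adj_on UNIV (T (lquot P q r)) h)))) \<and>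
     (\<forall>p\<in>carrier P. \<forall>q\<in>carrier P.
        (p <#\<^bsub>P\<^esub> carrier P) \<inter> (q <#\<^bsub>P\<^esub> carrier P) = {} \<longrightarrow>
        (\<forall>h. oproj (range J) (adj_on K (V p) (V q (J h))) = 0))"

definition rep_times :: "('a \<Rightarrow> 'a) \<Rightarrow> ('p \<Rightarrow> 'a \<Rightarrow> 'a) \<Rightarrow> nat \<times> 'p \<Rightarrow> 'a \<Rightarrow> 'a" where
  "rep_times S T = (\<lambda>(n, p). (S ^^ n) \<circ> T p)"

definition rep_times2 ::
  "('a \<Rightarrow> 'a) \<Rightarrow> ('a \<Rightarrow> 'a) \<Rightarrow> ('p \<Rightarrow> 'a \<Rightarrow> 'a) \<Rightarrow> (nat \<times> nat) \<times> 'p \<Rightarrow> 'a \<Rightarrow> 'a" where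
  "rep_times2 S\<^sub>1 S\<^sub>2 T = (\<lambda>((n, m), p). (S\<^sub>1 ^^ n) \<circ> (S\<^sub>2 ^^ m) \<circ> T p)"

text \<open>HOL has no quantifier over all Hilbert spaces.  A dilation space in a hypothesis is a
  subspace of an arbitrary type.  One asserted to exist is a closed subspace of \<open>'h ell2\<close>, that
  is, of $\ell^2(\mathbb{N}, H)$.  For a countable monoid this is no restriction on the space up to
  unitary equivalence: a dilation may be cut down to the closed span of the images
  \<open>V p (J ` UNIV)\<close>, whose Hilbert dimension is at most $\aleph_0 \cdot \dim H$.\<close>

end

theory Submission
  imports Defs "HOL-Library.Nat_Bijection"
begin

text \<open>The hypotheses enter only through the kernel
  \<open>K(p, q) = T(p\<^sup>-\<^sup>1r) T(q\<^sup>-\<^sup>1r)\<^sup>*\<close> (and \<open>0\<close> if \<open>pP \<inter> qP\<close> is empty).  A *-regular dilation of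
  \<open>S\<^sub>i \<times> T\<close> shows that \<open>K\<close> is positive definite and dominates \<open>S\<^sub>i K S\<^sub>i\<^sup>*\<close>.  Hence, on the Hilbert space
  spanned by symbols \<open>L p h\<close> with Gram kernel \<open>K\<close>, the isometries \<open>W(p) (L q h) = L (pq) h\<close> form a
  Nica-covariant co-extension of \<open>T\<close>, and \<open>L p h \<mapsto> L p (S\<^sub>i\<^sup>* h)\<close> defines commuting contractions
  \<open>R\<^sub>1, R\<^sub>2\<close> which commute with all \<open>W(p)\<close> and all \<open>W(p)\<^sup>*\<close>.  Ando's dilation of the pair
  \<open>R\<^sub>1\<^sup>*, R\<^sub>2\<^sup>*\<close> can be carried out inside the commutant of the von Neumann algebra generated by \<open>W\<close>,
  the unitary in Ando's construction being taken as the Halmos dilation of a partial isometry.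
  So the resulting isometries \<open>V\<^sub>1, V\<^sub>2\<close> doubly commute with the amplification of \<open>W\<close>, and double
  commutation makes \<open>V\<^sub>i \<times> W\<close> Nica-covariant.\<close>

section \<open>Complex inner products\<close>

text \<open>Domination comes from one entry of the regularity formula: (1, p) and (0, q) have least
  common multiple (1, r) with quotients (0, \<open>lquot P p r\<close>) and (1,
  \<open>lquot P q r\<close>). Applying the isometry of (1, \<open>\<one>\<close>) on the left of
  the Gram kernel therefore amounts to applying the adjoint of \<open>S\<close> on the right, and
  Cauchy-Schwarz turns this into a norm inequality. Passing to adjoints produces a co-extension:
  Ando's isometries are lower triangular, so their adjoints extend \<open>R1\<close> and
  \<open>R2\<close>, and these restrict to the adjoints of \<open>S\<^sub>1\<close> and
  \<open>S\<^sub>2\<close> on the copy of H formed by the vectors \<open>L \<one> h\<close>. The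
  obstacle is that textbook versions of Ando's theorem obtain a unitary by comparing dimensions, a
  choice that need not commute with \<open>W\<close>. A second constraint is that the dilation space
  must lie in \<open>'h ell2\<close>. The vectors \<open>L p h\<close> are therefore realized there,
  the direct sums and sequence spaces built over it embed back, and a proper subspace is handled
  through a projection \<open>E\<close> that stands for its identity.\<close>

instance chilbert_space \<subseteq> banach ..

lemma cinner_zero [simp]: "cinner 0 y = 0" "cinner y 0 = 0" for y :: "'a::complex_inner"
  using cinner_add_left[of 0 0 y] cinner_add_right[of y 0 0] by simp_all

lemma cinner_minus [simp]: "cinner (- x) y = - cinner x y" "cinner y (- x) = - cinner y x"
  for x :: "'a::complex_inner"
  using cinner_add_left[of x "- x" y] cinner_add_right[of y x "- x"]
  by (simp_all add: eq_neg_iff_add_eq_0 add.commute)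

lemma cinner_diff_left: "cinner (x - y) z = cinner x z - cinner y (z :: 'a::complex_inner)"
  by (metis cinner_add_left cinner_minus(1) diff_conv_add_uminus)

lemma cinner_diff_right: "cinner z (x - y) = cinner z x - cinner z (y :: 'a::complex_inner)"
  by (metis cinner_add_right cinner_minus(2) diff_conv_add_uminus)

lemma cinner_sum_left: "cinner (sum f A) y = (\<Sum>i\<in>A. cinner (f i) (y :: 'a::complex_inner))"
  by (induction A rule: infinite_finite_induct) (auto simp: cinner_add_left)

lemma cinner_sum_right: "cinner y (sum f A) = (\<Sum>i\<in>A. cinner (y :: 'a::complex_inner) (f i))"
  by (induction A rule: infinite_finite_induct) (auto simp: cinner_add_right)

lemma cinner_self: "cinner x x = complex_of_real ((norm (x :: 'a::complex_inner))\<^sup>2)"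
proof -
  have "Im (cinner x x) = 0"
    using arg_cong[OF cinner_commute[of x x], of Im] by simp
  then show ?thesis
    by (simp add: complex_eq_iff power2_norm_eq_inner inner_eq_Re_cinner)
qed

lemma cinner_self_eq_zero [simp]: "cinner x x = 0 \<longleftrightarrow> x = (0 :: 'a::complex_inner)"
  by (simp add: cinner_self)

lemma cinner_eqI: "(\<And>z. cinner z x = cinner z y) \<Longrightarrow> x = (y :: 'a::complex_inner)"
  by (metis cinner_diff_right cinner_self_eq_zero eq_iff_diff_eq_0)

lemma norm_cinner_le: "cmod (cinner x y) \<le> norm x * norm (y :: 'a::complex_inner)"
proof (cases "cinner x y = 0")
  case False
  \<comment> \<open>A phase that makes the inner product real and nonnegative, so that the real
    Cauchy-Schwarz inequality applies.\<close>
  define u where "u = cnj (cinner x y) / cmod (cinner x y)"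
  have u: "cmod u = 1" using False by (simp add: u_def norm_divide)
  have "cnj (cinner x y) * cinner x y = of_real (cmod (cinner x y)) * of_real (cmod (cinner x y))"
    by (metis complex_norm_square mult.commute of_real_mult power2_eq_square)
  then have "cinner (u *\<^sub>C x) y = cmod (cinner x y)"
    using False by (simp add: u_def cinner_scaleC_left)
  then have "cmod (cinner x y) = inner (u *\<^sub>C x) y"
    by (simp add: inner_eq_Re_cinner)
  also have "\<dots> \<le> norm (u *\<^sub>C x) * norm y" by (rule norm_cauchy_schwarz)
  finally show ?thesis by (simp add: norm_scaleC u)
qed simp

lemma scaleC_zero_right [simp]: "c *\<^sub>C (0 :: 'a::complex_inner) = 0"
  by (rule complex_vector.scale_zero_right)

lemma scaleC_diff_right: "c *\<^sub>C (x - y :: 'a::complex_inner) = c *\<^sub>C x - c *\<^sub>C y"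
  by (rule complex_vector.scale_right_diff_distrib)

lemma bounded_bilinear_cinner: "bounded_bilinear (cinner :: 'a::complex_inner \<Rightarrow> _)"
  by unfold_locales
    (auto simp: cinner_add_left cinner_add_right scaleR_scaleC cinner_scaleC_left
      cinner_scaleC_right scaleR_conv_of_real intro!: exI[of _ 1] norm_cinner_le)

lemma bounded_bilinear_scaleC: "bounded_bilinear (scaleC :: complex \<Rightarrow> 'a::complex_inner \<Rightarrow> 'a)"
proof unfold_locales
  show "(r *\<^sub>R a) *\<^sub>C b = r *\<^sub>R (a *\<^sub>C b)" for r a and b :: 'a
    by (simp add: scaleR_scaleC scaleR_conv_of_real scaleC_scaleC)
  show "a *\<^sub>C (r *\<^sub>R b) = r *\<^sub>R (a *\<^sub>C b)" for r a and b :: 'a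
    by (simp add: scaleR_scaleC scaleC_scaleC mult.commute)
qed (auto simp: scaleC_add_left scaleC_add_right norm_scaleC intro!: exI[of _ 1])

lemmas tendsto_scaleC = bounded_bilinear.tendsto[OF bounded_bilinear_scaleC]

lemma parallelogram:
  "(norm (x + y))\<^sup>2 + (norm (x - y))\<^sup>2 = 2 * (norm x)\<^sup>2 + 2 * (norm (y :: 'a::real_inner))\<^sup>2"
  by (simp add: power2_norm_eq_inner inner_simps)

text \<open>A sequence in \<open>M\<close> approximating the distance from \<open>x\<close> is
  Cauchy by the parallelogram law; its limit is a nearest point, and minimality forces
  orthogonality.\<close>

lemma orthogonal_projection_exists:
  fixes M :: "'a::chilbert_space set"
  assumes M: "hilbert_subspace M"
  obtains y where "y \<in> M" "\<And>z. z \<in> M \<Longrightarrow> cinner (x - y) z = 0"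
proof -
  note sub = M[unfolded hilbert_subspace_def, THEN conjunct1]
  have add: "a + b \<in> M" if "a \<in> M" "b \<in> M" for a b
    using that complex_vector.subspace_add[OF sub] by blast
  have scale: "c *\<^sub>C a \<in> M" if "a \<in> M" for a c
    using that complex_vector.subspace_scale[OF sub] by blast
  have scaleR: "c *\<^sub>R a \<in> M" if "a \<in> M" for a c
    using that scale by (simp add: scaleR_scaleC)
  define d where "d = infdist x M"
  have ne: "M \<noteq> {}" using complex_vector.subspace_0[OF sub] by blast
  have dle: "d \<le> norm (x - y)" if "y \<in> M" for y
    using infdist_le[OF that, of x] by (simp add: d_def dist_norm)
  have d0: "0 \<le> d" by (simp add: d_def infdist_nonneg)
  have "\<exists>y\<in>M. dist x y < d + 1 / Suc n" for n
  proof (rule ccontr)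
    assume "\<not> ?thesis"
    then have "d + 1 / Suc n \<le> d"
      unfolding d_def infdist_notempty[OF ne] by (intro cINF_greatest ne) (auto simp: not_less)
    then show False by (simp add: field_simps)
  qed
  then obtain f where f: "\<And>n. f n \<in> M" "\<And>n. norm (x - f n) < d + 1 / Suc n"
    unfolding dist_norm by metis
  have lim: "(\<lambda>n. d + 1 / Suc n) \<longlonglongrightarrow> d"
    using tendsto_add[OF tendsto_const LIMSEQ_inverse_real_of_nat, of d]
    by (simp add: inverse_eq_divide)
  have bnd: "(norm (f n - f m))\<^sup>2 \<le> 2 * ((d + 1 / Suc n)\<^sup>2 - d\<^sup>2) + 2 * ((d + 1 / Suc m)\<^sup>2 - d\<^sup>2)" for n m
  proof -
    \<comment> \<open>The midpoint of two members of \<open>M\<close> is again in \<open>M\<close>,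
      hence no closer to \<open>x\<close> than \<open>d\<close>.\<close>
    have "d \<le> norm (x - (1/2) *\<^sub>R (f n + f m))" by (intro dle scaleR add f)
    then have "d\<^sup>2 \<le> (norm (x - (1/2) *\<^sub>R (f n + f m)))\<^sup>2" using d0 by (intro power_mono)
    moreover have "(x - f n) + (x - f m) = 2 *\<^sub>R (x - (1/2) *\<^sub>R (f n + f m))"
      by (simp add: algebra_simps scaleR_2)
    then have "(norm ((x - f n) + (x - f m)))\<^sup>2 = 4 * (norm (x - (1/2) *\<^sub>R (f n + f m)))\<^sup>2"
      by (simp only: norm_scaleR power_mult_distrib) simp
    moreover have "(norm ((x - f n) + (x - f m)))\<^sup>2 + (norm (f m - f n))\<^sup>2
        = 2 * (norm (x - f n))\<^sup>2 + 2 * (norm (x - f m))\<^sup>2"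
      using parallelogram[of "x - f n" "x - f m"] by simp
    moreover have "(norm (x - f k))\<^sup>2 \<le> (d + 1 / Suc k)\<^sup>2" for k
      using f(2)[of k] by (intro power_mono) auto
    from this[of n] this[of m]
    have "2 * (norm (x - f n))\<^sup>2 + 2 * (norm (x - f m))\<^sup>2 \<le> 2 * (d + 1 / Suc n)\<^sup>2 + 2 * (d + 1 / Suc m)\<^sup>2"
      by simp
    ultimately show ?thesis unfolding norm_minus_commute[of "f m"] right_diff_distrib by linarith
  qed
  have "Cauchy f"
  proof (rule CauchyI)
    fix e :: real assume e: "0 < e"
    have "(\<lambda>n. 2 * ((d + 1 / Suc n)\<^sup>2 - d\<^sup>2)) \<longlonglongrightarrow> 2 * (d\<^sup>2 - d\<^sup>2)"
      by (intro tendsto_intros lim)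
    then have "\<forall>\<^sub>F n in sequentially. 2 * ((d + 1 / Suc n)\<^sup>2 - d\<^sup>2) < e\<^sup>2 / 2"
      using e by (intro order_tendstoD(2)[where y = "2 * (d\<^sup>2 - d\<^sup>2)"]) auto
    then obtain N where N: "\<And>n. n \<ge> N \<Longrightarrow> 2 * ((d + 1 / Suc n)\<^sup>2 - d\<^sup>2) < e\<^sup>2 / 2"
      unfolding eventually_sequentially by blast
    have "norm (f m - f n) < e" if "m \<ge> N" "n \<ge> N" for m n
    proof (rule power2_less_imp_less)
      show "(norm (f m - f n))\<^sup>2 < e\<^sup>2"
        using bnd[of m n] N[OF that(1)] N[OF that(2)] by linarith
    qed (use e in simp)
    then show "\<exists>M. \<forall>m\<ge>M. \<forall>n\<ge>M. norm (f m - f n) < e" by blast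
  qed
  then obtain y where y: "f \<longlonglongrightarrow> y" using Cauchy_convergent convergent_def by blast
  have yM: "y \<in> M"
    using M y f(1) closed_sequentially[of M f y] by (auto simp: hilbert_subspace_def)
  have "norm (x - y) \<le> d"
  proof (rule LIMSEQ_le)
    show "(\<lambda>n. norm (x - f n)) \<longlonglongrightarrow> norm (x - y)" by (intro tendsto_intros y)
    show "\<exists>N. \<forall>n\<ge>N. norm (x - f n) \<le> d + 1 / Suc n" using f(2) less_imp_le by blast
  qed (rule lim)
  then have nd: "norm (x - y) = d" using dle[OF yM] by simp
  have re: "inner (x - y) z = 0" if z: "z \<in> M" for z
  proof (cases "z = 0")
    case False
    \<comment> \<open>The value minimising the squared norm of
      \<open>(x - y) - t *\<^sub>R z\<close>.\<close>
    define t where "t = inner (x - y) z / (norm z)\<^sup>2"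
    have "d \<le> norm (x - (y + t *\<^sub>R z))" by (intro dle add scaleR z yM)
    then have "(norm (x - y))\<^sup>2 \<le> (norm ((x - y) - t *\<^sub>R z))\<^sup>2"
      using nd d0 by (simp add: diff_diff_add power_mono)
    also have "\<dots> = (norm (x - y))\<^sup>2 - 2 * t * inner (x - y) z + t\<^sup>2 * (norm z)\<^sup>2"
      unfolding power2_norm_eq_inner inner_diff_left[of "x - y" "t *\<^sub>R z"]
        inner_diff_right[of _ "x - y" "t *\<^sub>R z"] inner_commute[of "t *\<^sub>R z" "x - y"]
      by (simp add: power2_eq_square)
    also have "t\<^sup>2 * (norm z)\<^sup>2 = t * inner (x - y) z"
      using False by (simp add: t_def power2_eq_square)
    finally have "t * inner (x - y) z \<le> 0" by simp
    moreover have "t * inner (x - y) z = (inner (x - y) z)\<^sup>2 / (norm z)\<^sup>2"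
      by (simp add: t_def power2_eq_square)
    ultimately have "(inner (x - y) z)\<^sup>2 / (norm z)\<^sup>2 \<le> 0" by simp
    then show ?thesis using False by (simp add: divide_le_0_iff)
  qed simp
  have "cinner (x - y) z = 0" if z: "z \<in> M" for z
  proof -
    \<comment> \<open>Real orthogonality to \<open>z\<close> and to \<open>\<i> *\<^sub>C z\<close>
      together is complex orthogonality.\<close>
    have "inner (x - y) (\<i> *\<^sub>C z) = Im (cinner (x - y) z)"
      by (simp add: inner_eq_Re_cinner cinner_scaleC_right)
    then show ?thesis using re[OF z] re[OF scale[OF z, of \<i>]]
      by (simp add: complex_eq_iff inner_eq_Re_cinner)
  qed
  with yM show ?thesis using that by blast
qed

lemma oproj_eqI:
  fixes M :: "'a::chilbert_space set"
  assumes "complex_vector.subspace M" "y \<in> M" "\<And>z. z \<in> M \<Longrightarrow> cinner (x - y) z = 0"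
  shows "oproj M x = y"
  unfolding oproj_def
proof (rule the_equality)
  fix y' assume y': "y' \<in> M \<and> (\<forall>z\<in>M. cinner (x - y') z = 0)"
  have d: "y - y' \<in> M" using assms(1,2) y' by (blast intro: complex_vector.subspace_diff)
  then have "cinner (x - y') (y - y') - cinner (x - y) (y - y') = 0" using y' assms(3)[OF d] by simp
  then have "cinner (y - y') (y - y') = 0" by (simp flip: cinner_diff_left)
  then show "y' = y" by simp
qed (use assms in auto)

section \<open>Bounded operators and adjoints\<close>

text \<open>The two-sorted, everywhere defined counterpart of \<open>bounded_op_on\<close>:
  embeddings, direct sums and sequence spaces call for different domain and codomain types.\<close>

definition bounded_clinear :: "('a::chilbert_space \<Rightarrow> 'b::chilbert_space) \<Rightarrow> bool" where
  "bounded_clinear A \<longleftrightarrow> (\<forall>x y. A (x + y) = A x + A y) \<and> (\<forall>c x. A (c *\<^sub>C x) = c *\<^sub>C A x) \<and>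
     (\<exists>b. \<forall>x. norm (A x) \<le> b * norm x)"

lemma bounded_clinearI:
  assumes "\<And>x y. A (x + y) = A x + A y" "\<And>c x. A (c *\<^sub>C x) = c *\<^sub>C A x"
    "\<And>x. norm (A x) \<le> b * norm x"
  shows "bounded_clinear A"
  using assms unfolding bounded_clinear_def by blast

lemma bounded_clinear_add: "bounded_clinear A \<Longrightarrow> A (x + y) = A x + A y"
  by (simp add: bounded_clinear_def)

lemma bounded_clinear_scaleC: "bounded_clinear A \<Longrightarrow> A (c *\<^sub>C x) = c *\<^sub>C A x"
  by (simp add: bounded_clinear_def)

lemma bounded_clinear_imp_bounded_linear: "bounded_clinear A \<Longrightarrow> bounded_linear A"
proof -
  assume A: "bounded_clinear A"
  then obtain b where "\<And>x. norm (A x) \<le> norm x * b"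
    by (auto simp: bounded_clinear_def mult.commute)
  then show ?thesis
    using A by (intro bounded_linear_intro[of A b]) (auto simp: bounded_clinear_def scaleR_scaleC)
qed

lemmas bounded_clinear_0 = bounded_clinear_imp_bounded_linear[THEN bounded_linear.linear, THEN linear_0]
lemmas bounded_clinear_diff = bounded_clinear_imp_bounded_linear[THEN bounded_linear.linear, THEN linear_diff]
lemmas bounded_clinear_sum = bounded_clinear_imp_bounded_linear[THEN bounded_linear.linear, THEN linear_sum]
lemmas bounded_clinear_continuous_on =
  bounded_clinear_imp_bounded_linear[THEN bounded_linear.continuous_on]

lemma bounded_clinear_comp:
  assumes "bounded_clinear A" "bounded_clinear B"
  shows "bounded_clinear (\<lambda>x. A (B x))"
proof -
  obtain b where "\<And>x. norm (A (B x)) \<le> norm x * b"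
    using bounded_linear.bounded[OF bounded_linear_compose[OF assms[THEN bounded_clinear_imp_bounded_linear]]]
    by blast
  then show ?thesis using assms
    by (intro bounded_clinearI[of _ b]) (simp_all add: bounded_clinear_def mult.commute)
qed

lemma bounded_clinear_ident [simp]: "bounded_clinear (\<lambda>x. x)"
  by (rule bounded_clinearI[of _ 1]) auto

lemma bounded_clinear_zero [simp]: "bounded_clinear (\<lambda>x. 0)"
  by (rule bounded_clinearI[of _ 1]) auto

lemma bounded_clinear_plus:
  assumes "bounded_clinear A" "bounded_clinear B"
  shows "bounded_clinear (\<lambda>x. A x + B x)"
proof -
  obtain b where "\<And>x. norm (A x + B x) \<le> norm x * b"
    using bounded_linear.bounded[OF bounded_linear_add[OF assms[THEN bounded_clinear_imp_bounded_linear]]]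
    by blast
  then show ?thesis using assms
    by (intro bounded_clinearI[of _ b]) (simp_all add: bounded_clinear_def mult.commute scaleC_add_right)
qed

lemma bounded_clinear_uminus:
  assumes "bounded_clinear A" shows "bounded_clinear (\<lambda>x. - A x)"
  using assms by (auto simp: bounded_clinear_def)

lemma bounded_clinear_sub:
  assumes "bounded_clinear A" "bounded_clinear B"
  shows "bounded_clinear (\<lambda>x. A x - B x)"
  using bounded_clinear_plus[OF assms(1) bounded_clinear_uminus[OF assms(2)]] by simp

lemma bounded_clinear_on_UNIV: "bounded_op_on UNIV A \<longleftrightarrow> bounded_clinear A"
  by (simp add: bounded_op_on_def bounded_clinear_def)

text \<open>Supplies the closed subspaces for density arguments, and with \<open>B\<close> the
  identity shows that the fixed space of a bounded operator is a Hilbert subspace.\<close>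

lemma hilbert_subspace_eq_kernel:
  assumes "bounded_clinear A" "bounded_clinear B"
  shows "hilbert_subspace {x. A x = B x}"
  unfolding hilbert_subspace_def complex_vector.subspace_def
  using assms[THEN bounded_clinear_0] assms[unfolded bounded_clinear_def]
  by (auto intro!: closed_Collect_eq bounded_clinear_continuous_on[OF assms(1)]
      bounded_clinear_continuous_on[OF assms(2)] continuous_on_id)

lemma Riesz_representation:
  fixes f :: "'a::chilbert_space \<Rightarrow> complex"
  assumes add: "\<And>x y. f (x + y) = f x + f y" and scale: "\<And>c x. f (c *\<^sub>C x) = c * f x"
    and bound: "\<And>x. cmod (f x) \<le> b * norm x"
  obtains y where "\<And>x. f x = cinner x y"
proof (cases "\<forall>x. f x = 0")
  case True
  then show ?thesis using that[of 0] by simp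
next
  case False
  then obtain x0 where x0: "f x0 \<noteq> 0" by blast
  have bl: "bounded_linear f"
    by (rule bounded_linear_intro[of _ b])
      (auto simp: add scale scaleR_scaleC scaleR_conv_of_real mult.commute bound)
  have "hilbert_subspace {x. f x = 0}"
    unfolding hilbert_subspace_def complex_vector.subspace_def
    by (auto simp: add scale linear_0[OF bounded_linear.linear[OF bl]]
        intro!: closed_Collect_eq bounded_linear.continuous_on[OF bl])
  then obtain y where y: "f y = 0" "\<And>z. f z = 0 \<Longrightarrow> cinner (x0 - y) z = 0"
    using orthogonal_projection_exists[of "{x. f x = 0}" x0] by auto
  \<comment> \<open>The part of \<open>x0\<close> orthogonal to the kernel of \<open>f\<close>; the
    representing vector is a multiple of it.\<close>
  define u where "u = x0 - y"
  have fd: "f (a - b) = f a - f b" for a b using linear_diff[OF bounded_linear.linear[OF bl]] .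
  have fu: "f u = f x0" by (simp add: u_def fd y)
  have u0: "u \<noteq> 0" using fu x0 linear_0[OF bounded_linear.linear[OF bl]] by auto
  have "f x = cinner x ((cnj (f u) / cinner u u) *\<^sub>C u)" for x
  proof -
    \<comment> \<open>This combination lies in the kernel; its orthogonality to \<open>u\<close> is
      the desired formula up to the factor \<open>cinner u u\<close>.\<close>
    have "f (f u *\<^sub>C x - f x *\<^sub>C u) = 0" by (simp add: fd scale)
    from y(2)[OF this] have "cinner u (f u *\<^sub>C x - f x *\<^sub>C u) = 0" by (simp add: u_def)
    then have "cinner (f u *\<^sub>C x - f x *\<^sub>C u) u = 0" by (metis cinner_commute complex_cnj_zero)
    then have "f u * cinner x u = f x * cinner u u"
      by (simp add: cinner_diff_left cinner_scaleC_left)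
    moreover have "cnj (cinner u u) = cinner u u" by (metis cinner_commute)
    ultimately show ?thesis using u0 by (simp add: cinner_scaleC_right field_simps)
  qed
  then show ?thesis using that by blast
qed

definition adj :: "('a::chilbert_space \<Rightarrow> 'b::chilbert_space) \<Rightarrow> 'b \<Rightarrow> 'a" where
  "adj A y = (THE x. \<forall>z. cinner z x = cinner (A z) y)"

lemma cinner_adj_right:
  assumes A: "bounded_clinear A"
  shows "cinner z (adj A y) = cinner (A z) y"
proof -
  obtain b where b: "\<And>x. norm (A x) \<le> b * norm x" using A by (auto simp: bounded_clinear_def)
  have "\<exists>x. \<forall>z. cinner (A z) y = cinner z x"
  proof (rule Riesz_representation[of "\<lambda>z. cinner (A z) y" "b * norm y"])
    show "cmod (cinner (A x) y) \<le> (b * norm y) * norm x" for x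
      using norm_cinner_le[of "A x" y] mult_right_mono[OF b[of x], of "norm y"]
      by (simp add: mult_ac)
  qed (use A in \<open>auto simp: bounded_clinear_def cinner_add_left cinner_scaleC_left\<close>)
  then have "\<exists>!x. \<forall>z. cinner z x = cinner (A z) y" by (metis cinner_eqI)
  from theI'[OF this] show ?thesis by (simp add: adj_def)
qed

lemma cinner_adj_left:
  assumes A: "bounded_clinear A"
  shows "cinner (adj A y) z = cinner y (A z)"
  by (metis cinner_adj_right[OF A] cinner_commute)

lemma adj_eqI:
  assumes A: "bounded_clinear A" and "\<And>z. cinner z x = cinner (A z) y"
  shows "adj A y = x"
  by (rule cinner_eqI) (simp add: cinner_adj_right[OF A] assms(2))

lemma norm_adj_le:
  assumes A: "bounded_clinear A" and b: "\<And>x. norm (A x) \<le> b * norm x" and "0 \<le> b"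
  shows "norm (adj A y) \<le> b * norm y"
proof (cases "adj A y = 0")
  case False
  have "(norm (adj A y))\<^sup>2 = cmod (cinner (A (adj A y)) y)"
    by (simp flip: cinner_adj_right[OF A] add: cinner_self norm_power)
  also have "\<dots> \<le> norm (A (adj A y)) * norm y" by (rule norm_cinner_le)
  also have "\<dots> \<le> b * norm (adj A y) * norm y" by (intro mult_right_mono b) simp
  finally show ?thesis using False by (simp add: power2_eq_square)
qed (use \<open>0 \<le> b\<close> in simp)

lemma bounded_clinear_adj:
  assumes A: "bounded_clinear A"
  shows "bounded_clinear (adj A)"
proof -
  obtain b where b: "\<And>x. norm (A x) \<le> b * norm x" using A by (auto simp: bounded_clinear_def)
  have *: "norm (A x) \<le> max b 0 * norm x" for x
    using b[of x] by (rule order_trans) (intro mult_right_mono, auto)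
  show ?thesis
  proof (rule bounded_clinearI)
    show "norm (adj A y) \<le> max b 0 * norm y" for y
      by (rule norm_adj_le[OF A]) (use * in auto)
  qed (auto intro!: adj_eqI[OF A]
      simp: cinner_add_right cinner_scaleC_right cinner_adj_right[OF A])
qed

lemma adj_adj: "bounded_clinear A \<Longrightarrow> adj (adj A) = A"
  by (rule ext, rule adj_eqI[OF bounded_clinear_adj]) (simp_all add: cinner_adj_left)

lemma adj_comp:
  assumes "bounded_clinear A" "bounded_clinear B"
  shows "adj (\<lambda>x. A (B x)) y = adj B (adj A y)"
  by (rule adj_eqI[OF bounded_clinear_comp[OF assms]])
    (simp add: cinner_adj_right[OF assms(1)] cinner_adj_right[OF assms(2)])

lemma adj_commute:
  assumes "bounded_clinear A" "bounded_clinear B" "\<And>x. A (B x) = B (A x)"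
  shows "adj A (adj B x) = adj B (adj A x)"
  using adj_comp[OF assms(1,2)] adj_comp[OF assms(2,1)] assms(3) by simp

lemma contraction_adj:
  assumes "bounded_clinear A" "\<And>x. norm (A x) \<le> norm x"
  shows "norm (adj A x) \<le> norm x"
  using norm_adj_le[of A 1] assms by simp

section \<open>Direct sums of two Hilbert spaces\<close>

instantiation prod :: (complex_inner, complex_inner) complex_inner
begin

definition "c *\<^sub>C x = (c *\<^sub>C fst x, c *\<^sub>C snd x)"
definition "cinner x y = cinner (fst x) (fst y) + cinner (snd x) (snd y)"

instance
proof
  fix x y z :: "'a \<times> 'b"
  show "cinner x y = cnj (cinner y x)"
    unfolding cinner_prod_def complex_cnj_add by (simp flip: cinner_commute)
qed (auto simp: scaleC_prod_def cinner_prod_def scaleC_add_left scaleC_add_right scaleC_scaleC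
    scaleR_prod_def scaleR_scaleC cinner_add_left cinner_scaleC_left inner_prod_def
    inner_eq_Re_cinner distrib_left)

end

instance prod :: (chilbert_space, chilbert_space) chilbert_space ..

lemma scaleC_Pair [simp]: "c *\<^sub>C (x, y) = (c *\<^sub>C x, c *\<^sub>C y)"
  by (simp add: scaleC_prod_def)

lemma fst_scaleC [simp]: "fst (c *\<^sub>C x) = c *\<^sub>C fst x"
  and snd_scaleC [simp]: "snd (c *\<^sub>C x) = c *\<^sub>C snd x"
  by (simp_all add: scaleC_prod_def)

lemma cinner_Pair [simp]: "cinner (a, b) (c, d) = cinner a c + cinner b d"
  by (simp add: cinner_prod_def)

lemma norm_prod_sq: "(norm x)\<^sup>2 = (norm (fst x))\<^sup>2 + (norm (snd x))\<^sup>2"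
  by (simp add: norm_prod_def)

section \<open>Operators prescribed on a family of vectors\<close>

text \<open>Split \<open>x\<close> by the projection onto \<open>N\<close>: the remainder is
  orthogonal to \<open>N\<close>, hence to every \<open>a i\<close>, hence itself a member of
  \<open>N\<close>.\<close>

lemma closed_subspace_eq_UNIV:
  assumes N: "hilbert_subspace N" and aN: "\<And>i. i \<in> I \<Longrightarrow> a i \<in> N"
    and orth: "\<And>x. (\<And>i. i \<in> I \<Longrightarrow> cinner (a i) x = 0) \<Longrightarrow> x \<in> N"
  shows "x \<in> N"
proof -
  obtain y where y: "y \<in> N" "\<And>z. z \<in> N \<Longrightarrow> cinner (x - y) z = 0"
    using orthogonal_projection_exists[OF N] by metis
  have "cinner (a i) (x - y) = 0" if "i \<in> I" for i
    by (metis aN[OF that] y(2) cinner_commute complex_cnj_zero)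
  then have "x - y \<in> N" by (rule orth)
  then show ?thesis using y by fastforce
qed

text \<open>Operators obtained from \<open>contraction_extension\<close> are known on a generating
  family and vanish on its orthogonal complement; these two checks identify them.\<close>

lemma bounded_clinear_eqI:
  assumes "bounded_clinear A" "bounded_clinear B" "\<And>i. i \<in> I \<Longrightarrow> A (a i) = B (a i)"
    and "\<And>x. (\<And>i. i \<in> I \<Longrightarrow> cinner (a i) x = 0) \<Longrightarrow> A x = B x"
  shows "A x = B x"
  using closed_subspace_eq_UNIV[OF hilbert_subspace_eq_kernel[OF assms(1,2)], of I a x] assms(3,4)
  by simp

lemma hilbert_subspace_closure:
  assumes S: "complex_vector.subspace S"
  shows "hilbert_subspace (closure S)"
  unfolding hilbert_subspace_def complex_vector.subspace_def
proof (intro conjI ballI allI closed_closure)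
  show "0 \<in> closure S" using complex_vector.subspace_0[OF S] closure_subset by blast
  fix x y assume "x \<in> closure S" "y \<in> closure S"
  then obtain u v where "\<forall>n. u n \<in> S" "u \<longlonglongrightarrow> x" "\<forall>n. v n \<in> S" "v \<longlonglongrightarrow> y"
    unfolding closure_sequential by blast
  then show "x + y \<in> closure S" unfolding closure_sequential
    by (intro exI[of _ "\<lambda>n. u n + v n"] conjI tendsto_add allI complex_vector.subspace_add[OF S]) auto
next
  fix c x assume "x \<in> closure S"
  then obtain u where "\<forall>n. u n \<in> S" "u \<longlonglongrightarrow> x"
    unfolding closure_sequential by blast
  then show "c *\<^sub>C x \<in> closure S" unfolding closure_sequential
    by (intro exI[of _ "\<lambda>n. c *\<^sub>C u n"] conjI tendsto_scaleC tendsto_const allI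
        complex_vector.subspace_scale[OF S]) auto
qed

lemma fst_sum': "fst (sum f A) = (\<Sum>i\<in>A. fst (f i))"
  and snd_sum': "snd (sum f A) = (\<Sum>i\<in>A. snd (f i))"
  by (induction A rule: infinite_finite_induct) auto

lemma cinner_left_continuous: "continuous_on S (\<lambda>z. cinner x (z :: 'a::complex_inner))"
  using bounded_bilinear.continuous_on[OF bounded_bilinear_cinner continuous_on_const continuous_on_id]
  by (auto simp: id_def)

text \<open>The closed linear span of the pairs \<open>(a i, b i)\<close> is the graph of a contraction on the closed
  span of the \<open>a i\<close>; it is extended by zero on the orthogonal complement.\<close>

lemma contraction_extension:
  fixes a :: "'i \<Rightarrow> 'a::chilbert_space" and b :: "'i \<Rightarrow> 'b::chilbert_space"
  assumes le: "\<And>F c. finite F \<Longrightarrow> F \<subseteq> I \<Longrightarrow>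
      norm (\<Sum>i\<in>F. c i *\<^sub>C b i) \<le> norm (\<Sum>i\<in>F. c i *\<^sub>C a i)"
  obtains A where "bounded_clinear A" "\<And>x. norm (A x) \<le> norm x" "\<And>i. i \<in> I \<Longrightarrow> A (a i) = b i"
    "\<And>x. (\<And>i. i \<in> I \<Longrightarrow> cinner (a i) x = 0) \<Longrightarrow> A x = 0"
proof -
  define S where "S = complex_vector.span ((\<lambda>i. (a i, b i)) ` I)"
  define G where "G = closure S"
  have hG: "hilbert_subspace G"
    unfolding G_def S_def by (intro hilbert_subspace_closure complex_vector.subspace_span)
  then have sG: "complex_vector.subspace G" by (simp add: hilbert_subspace_def)
  have "norm (snd p) \<le> norm (fst p)" if "p \<in> S" for p
  proof -
    from that obtain t r where t: "finite t" "t \<subseteq> (\<lambda>i. (a i, b i)) ` I" "p = (\<Sum>v\<in>t. r v *\<^sub>C v)"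
      unfolding S_def complex_vector.span_explicit by blast
    \<comment> \<open>Different indices may give the same pair; one index is chosen per pair so that
      the sum over pairs can be reindexed.\<close>
    then obtain F where F: "F \<subseteq> I" "inj_on (\<lambda>i. (a i, b i)) F" "t = (\<lambda>i. (a i, b i)) ` F"
      by (auto simp: subset_image_inj)
    have "finite F" using t(1) F(2,3) finite_imageD by blast
    moreover have "p = (\<Sum>i\<in>F. r (a i, b i) *\<^sub>C (a i, b i))"
      unfolding t(3) F(3) by (simp add: sum.reindex[OF F(2)])
    ultimately show ?thesis using le[of F "\<lambda>i. r (a i, b i)"] F(1)
      by (simp add: fst_sum' snd_sum')
  qed
  then have "S \<subseteq> {p. norm (snd p) \<le> norm (fst p)}" by blast
  then have "G \<subseteq> {p. norm (snd p) \<le> norm (fst p)}" unfolding G_def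
    by (rule closure_minimal) (intro closed_Collect_le continuous_intros)
  then have Gle: "norm v \<le> norm u" if "(u, v) \<in> G" for u v using that by auto
  have Gadd: "(u + u', v + v') \<in> G" if "(u, v) \<in> G" "(u', v') \<in> G" for u v u' v'
    using complex_vector.subspace_add[OF sG that] by simp
  have Gdiff: "(u - u', v - v') \<in> G" if "(u, v) \<in> G" "(u', v') \<in> G" for u v u' v'
    using complex_vector.subspace_diff[OF sG that] by simp
  have Gscale: "(c *\<^sub>C u, c *\<^sub>C v) \<in> G" if "(u, v) \<in> G" for u v c
    using complex_vector.subspace_scale[OF sG that] by simp
  have G0: "(0, 0) \<in> G" using complex_vector.subspace_0[OF sG] by (simp add: zero_prod_def)
  have Gab: "(a i, b i) \<in> G" if "i \<in> I" for i
  proof -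
    have "(a i, b i) \<in> S" unfolding S_def using that by (intro complex_vector.span_base) blast
    then show ?thesis unfolding G_def using closure_subset by blast
  qed
  define N where "N = {u. \<exists>v. (u, v) \<in> G}"
  \<comment> \<open>On a closed graph whose second entries are dominated by the first, convergence
    of the first entries makes the second entries Cauchy, so the limit point is again in the
    domain.\<close>
  have clN: "closed N" unfolding closed_sequential_limits
  proof (intro allI impI, elim conjE)
    fix f u assume f: "\<forall>n. f n \<in> N" "f \<longlonglongrightarrow> u"
    then have "\<forall>n. \<exists>v. (f n, v) \<in> G" by (simp add: N_def)
    then obtain g where g: "\<And>n. (f n, g n) \<in> G" by metis
    have "Cauchy f" using f(2) by (rule LIMSEQ_imp_Cauchy)
    have "Cauchy g"
    proof (rule CauchyI)
      fix e :: real assume "0 < e"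
      then obtain M where "\<forall>m\<ge>M. \<forall>n\<ge>M. norm (f m - f n) < e"
        using CauchyD[OF \<open>Cauchy f\<close>] by blast
      moreover have "norm (g m - g n) \<le> norm (f m - f n)" for m n by (rule Gle[OF Gdiff[OF g g]])
      ultimately show "\<exists>M. \<forall>m\<ge>M. \<forall>n\<ge>M. norm (g m - g n) < e"
        by (meson order_le_less_trans)
    qed
    then obtain v where v: "g \<longlonglongrightarrow> v" using Cauchy_convergent convergent_def by blast
    have "(\<lambda>n. (f n, g n)) \<longlonglongrightarrow> (u, v)" by (intro tendsto_Pair f v)
    moreover have "closed G" by (simp add: G_def)
    ultimately have "(u, v) \<in> G" using g closed_sequentially[of G "\<lambda>n. (f n, g n)"] by simp
    then show "u \<in> N" by (auto simp: N_def)
  qed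
  have hN: "hilbert_subspace N"
    unfolding hilbert_subspace_def complex_vector.subspace_def
  proof (intro conjI ballI allI clN)
    show "0 \<in> N" using G0 by (auto simp: N_def)
    show "x + y \<in> N" if "x \<in> N" "y \<in> N" for x y using that Gadd unfolding N_def by blast
    show "c *\<^sub>C x \<in> N" if "x \<in> N" for c x using that Gscale unfolding N_def by blast
  qed
  \<comment> \<open>\<open>v\<close> is the image of the orthogonal projection of \<open>x\<close>
    onto the domain \<open>N\<close> of the graph.\<close>
  define R where "R x v \<longleftrightarrow> (\<exists>u. (u, v) \<in> G \<and> (\<forall>z\<in>N. cinner (x - u) z = 0))" for x v
  have R_ex: "\<exists>v. R x v" for x
  proof -
    obtain u where "u \<in> N" "\<And>z. z \<in> N \<Longrightarrow> cinner (x - u) z = 0"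
      using orthogonal_projection_exists[OF hN] by metis
    then show ?thesis unfolding R_def N_def by blast
  qed
  have R_uniq: "v = v'" if v: "R x v" and v': "R x v'" for x v v'
  proof -
    obtain u u' where u: "(u, v) \<in> G" "\<forall>z\<in>N. cinner (x - u) z = 0"
      and u': "(u', v') \<in> G" "\<forall>z\<in>N. cinner (x - u') z = 0"
      using v v' unfolding R_def by blast
    have d: "(u - u', v - v') \<in> G" using u u' by (intro Gdiff)
    then have "u - u' \<in> N" by (auto simp: N_def)
    then have "cinner (x - u') (u - u') - cinner (x - u) (u - u') = 0" using u u' by simp
    then have "u - u' = 0" by (simp flip: cinner_diff_left)
    then show ?thesis using Gle[OF d] by simp
  qed
  define A where "A x = (THE v. R x v)" for x
  have A_eqI: "A x = v" if "R x v" for x v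
    unfolding A_def using that R_uniq by (intro the_equality) auto
  have RA: "R x (A x)" for x using R_ex A_eqI by metis
  have "A (x + y) = A x + A y" for x y
  proof (rule A_eqI)
    obtain u v where uv: "(u, A x) \<in> G" "\<forall>z\<in>N. cinner (x - u) z = 0"
      "(v, A y) \<in> G" "\<forall>z\<in>N. cinner (y - v) z = 0" using RA[of x] RA[of y] unfolding R_def by blast
    have "\<forall>z\<in>N. cinner (x + y - (u + v)) z = 0"
      using uv(2,4) by (simp add: add_diff_add cinner_add_left)
    then show "R (x + y) (A x + A y)" unfolding R_def using Gadd[OF uv(1,3)] by blast
  qed
  moreover have "A (c *\<^sub>C x) = c *\<^sub>C A x" for c x
  proof (rule A_eqI)
    obtain u where u: "(u, A x) \<in> G" "\<forall>z\<in>N. cinner (x - u) z = 0" using RA[of x] unfolding R_def by blast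
    have "\<forall>z\<in>N. cinner (c *\<^sub>C x - c *\<^sub>C u) z = 0"
      unfolding scaleC_diff_right[symmetric] cinner_scaleC_left using u(2) by simp
    then show "R (c *\<^sub>C x) (c *\<^sub>C A x)" unfolding R_def using Gscale[OF u(1)] by blast
  qed
  moreover have A_le: "norm (A x) \<le> norm x" for x
  proof -
    obtain u where u: "(u, A x) \<in> G" "\<forall>z\<in>N. cinner (x - u) z = 0" using RA[of x] unfolding R_def by blast
    then have "cinner (x - u) u = 0" by (auto simp: N_def)
    then have "inner (x - u) u = 0" by (simp add: inner_eq_Re_cinner)
    then have "(norm x)\<^sup>2 = (norm (x - u))\<^sup>2 + (norm u)\<^sup>2"
      using norm_add_Pythagorean[of "x - u" u] by (simp add: orthogonal_def)
    then have "(norm u)\<^sup>2 \<le> (norm x)\<^sup>2" by simp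
    then have "norm u \<le> norm x" by (simp add: power2_le_iff_abs_le)
    then show ?thesis using Gle[OF u(1)] by simp
  qed
  ultimately have "bounded_clinear A" by (intro bounded_clinearI[of A 1]) simp_all
  moreover have "A (a i) = b i" if "i \<in> I" for i
  proof (rule A_eqI)
    show "R (a i) (b i)" unfolding R_def using Gab[OF that] by (intro exI[of _ "a i"]) simp
  qed
  moreover have "A x = 0" if x: "\<And>i. i \<in> I \<Longrightarrow> cinner (a i) x = 0" for x
  proof (rule A_eqI)
    have x': "cinner x (a i) = 0" if "i \<in> I" for i using x[OF that] by (metis cinner_commute complex_cnj_zero)
    have "S \<subseteq> {p. cinner x (fst p) = 0}" unfolding S_def
      by (rule complex_vector.span_minimal)
        (auto simp: complex_vector.subspace_def x' cinner_add_right cinner_scaleC_right)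
    then have "G \<subseteq> {p. cinner x (fst p) = 0}" unfolding G_def
      by (rule closure_minimal)
        (rule closed_Collect_eq[OF continuous_on_compose2[OF cinner_left_continuous[of UNIV]
          continuous_on_fst[OF continuous_on_id]] continuous_on_const], simp)
    then have "\<forall>z\<in>N. cinner (x - 0) z = 0" by (auto simp: N_def)
    then show "R x 0" unfolding R_def using G0 by blast
  qed
  ultimately show ?thesis using that A_le by metis
qed

text \<open>Polarization: equal norms give equal real inner products, and replacing \<open>x\<close>
  by \<open>(- \<i>) *\<^sub>C x\<close> gives the imaginary parts.\<close>

lemma norm_eq_imp_cinner_eq:
  assumes A: "bounded_clinear A" and B: "bounded_clinear B" and eq: "\<And>x. norm (A x) = norm (B x)"
  shows "cinner (A x) (A y) = cinner (B x) (B y)"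
proof -
  have inner: "inner (A x) (A y) = inner (B x) (B y)" for x y
    using eq[of "x + y"] eq[of x] eq[of y]
    by (simp add: dot_norm bounded_clinear_add[OF A] bounded_clinear_add[OF B])
  show ?thesis
    using inner[of x y] inner[of "(- \<i>) *\<^sub>C x" y]
    by (simp only: complex_eq_iff Im_cinner inner_eq_Re_cinner[symmetric]
        bounded_clinear_scaleC[OF A] bounded_clinear_scaleC[OF B])
qed

lemma isometry_adj:
  assumes A: "bounded_clinear A" and eq: "\<And>x. norm (A x) = norm x"
  shows "adj A (A x) = x"
  by (rule adj_eqI[OF A]) (metis norm_eq_imp_cinner_eq[OF A bounded_clinear_ident] eq)

text \<open>The squared norm of a finite combination is a quadratic form in the Gram kernel. With
  \<open>contraction_extension\<close>, two families with the same kernel are thereby mapped to each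
  other.\<close>

lemma norm_sum_eq_of_Gram_eq:
  assumes "\<And>i j. i \<in> F \<Longrightarrow> j \<in> F \<Longrightarrow> cinner (a i) (a j) = cinner (b i) (b j)"
  shows "norm (\<Sum>i\<in>F. c i *\<^sub>C a i) = norm (\<Sum>i\<in>F. c i *\<^sub>C b i)"
proof -
  have "cinner (\<Sum>i\<in>F. c i *\<^sub>C a i) (\<Sum>i\<in>F. c i *\<^sub>C a i)
      = cinner (\<Sum>i\<in>F. c i *\<^sub>C b i) (\<Sum>i\<in>F. c i *\<^sub>C b i)"
    unfolding cinner_sum_left cinner_sum_right cinner_scaleC_left cinner_scaleC_right
    using assms by (intro sum.cong) auto
  then show ?thesis by (simp add: cinner_self del: of_real_power flip: of_real_power)
qed

text \<open>The extension of the identity on the family by zero. Self-adjointness rests on the fact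
  that if a contraction fixes a vector, so does its adjoint.\<close>

lemma projection_onto_span:
  fixes a :: "'i \<Rightarrow> 'a::chilbert_space"
  obtains E where "bounded_clinear E" "\<And>x. norm (E x) \<le> norm x" "\<And>i. i \<in> I \<Longrightarrow> E (a i) = a i"
    "\<And>x. (\<And>i. i \<in> I \<Longrightarrow> cinner (a i) x = 0) \<Longrightarrow> E x = 0"
    "\<And>x. E (E x) = E x" "\<And>x. adj E x = E x"
proof -
  obtain E where E: "bounded_clinear E" "\<And>x. norm (E x) \<le> norm x" "\<And>i. i \<in> I \<Longrightarrow> E (a i) = a i"
    "\<And>x. (\<And>i. i \<in> I \<Longrightarrow> cinner (a i) x = 0) \<Longrightarrow> E x = 0"
    by (rule contraction_extension[of I a a, OF order_refl]) blast
  have EE: "E (E x) = E x" for x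
    by (rule bounded_clinear_eqI[OF bounded_clinear_comp[OF E(1,1)] E(1), of I a])
      (auto simp: E(3,4) bounded_clinear_0[OF E(1)])
  have adj_a: "adj E (a i) = a i" if "i \<in> I" for i
  proof -
    have "inner (adj E (a i)) (a i) = (norm (a i))\<^sup>2"
      using E(3)[OF that] by (simp add: inner_eq_Re_cinner cinner_adj_left[OF E(1)] cinner_self)
    then have "(norm (adj E (a i) - a i))\<^sup>2 = (norm (adj E (a i)))\<^sup>2 - (norm (a i))\<^sup>2"
      by (simp add: power2_norm_eq_inner inner_diff_left inner_diff_right inner_commute)
    also have "\<dots> \<le> 0"
      using contraction_adj[OF E(1,2), of "a i"] by (simp add: power_mono)
    finally show ?thesis by simp
  qed
  have *: "adj E y = E y" for y
  proof (rule bounded_clinear_eqI[OF bounded_clinear_adj[OF E(1)] E(1), of I a])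
    show "adj E (a i) = E (a i)" if "i \<in> I" for i
      using that by (simp add: adj_a E(3))
    fix x assume x: "\<And>i. i \<in> I \<Longrightarrow> cinner (a i) x = 0"
    have "cinner (a i) (adj E x) = 0" if "i \<in> I" for i
      using that x by (simp add: cinner_adj_right[OF E(1)] E(3))
    then have "E (adj E x) = 0" by (rule E(4))
    then have "cinner (adj E x) (adj E x) = 0" by (simp add: cinner_adj_right[OF E(1)])
    then show "adj E x = E x" using E(4)[OF x] by simp
  qed
  from that[OF E EE *] show ?thesis .
qed

section \<open>Square roots\<close>

text \<open>The summands are the Taylor coefficients of (1 - t)^(1/2). Dividing a power series by 1
  - t forms partial sums, and the quotient (1 - t)^(-1/2) has the coefficients on the right.\<close>

lemma sum_pochhammer_minus_half:
  "(\<Sum>k\<le>n. pochhammer (- 1 / 2) k / fact k) = pochhammer (1 / 2 :: real) n / fact n"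
proof (induction n)
  case (Suc n)
  define p where "p = pochhammer (1 / 2 :: real) n"
  have 1: "pochhammer (- 1 / 2) (Suc n) = (- 1 / 2 :: real) * p"
    by (simp add: pochhammer_rec p_def)
  have 2: "pochhammer (1 / 2) (Suc n) = p * (1 / 2 + n)"
    unfolding p_def by (rule pochhammer_Suc)
  have "p / fact n + (- 1 / 2) * p / (fact n * (1 + real n)) = p * (1 / 2 + n) / (fact n * (1 + real n))"
    by (simp add: divide_simps) (simp add: algebra_simps)
  then show ?case
    unfolding sum.atMost_Suc Suc.IH 1 2 p_def[symmetric] by (simp add: mult.commute)
qed simp

text \<open>All coefficients beyond index 0 are nonpositive while the partial sums stay nonnegative,
  so the absolute values beyond index 0 add up to at most 1.\<close>

lemma summable_sqrt_coeffs: "summable (\<lambda>k. \<bar>pochhammer (- 1 / 2 :: real) k / fact k\<bar>)"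
proof -
  let ?b = "\<lambda>k. pochhammer (- 1 / 2 :: real) k / fact k"
  have nonpos: "?b (Suc k) \<le> 0" for k
    using pochhammer_nonneg[of "1/2::real" k]
    by (simp add: pochhammer_rec divide_le_0_iff mult_le_0_iff)
  have "summable (\<lambda>k. \<bar>?b (Suc k)\<bar>)"
  proof (rule summableI_nonneg_bounded[where x = 1])
    fix n
    have "(\<Sum>k<n. \<bar>?b (Suc k)\<bar>) = - (\<Sum>k<n. ?b (Suc k))"
      unfolding sum_negf[symmetric] by (intro sum.cong refl abs_of_nonpos nonpos)
    also have "(\<Sum>k<n. ?b (Suc k)) = (\<Sum>k\<le>n. ?b k) - 1"
      by (simp add: sum.atMost_shift)
    finally show "(\<Sum>k<n. \<bar>?b (Suc k)\<bar>) \<le> 1"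
      unfolding sum_pochhammer_minus_half using pochhammer_nonneg[of "1/2::real" n] by simp
  qed simp
  then show ?thesis by (subst (asm) summable_Suc_iff)
qed

text \<open>The square of the series for (1 - t)^(1/2) is 1 - t; on coefficients this is the
  Vandermonde identity for \<open>pochhammer\<close>, with -1/2 taken twice giving -1.\<close>

lemma sqrt_coeffs_convolution:
  "(\<Sum>i\<le>n. (pochhammer (- 1 / 2) i / fact i) * (pochhammer (- 1 / 2) (n - i) / fact (n - i)))
     = (if n = 0 then 1 else if n = 1 then - 1 else 0 :: real)"
proof -
  have "(\<Sum>i\<le>n. (pochhammer (- 1 / 2) i / fact i) * (pochhammer (- 1 / 2) (n - i) / fact (n - i)))
     = (\<Sum>i\<le>n. of_nat (n choose i) * pochhammer (- 1 / 2 :: real) i * pochhammer (- 1 / 2) (n - i)) / fact n"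
    unfolding sum_divide_distrib by (intro sum.cong refl) (simp add: binomial_fact)
  also have "\<dots> = pochhammer (- 1 :: real) n / fact n"
    by (simp flip: pochhammer_binomial_sum)
  also have "\<dots> = (if n = 0 then 1 else if n = 1 then - 1 else 0)"
  proof (cases n)
    case (Suc m)
    then show ?thesis by (cases m) (simp_all add: pochhammer_rec)
  qed simp
  finally show ?thesis .
qed

lemma bounded_clinear_funpow:
  fixes B :: "'a::chilbert_space \<Rightarrow> 'a"
  assumes B: "bounded_clinear B"
  shows "bounded_clinear (B ^^ k)"
proof (induction k)
  case (Suc k)
  show ?case using bounded_clinear_comp[OF B Suc.IH] by (simp add: comp_def)
qed (simp add: id_def)

lemma contraction_funpow:
  fixes B :: "'a::real_normed_vector \<Rightarrow> 'a"
  assumes "\<And>x. norm (B x) \<le> norm x"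
  shows "norm ((B ^^ k) x) \<le> norm x"
proof (induction k)
  case (Suc k)
  then show ?case using assms[of "(B ^^ k) x"] by simp
qed simp

text \<open>The power series of \<open>sqrt (1 - B)\<close> converges in norm because its coefficients are absolutely
  summable, so that no functional calculus is needed.\<close>

lemma sqrt_one_minus_exists:
  fixes B :: "'a::chilbert_space \<Rightarrow> 'a"
  assumes B: "bounded_clinear B" and contr: "\<And>x. norm (B x) \<le> norm x"
    and selfadj: "\<And>x. adj B x = B x"
  obtains D where "bounded_clinear D" "\<And>x. adj D x = D x" "\<And>x. D (D x) = x - B x"
    "\<And>C x. bounded_clinear C \<Longrightarrow> (\<And>y. C (B y) = B (C y)) \<Longrightarrow> C (D x) = D (C x)"
proof -
  define b where "b k = pochhammer (- 1 / 2 :: real) k / fact k" for k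
  have sb: "summable (\<lambda>k. \<bar>b k\<bar>)" unfolding b_def by (rule summable_sqrt_coeffs)
  note Bk = bounded_clinear_funpow[OF B] and Bk_le = contraction_funpow[OF contr]
  have le: "norm (b k *\<^sub>R (B ^^ k) x) \<le> \<bar>b k\<bar> * norm x" for k x
    using mult_left_mono[OF Bk_le[of k x], of "\<bar>b k\<bar>"] by simp
  have sn: "summable (\<lambda>k. norm (b k *\<^sub>R (B ^^ k) x))" for x
    by (rule summable_comparison_test'[OF summable_mult2[OF sb, of "norm x"]]) (use le in simp)
  have s: "summable (\<lambda>k. b k *\<^sub>R (B ^^ k) x)" for x by (rule summable_norm_cancel[OF sn])
  define D where "D x = (\<Sum>k. b k *\<^sub>R (B ^^ k) x)" for x
  have D: "bounded_clinear D"
  proof (rule bounded_clinearI)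
    show "D (x + y) = D x + D y" for x y
      unfolding D_def using suminf_add[OF s s]
      by (simp add: bounded_clinear_add[OF Bk] scaleR_add_right)
    show "D (c *\<^sub>C x) = c *\<^sub>C D x" for c x
      unfolding D_def
        bounded_linear.suminf[OF bounded_bilinear.bounded_linear_right[OF bounded_bilinear_scaleC] s]
      by (simp add: bounded_clinear_scaleC[OF Bk] scaleR_scaleC scaleC_scaleC mult.commute)
    show "norm (D x) \<le> (\<Sum>k. \<bar>b k\<bar>) * norm x" for x
      unfolding D_def suminf_mult2[OF sb]
      using summable_norm[OF sn] suminf_le[OF le sn summable_mult2[OF sb]] by (rule order_trans)
  qed
  have comm: "C (D x) = D (C x)"
    if C: "bounded_clinear C" and CB: "\<And>y. C (B y) = B (C y)" for C x
  proof -
    have CBk: "C ((B ^^ k) y) = (B ^^ k) (C y)" for k y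
      by (induction k) (simp_all add: CB)
    note Cl = bounded_clinear_imp_bounded_linear[OF C]
    show ?thesis
      unfolding D_def bounded_linear.suminf[OF Cl s]
      by (simp add: linear_scale[OF bounded_linear.linear[OF Cl]] CBk)
  qed
  have adjBk: "cinner ((B ^^ k) x) y = cinner x ((B ^^ k) y)" for k x y
  proof (induction k arbitrary: y)
    case (Suc k)
    have "cinner (B ((B ^^ k) x)) y = cinner ((B ^^ k) x) (B y)"
      by (metis cinner_adj_right[OF B] selfadj)
    then show ?case using Suc by (simp add: funpow_swap1)
  qed simp
  have "adj D x = D x" for x
  proof (rule adj_eqI[OF D])
    fix z
    show "cinner z (D x) = cinner (D z) x"
      unfolding D_def
        bounded_linear.suminf[OF bounded_bilinear.bounded_linear_left[OF bounded_bilinear_cinner] s]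
        bounded_linear.suminf[OF bounded_bilinear.bounded_linear_right[OF bounded_bilinear_cinner] s]
      by (simp add: scaleR_scaleC cinner_scaleC_left cinner_scaleC_right adjBk)
  qed
  moreover have "D (D x) = x - B x" for x
  proof -
    \<comment> \<open>The terms of the Cauchy product for \<open>D (D x)\<close>. Absolute
      summability over all pairs permits regrouping by \<open>k + j\<close>, after which only
      degrees 0 and 1 survive.\<close>
    define f where "f = (\<lambda>(k, j). (b k * b j) *\<^sub>R (B ^^ (k + j)) x)"
    have bs: "(\<lambda>k. \<bar>b k\<bar>) summable_on UNIV"
      using sb by (simp add: summable_on_UNIV_nonneg_real_iff)
    have "(\<lambda>p. norm (case p of (k, j) \<Rightarrow> b k * b j)) summable_on Sigma UNIV (\<lambda>_. UNIV)"
      unfolding Infinite_Sum.abs_summable_on_Sigma_iff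
      using summable_on_cmult_right[OF bs] summable_on_cmult_left[OF bs]
      by (simp add: abs_mult infsum_cmult_right')
    then have "(\<lambda>p. norm (case p of (k, j) \<Rightarrow> b k * b j) * norm x) summable_on Sigma UNIV (\<lambda>_. UNIV)"
      by (rule summable_on_cmult_left)
    moreover have "norm (f p) \<le> norm (case p of (k, j) \<Rightarrow> b k * b j) * norm x" for p
      using mult_left_mono[OF Bk_le[of "fst p + snd p" x], of "\<bar>b (fst p)\<bar> * \<bar>b (snd p)\<bar>"]
      by (simp add: f_def abs_mult split_beta)
    ultimately have fs: "f summable_on UNIV \<times> UNIV"
      by (rule Infinite_Sum.abs_summable_on_comparison_test'[THEN abs_summable_summable])
    have eqD: "D y = (\<Sum>\<^sub>\<infinity>k. b k *\<^sub>R (B ^^ k) y)" for y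
      unfolding D_def by (rule infsumI[OF norm_summable_imp_has_sum[OF sn summable_sums[OF s]], symmetric])
    have "D (D x) = (\<Sum>\<^sub>\<infinity>k. b k *\<^sub>R (B ^^ k) (D x))" by (rule eqD)
    also have "\<dots> = (\<Sum>\<^sub>\<infinity>k. \<Sum>\<^sub>\<infinity>j. f (k, j))"
    proof (rule infsum_cong)
      fix k
      have BB: "(B ^^ j) ((B ^^ k) x) = (B ^^ (k + j)) x" for j
        by (metis add.commute comp_apply funpow_add)
      have "(B ^^ k) (B y) = B ((B ^^ k) y)" for y by (simp add: funpow_swap1)
      then have "(B ^^ k) (D x) = D ((B ^^ k) x)" by (rule comm[OF Bk])
      then have "b k *\<^sub>R (B ^^ k) (D x) = b k *\<^sub>R D ((B ^^ k) x)" by (rule arg_cong)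
      also have "\<dots> = (\<Sum>\<^sub>\<infinity>j. b k *\<^sub>R b j *\<^sub>R (B ^^ j) ((B ^^ k) x))"
        unfolding eqD by (rule infsum_scaleR_right[symmetric])
      finally show "b k *\<^sub>R (B ^^ k) (D x) = (\<Sum>\<^sub>\<infinity>j. f (k, j))"
        by (simp add: f_def BB)
    qed
    also have "\<dots> = infsum f (UNIV \<times> UNIV)"
      by (rule infsum_Sigma_banach[OF fs])
    also have "\<dots> = infsum (\<lambda>(n, i). f (i, n - i)) (Sigma UNIV (\<lambda>n. {..n}))"
      by (rule infsum_reindex_bij_witness[of _ "\<lambda>(n, i). (i, n - i)" "\<lambda>(k, j). (k + j, k)"]) auto
    also have "\<dots> = (\<Sum>\<^sub>\<infinity>n. \<Sum>\<^sub>\<infinity>i\<in>{..n}. f (i, n - i))"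
    proof (rule infsum_Sigma_banach[symmetric, where f = "\<lambda>(n, i). f (i, n - i)", simplified])
      have "(\<lambda>(n, i). f (i, n - i)) summable_on Sigma UNIV (\<lambda>n. {..n}) \<longleftrightarrow> f summable_on UNIV \<times> UNIV"
        by (rule summable_on_reindex_bij_witness[of _ "\<lambda>(k, j). (k + j, k)" "\<lambda>(n, i). (i, n - i)"]) auto
      then show "(\<lambda>(n, i). f (i, n - i)) summable_on Sigma UNIV (\<lambda>n. {..n})" using fs by blast
    qed
    also have "\<dots> = (\<Sum>\<^sub>\<infinity>n. (if n = 0 then 1 else if n = 1 then - 1 else 0) *\<^sub>R (B ^^ n) x)"
      by (simp add: f_def sqrt_coeffs_convolution[folded b_def] flip: scaleR_sum_left)
    also have "\<dots> = (\<Sum>n\<in>{0, 1}. (if n = 0 then 1 else if n = 1 then - 1 else 0) *\<^sub>R (B ^^ n) x)"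
      by (rule trans[OF infsum_cong_neutral infsum_finite]) auto
    also have "\<dots> = x - B x" by simp
    finally show ?thesis .
  qed
  ultimately show ?thesis by (rule that[OF D _ _ comm])
qed

section \<open>Operators on sequence spaces\<close>

lemma isometric_embedding_imp_bounded_clinear: "isometric_embedding J K \<Longrightarrow> bounded_clinear J"
  by (auto simp: isometric_embedding_def intro!: bounded_clinearI[of J 1])

lemma Rep_ell2_Abs: "summable (\<lambda>n. (norm (f n))\<^sup>2) \<Longrightarrow> Rep_ell2 (Abs_ell2 f) = f"
  by (simp add: Abs_ell2_inverse)

definition ell2_map :: "('a::chilbert_space \<Rightarrow> 'b::chilbert_space) \<Rightarrow> 'a ell2 \<Rightarrow> 'b ell2" where
  "ell2_map A f = Abs_ell2 (\<lambda>n. A (Rep_ell2 f n))"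

lemma Rep_ell2_map:
  assumes A: "bounded_clinear A"
  shows "Rep_ell2 (ell2_map A f) n = A (Rep_ell2 f n)"
proof -
  obtain b where b: "\<And>x. norm (A x) \<le> b * norm x" using A by (auto simp: bounded_clinear_def)
  have "summable (\<lambda>n. (norm (A (Rep_ell2 f n)))\<^sup>2)"
  proof (rule summable_comparison_test')
    show "summable (\<lambda>n. b\<^sup>2 * (norm (Rep_ell2 f n))\<^sup>2)"
      by (rule summable_mult[OF summable_Rep_ell2])
    show "norm ((norm (A (Rep_ell2 f n)))\<^sup>2) \<le> b\<^sup>2 * (norm (Rep_ell2 f n))\<^sup>2" for n
      using power_mono[OF b[of "Rep_ell2 f n"], of 2] by (simp add: power_mult_distrib)
  qed
  then show ?thesis by (simp add: ell2_map_def Rep_ell2_Abs)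
qed

lemma norm_ell2_map_le:
  assumes A: "bounded_clinear A" and b: "\<And>x. norm (A x) \<le> b * norm x" "0 \<le> b"
  shows "norm (ell2_map A f) \<le> b * norm f"
proof (rule power2_le_imp_le)
  have "(norm (ell2_map A f))\<^sup>2 \<le> (\<Sum>n. b\<^sup>2 * (norm (Rep_ell2 f n))\<^sup>2)"
    unfolding norm_ell2_sq
  proof (rule suminf_le)
    show "(norm (Rep_ell2 (ell2_map A f) n))\<^sup>2 \<le> b\<^sup>2 * (norm (Rep_ell2 f n))\<^sup>2" for n
      using power_mono[OF b(1)[of "Rep_ell2 f n"], of 2]
      by (simp add: power_mult_distrib Rep_ell2_map[OF A])
  qed (intro summable_Rep_ell2 summable_mult)+
  then show "(norm (ell2_map A f))\<^sup>2 \<le> (b * norm f)\<^sup>2"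
    by (simp add: suminf_mult[OF summable_Rep_ell2] power_mult_distrib norm_ell2_sq)
qed (use b(2) in simp)

lemma bounded_clinear_ell2_map:
  assumes A: "bounded_clinear A"
  shows "bounded_clinear (ell2_map A)"
proof -
  obtain b where b: "\<And>x. norm (A x) \<le> b * norm x" using A by (auto simp: bounded_clinear_def)
  have b': "norm (A x) \<le> max b 0 * norm x" for x
    using b[of x] by (rule order_trans) (intro mult_right_mono, auto)
  show ?thesis
  proof (rule bounded_clinearI)
    show "ell2_map A (x + y) = ell2_map A x + ell2_map A y" for x y
      by (rule ell2_eqI) (simp add: Rep_ell2_map[OF A] Rep_add bounded_clinear_add[OF A])
    show "ell2_map A (c *\<^sub>C x) = c *\<^sub>C ell2_map A x" for c x
      by (rule ell2_eqI) (simp add: Rep_ell2_map[OF A] Rep_scaleC bounded_clinear_scaleC[OF A])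
    show "norm (ell2_map A x) \<le> max b 0 * norm x" for x
      by (rule norm_ell2_map_le[OF A b']) simp
  qed
qed

lemma norm_ell2_map:
  assumes "bounded_clinear A" "\<And>x. norm (A x) = norm x"
  shows "norm (ell2_map A f) = norm f"
proof -
  have "(norm (ell2_map A f))\<^sup>2 = (norm f)\<^sup>2"
    unfolding norm_ell2_sq by (simp add: Rep_ell2_map assms)
  then show ?thesis by simp
qed

lemma ell2_map_comp:
  assumes "bounded_clinear A" "bounded_clinear B"
  shows "ell2_map A (ell2_map B f) = ell2_map (\<lambda>x. A (B x)) f"
  by (rule ell2_eqI) (simp add: Rep_ell2_map assms bounded_clinear_comp)

lemma adj_ell2_map:
  assumes A: "bounded_clinear A"
  shows "adj (ell2_map A) = ell2_map (adj A)"
  by (rule ext, rule adj_eqI[OF bounded_clinear_ell2_map[OF A]])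
    (simp add: cinner_ell2_def Rep_ell2_map A bounded_clinear_adj cinner_adj_right)

definition ell2_single :: "nat \<Rightarrow> 'a::chilbert_space \<Rightarrow> 'a ell2" where
  "ell2_single n x = Abs_ell2 (\<lambda>k. if k = n then x else 0)"

lemma Rep_ell2_single: "Rep_ell2 (ell2_single n x) k = (if k = n then x else 0)"
proof -
  have "summable (\<lambda>k. (norm (if k = n then x else 0))\<^sup>2)"
    by (rule summable_finite[of "{n}"]) auto
  then show ?thesis by (simp add: ell2_single_def Rep_ell2_Abs)
qed

lemma norm_ell2_single [simp]: "norm (ell2_single n x) = norm x"
proof -
  have "(norm (ell2_single n x))\<^sup>2 = (\<Sum>k\<in>{n}. (norm (Rep_ell2 (ell2_single n x) k))\<^sup>2)"
    unfolding norm_ell2_sq by (rule suminf_finite) (auto simp: Rep_ell2_single)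
  then show ?thesis by (simp add: Rep_ell2_single)
qed

lemma isometric_embedding_ell2_single: "isometric_embedding (ell2_single n) UNIV"
  by (auto simp: isometric_embedding_def Rep_ell2_single Rep_add Rep_scaleC intro!: ell2_eqI)

text \<open>Flattens a square-summable sequence of sequences along a pairing of the naturals. It
  brings auxiliary spaces built over \<open>'h ell2\<close> back into that type.\<close>

definition ell2_join :: "'a::chilbert_space ell2 ell2 \<Rightarrow> 'a ell2" where
  "ell2_join f = Abs_ell2 (\<lambda>n. case prod_decode n of (i, j) \<Rightarrow> Rep_ell2 (Rep_ell2 f i) j)"

text \<open>Unconditional summation justifies both the iterated sum over pairs and the reindexing by
  \<open>prod_decode\<close>.\<close>

lemma ell2_join_sums:
  "(\<lambda>n. (norm (case prod_decode n of (i, j) \<Rightarrow> Rep_ell2 (Rep_ell2 f i) j))\<^sup>2) sums (norm f)\<^sup>2"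
proof -
  define g where "g = (\<lambda>(i, j). (norm (Rep_ell2 (Rep_ell2 f i) j))\<^sup>2)"
  have 1: "((\<lambda>j. (norm (Rep_ell2 x j))\<^sup>2) has_sum (norm x)\<^sup>2) UNIV" for x :: "'b::chilbert_space ell2"
    using norm_summable_imp_has_sum[of "\<lambda>j. (norm (Rep_ell2 x j))\<^sup>2", OF _ summable_sums]
    by (simp add: summable_Rep_ell2 norm_ell2_sq)
  have inner: "((\<lambda>j. g (i, j)) has_sum (norm (Rep_ell2 f i))\<^sup>2) UNIV" for i
    unfolding g_def prod.case by (rule 1)
  have "g summable_on Sigma UNIV (\<lambda>_. UNIV)"
    by (rule summable_on_SigmaI[OF inner]) (auto simp: g_def intro: has_sum_imp_summable[OF 1])
  with inner 1 have "(g has_sum (norm f)\<^sup>2) (Sigma UNIV (\<lambda>_. UNIV))"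
    by (rule has_sum_SigmaI)
  then have "((\<lambda>n. g (prod_decode n)) has_sum (norm f)\<^sup>2) UNIV"
    using has_sum_reindex_bij_betw[OF bij_prod_decode, of g] by simp
  then show ?thesis
    by (simp add: has_sum_imp_sums g_def split_beta)
qed

lemma Rep_ell2_join:
  "Rep_ell2 (ell2_join f) n = (case prod_decode n of (i, j) \<Rightarrow> Rep_ell2 (Rep_ell2 f i) j)"
  by (simp add: ell2_join_def Rep_ell2_Abs[OF sums_summable[OF ell2_join_sums]])

lemma isometric_embedding_ell2_join: "isometric_embedding (ell2_join :: 'a::chilbert_space ell2 ell2 \<Rightarrow> _) UNIV"
proof -
  have "(norm (ell2_join f))\<^sup>2 = (norm f)\<^sup>2" for f :: "'a ell2 ell2"
    unfolding norm_ell2_sq[of "ell2_join f"] Rep_ell2_join by (rule sums_unique[OF ell2_join_sums, symmetric])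
  then have "norm (ell2_join f) = norm f" for f :: "'a ell2 ell2"
    by (metis norm_ge_zero power2_eq_iff_nonneg)
  then show ?thesis unfolding isometric_embedding_def
    by (auto intro!: ell2_eqI simp: Rep_ell2_join Rep_add Rep_scaleC split: prod.split)
qed

lemma isometric_embedding_comp:
  assumes "isometric_embedding A UNIV" "isometric_embedding B UNIV"
  shows "isometric_embedding (\<lambda>x. A (B x)) UNIV"
  using assms by (simp add: isometric_embedding_def)

lemma isometric_embedding_ell2_map:
  assumes "isometric_embedding A UNIV"
  shows "isometric_embedding (ell2_map A) UNIV"
  using bounded_clinear_ell2_map[OF isometric_embedding_imp_bounded_clinear[OF assms]]
    norm_ell2_map[OF isometric_embedding_imp_bounded_clinear[OF assms]] assms
  by (simp add: isometric_embedding_def bounded_clinear_def)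

lemma ell2_embeds:
  fixes A :: "'x::chilbert_space \<Rightarrow> 'h::chilbert_space ell2"
  assumes "isometric_embedding A UNIV"
  shows "\<exists>B :: 'x ell2 \<Rightarrow> 'h ell2. isometric_embedding B UNIV"
  using isometric_embedding_comp[OF isometric_embedding_ell2_join isometric_embedding_ell2_map[OF assms]]
  by blast

lemma prod_embeds:
  fixes A :: "'x::chilbert_space \<Rightarrow> 'h::chilbert_space ell2"
    and B :: "'y::chilbert_space \<Rightarrow> 'h ell2"
  assumes A: "isometric_embedding A UNIV" and B: "isometric_embedding B UNIV"
  shows "\<exists>C :: 'x \<times> 'y \<Rightarrow> 'h ell2. isometric_embedding C UNIV"
proof -
  \<comment> \<open>The two summands become entries 0 and 1 of a sequence of sequences, which
    \<open>ell2_join\<close> then flattens.\<close>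
  define D where "D p = ell2_single 0 (A (fst p)) + ell2_single (Suc 0) (B (snd p))" for p
  have "(norm (D p))\<^sup>2 = (\<Sum>k\<in>{0, Suc 0}. (norm (Rep_ell2 (D p) k))\<^sup>2)" for p
    unfolding norm_ell2_sq by (rule suminf_finite) (auto simp: D_def Rep_add Rep_ell2_single Rep_zero)
  then have "(norm (D p))\<^sup>2 = (norm p)\<^sup>2" for p
    using A B by (simp add: D_def Rep_add Rep_ell2_single Rep_zero norm_prod_sq isometric_embedding_def)
  then have "norm (D p) = norm p" for p
    by (metis norm_ge_zero power2_eq_iff_nonneg)
  moreover have "D (x + y) = D x + D y" "D (c *\<^sub>C x) = c *\<^sub>C D x" for x y c
    using A B by (auto simp: D_def isometric_embedding_def Rep_add Rep_scaleC Rep_ell2_single Rep_zero intro!: ell2_eqI)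
  ultimately have "isometric_embedding D UNIV" by (simp add: isometric_embedding_def)
  then show ?thesis using isometric_embedding_comp[OF isometric_embedding_ell2_join] by blast
qed

text \<open>With \<open>C f = \<Sum>n. (1/2)^(n+1) L\<^sub>n f\<^sub>n\<close> from \<open>'h ell2\<close> to \<open>'k\<close>, the square root of \<open>C\<^sup>* C\<close> has the
  same Gram kernel as \<open>C\<close> but takes values in \<open>'h ell2\<close>, so no dimension count is needed.\<close>

lemma realize_Gram_in_ell2:
  fixes L :: "'i \<Rightarrow> 'h::chilbert_space \<Rightarrow> 'k::chilbert_space"
  assumes "countable I"
    and L: "\<And>i. i \<in> I \<Longrightarrow> bounded_clinear (L i)" "\<And>i x. i \<in> I \<Longrightarrow> norm (L i x) \<le> norm x"
  obtains L' :: "'i \<Rightarrow> 'h \<Rightarrow> 'h ell2" where "\<And>i. i \<in> I \<Longrightarrow> bounded_clinear (L' i)"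
    "\<And>i j x y. i \<in> I \<Longrightarrow> j \<in> I \<Longrightarrow> cinner (L' i x) (L' j y) = cinner (L i x) (L j y)"
proof (cases "I = {}")
  case True
  then show ?thesis using that by blast
next
  case False
  define M where "M n = L (from_nat_into I n)" for n
  have M: "bounded_clinear (M n)" "norm (M n x) \<le> norm x" for n x
    using L from_nat_into[OF False] by (auto simp: M_def)
  \<comment> \<open>Positive weights of total mass 1: since each entry of \<open>f\<close> is
    bounded by \<open>norm f\<close>, the series converges in norm and \<open>C\<close> is a
    contraction.\<close>
  define w :: "nat \<Rightarrow> real" where "w n = (1/2) ^ Suc n" for n
  have w: "w sums 1" unfolding w_def by (rule power_half_series)
  have le: "norm (w n *\<^sub>R M n (Rep_ell2 f n)) \<le> w n * norm f" for n f
    using order_trans[OF M(2) norm_Rep_ell2_le] by (simp add: w_def mult_left_mono)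
  have sw: "summable (\<lambda>n. w n * norm f)" for f :: "'h ell2"
    using w by (intro summable_mult2) (rule sums_summable)
  have sn: "summable (\<lambda>n. norm (w n *\<^sub>R M n (Rep_ell2 f n)))" for f
    by (rule summable_comparison_test'[OF sw]) (use le in simp)
  have s: "summable (\<lambda>n. w n *\<^sub>R M n (Rep_ell2 f n))" for f by (rule summable_norm_cancel[OF sn])
  define C where "C f = (\<Sum>n. w n *\<^sub>R M n (Rep_ell2 f n))" for f
  have C_le: "norm (C f) \<le> norm f" for f
  proof -
    have "norm (C f) \<le> (\<Sum>n. w n * norm f)" unfolding C_def
      using summable_norm[OF sn] suminf_le[OF le sn sw] by (rule order_trans)
    also have "\<dots> = norm f" using sums_mult2[OF w, of "norm f"] by (simp add: sums_iff)
    finally show ?thesis .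
  qed
  have C: "bounded_clinear C"
  proof (rule bounded_clinearI[where b = 1])
    show "C (x + y) = C x + C y" for x y
      unfolding C_def using suminf_add[OF s s]
      by (simp add: Rep_add bounded_clinear_add[OF M(1)] scaleR_add_right)
    show "C (c *\<^sub>C x) = c *\<^sub>C C x" for c x
      unfolding C_def
        bounded_linear.suminf[OF bounded_bilinear.bounded_linear_right[OF bounded_bilinear_scaleC] s]
      by (simp add: Rep_scaleC bounded_clinear_scaleC[OF M(1)] scaleR_scaleC scaleC_scaleC mult.commute)
  qed (simp add: C_le)
  have C_single: "C (ell2_single n x) = w n *\<^sub>R M n x" for n x
  proof -
    have "C (ell2_single n x) = (\<Sum>k\<in>{n}. w k *\<^sub>R M k (Rep_ell2 (ell2_single n x) k))"
      unfolding C_def by (rule suminf_finite) (auto simp: Rep_ell2_single bounded_clinear_0[OF M(1)])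
    then show ?thesis by (simp add: Rep_ell2_single)
  qed
  \<comment> \<open>Chosen so that \<open>x - B x = adj C (C x)\<close>, the form to which
    \<open>sqrt_one_minus_exists\<close> applies.\<close>
  define B where "B x = x - adj C (C x)" for x
  have CC: "bounded_clinear (\<lambda>x. adj C (C x))" by (rule bounded_clinear_comp[OF bounded_clinear_adj[OF C] C])
  have B: "bounded_clinear B" unfolding B_def by (rule bounded_clinear_sub[OF bounded_clinear_ident CC])
  have B_le: "norm (B x) \<le> norm x" for x
  proof (rule power2_le_imp_le)
    have "inner x (adj C (C x)) = (norm (C x))\<^sup>2"
      by (simp add: inner_eq_Re_cinner cinner_adj_right[OF C] cinner_self)
    then have "(norm (B x))\<^sup>2 = (norm x)\<^sup>2 - 2 * (norm (C x))\<^sup>2 + (norm (adj C (C x)))\<^sup>2"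
      unfolding B_def power2_norm_eq_inner inner_diff_left[of x] inner_diff_right[of _ x]
      by (simp add: inner_commute[of "adj C (C x)" x] power2_norm_eq_inner)
    moreover have "(norm (adj C (C x)))\<^sup>2 \<le> (norm (C x))\<^sup>2"
      by (intro power_mono contraction_adj[OF C C_le]) simp
    ultimately show "(norm (B x))\<^sup>2 \<le> (norm x)\<^sup>2" using zero_le_power2[of "norm (C x)"] by linarith
  qed simp
  have "adj B x = B x" for x
    by (rule adj_eqI[OF B])
      (simp add: B_def cinner_diff_left cinner_diff_right cinner_adj_left[OF C] cinner_adj_right[OF C])
  with B B_le obtain Q where Q: "bounded_clinear Q" "\<And>x. adj Q x = Q x" "\<And>x. Q (Q x) = x - B x"
    by (rule sqrt_one_minus_exists) blast
  have QQ: "cinner (Q x) (Q y) = cinner (C x) (C y)" for x y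
  proof -
    have "cinner (Q x) (Q y) = cinner x (Q (Q y))" by (metis Q(1,2) cinner_adj_right)
    then show ?thesis by (simp add: Q(3) B_def cinner_adj_right[OF C])
  qed
  \<comment> \<open>\<open>C\<close> multiplies the vector belonging to index \<open>i\<close> by
    its weight; dividing by that weight restores the original kernel.\<close>
  define L' where "L' i x = inverse (w (to_nat_on I i)) *\<^sub>R Q (ell2_single (to_nat_on I i) x)" for i x
  have "bounded_clinear (\<lambda>x. r *\<^sub>R Q (ell2_single n x))" for r n
  proof (rule bounded_clinear_comp[of "\<lambda>x. r *\<^sub>R x"])
    show "bounded_clinear (\<lambda>x::'h ell2. r *\<^sub>R x)"
      by (rule bounded_clinearI[of _ "\<bar>r\<bar>"])
        (auto simp: scaleC_add_right scaleR_scaleC scaleC_scaleC mult.commute norm_scaleC)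
    show "bounded_clinear (\<lambda>x. Q (ell2_single n x))"
      by (intro bounded_clinear_comp[OF Q(1)]
          isometric_embedding_imp_bounded_clinear[OF isometric_embedding_ell2_single])
  qed
  then have "bounded_clinear (L' i)" for i by (simp add: L'_def[abs_def])
  moreover have "cinner (L' i x) (L' j y) = cinner (L i x) (L j y)" if "i \<in> I" "j \<in> I" for i j x y
  proof -
    have "M (to_nat_on I i) = L i" "M (to_nat_on I j) = L j"
      using that \<open>countable I\<close> by (simp_all add: M_def)
    moreover have "w n \<noteq> 0" for n by (simp add: w_def)
    ultimately show ?thesis
      by (simp add: L'_def scaleR_scaleC cinner_scaleC_left cinner_scaleC_right QQ C_single field_simps)
  qed
  ultimately show ?thesis by (intro that)
qed

section \<open>Ando's dilation and the commutant\<close>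

text \<open>\<open>D\<close> is the square root of the identity minus \<open>adj A\<close> after
  \<open>A\<close>. Whatever commutes with \<open>A\<close> and with \<open>adj A\<close> commutes
  with their product, hence with the root.\<close>

lemma defect_operator_exists:
  fixes A :: "'x::chilbert_space \<Rightarrow> 'x"
  assumes A: "bounded_clinear A" and A_le: "\<And>x. norm (A x) \<le> norm x"
  obtains D where "bounded_clinear D" "\<And>x. (norm (D x))\<^sup>2 = (norm x)\<^sup>2 - (norm (A x))\<^sup>2"
    "\<And>C x. \<lbrakk>bounded_clinear C; \<And>y. C (A y) = A (C y); \<And>y. C (adj A y) = adj A (C y)\<rbrakk> \<Longrightarrow> C (D x) = D (C x)"
proof -
  let ?B = "\<lambda>x. adj A (A x)"
  have B: "bounded_clinear ?B" by (rule bounded_clinear_comp[OF bounded_clinear_adj[OF A] A])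
  have B_le: "norm (?B x) \<le> norm x" for x
    using order_trans[OF contraction_adj[OF A A_le] A_le] .
  have "adj ?B x = ?B x" for x
    by (rule adj_eqI[OF B]) (simp add: cinner_adj_left[OF A] cinner_adj_right[OF A])
  with B B_le obtain D where D: "bounded_clinear D" "\<And>x. adj D x = D x" "\<And>x. D (D x) = x - ?B x"
    and comm: "\<And>C x. bounded_clinear C \<Longrightarrow> (\<And>y. C (?B y) = ?B (C y)) \<Longrightarrow> C (D x) = D (C x)"
    by (rule sqrt_one_minus_exists) blast
  have "(norm (D x))\<^sup>2 = (norm x)\<^sup>2 - (norm (A x))\<^sup>2" for x
  proof -
    have "cinner (D x) (D x) = cinner x (D (D x))" by (metis D(1,2) cinner_adj_right)
    also have "\<dots> = cinner x x - cinner (A x) (A x)"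
      by (simp add: D(3) cinner_diff_right cinner_adj_right[OF A])
    finally have "complex_of_real ((norm (D x))\<^sup>2) = complex_of_real ((norm x)\<^sup>2 - (norm (A x))\<^sup>2)"
      by (simp only: cinner_self of_real_diff)
    then show ?thesis by (simp only: of_real_eq_iff)
  qed
  moreover have "C (D x) = D (C x)"
    if "bounded_clinear C" "\<And>y. C (A y) = A (C y)" "\<And>y. C (adj A y) = adj A (C y)" for C x
    using that by (intro comm) simp_all
  ultimately show ?thesis by (rule that[OF D(1)])
qed

text \<open>\<open>v\<close> is zero on the orthogonal complement of the vectors \<open>a x\<close>.
  For commutation, the common \<open>C'\<close> deals with those vectors, and the condition on
  \<open>adj C\<close> makes \<open>C\<close> preserve the complement.\<close>

lemma partial_isometry_exists:
  fixes a b :: "'x::chilbert_space \<Rightarrow> 'y::chilbert_space"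
  assumes a: "bounded_clinear a" and b: "bounded_clinear b" and eq: "\<And>x. norm (a x) = norm (b x)"
  obtains v where "bounded_clinear v" "\<And>x. v (a x) = b x" "\<And>x. adj v (b x) = a x"
    "\<And>y. v (adj v (v y)) = v y"
    "\<And>C C' C'' y. \<lbrakk>bounded_clinear C; \<And>x. C (a x) = a (C' x); \<And>x. C (b x) = b (C' x);
       \<And>x. adj C (a x) = a (C'' x)\<rbrakk> \<Longrightarrow> v (C y) = C (v y)"
proof -
  note cinner_eq = norm_eq_imp_cinner_eq[OF a b eq]
  obtain v where v: "bounded_clinear v" "\<And>x. norm (v x) \<le> norm x" "\<And>x. x \<in> UNIV \<Longrightarrow> v (a x) = b x"
    "\<And>y. (\<And>x. x \<in> UNIV \<Longrightarrow> cinner (a x) y = 0) \<Longrightarrow> v y = 0"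
  proof (rule contraction_extension[of UNIV b a])
    show "norm (\<Sum>i\<in>F. c i *\<^sub>C b i) \<le> norm (\<Sum>i\<in>F. c i *\<^sub>C a i)" for F c
      by (rule eq_refl, rule norm_sum_eq_of_Gram_eq) (rule cinner_eq[symmetric])
  qed blast
  have adj_b: "adj v (b x) = a x" for x
  proof -
    \<comment> \<open>\<open>d\<close> is orthogonal to every \<open>a x\<close>, so
      \<open>v d = 0\<close>; pairing \<open>d\<close> with each of its two terms then gives
      \<open>cinner d d = 0\<close>.\<close>
    define d where "d = adj v (b x) - a x"
    have "v d = 0"
      by (rule v(4)) (simp add: d_def cinner_diff_right cinner_adj_right[OF v(1)] v(3) cinner_eq)
    moreover have "cinner (a x) d = 0"
      by (simp add: d_def cinner_diff_right cinner_adj_right[OF v(1)] v(3) cinner_eq)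
    then have "cinner d (a x) = 0" by (metis cinner_commute complex_cnj_zero)
    ultimately have "cinner d d = 0"
      using cinner_adj_right[OF v(1), of d "b x"]
      by (simp add: cinner_diff_right d_def)
    then show ?thesis by (simp add: d_def)
  qed
  have vvv: "v (adj v (v y)) = v y" for y
  proof (rule bounded_clinear_eqI[where a = a and I = UNIV, OF _ v(1)])
    show "bounded_clinear (\<lambda>y. v (adj v (v y)))"
      by (rule bounded_clinear_comp[OF v(1) bounded_clinear_comp[OF bounded_clinear_adj[OF v(1)] v(1)]])
  qed (simp_all add: v(3,4) adj_b bounded_clinear_0[OF v(1)] bounded_clinear_0[OF bounded_clinear_adj[OF v(1)]])
  have "v (C y) = C (v y)"
    if C: "bounded_clinear C" "\<And>x. C (a x) = a (C' x)" "\<And>x. C (b x) = b (C' x)"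
      "\<And>x. adj C (a x) = a (C'' x)" for C C' C'' y
  proof (rule bounded_clinear_eqI[where a = a and I = UNIV, OF bounded_clinear_comp[OF v(1) C(1)]
        bounded_clinear_comp[OF C(1) v(1)]])
    show "v (C (a x)) = C (v (a x))" for x by (simp add: C v(3))
    fix z assume z: "\<And>x. x \<in> UNIV \<Longrightarrow> cinner (a x) z = 0"
    have "v (C z) = 0"
      by (rule v(4)) (simp add: z C(4) flip: cinner_adj_left[OF C(1)])
    then show "v (C z) = C (v z)" using v(4)[OF z] by (simp add: bounded_clinear_0[OF C(1)])
  qed
  then show ?thesis by (rule that[OF v(1) v(3)[OF UNIV_I] adj_b vvv])
qed

section \<open>Block operators and the Halmos unitary\<close>

lemma bounded_clinear_fst: "bounded_clinear fst"
  by (rule bounded_clinearI[of _ 1]) (auto simp: norm_fst_le)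

lemma bounded_clinear_snd: "bounded_clinear snd"
  by (rule bounded_clinearI[of _ 1]) (auto simp: norm_snd_le)

lemma bounded_clinear_Pair:
  assumes A: "bounded_clinear A" and B: "bounded_clinear B"
  shows "bounded_clinear (\<lambda>x. (A x, B x))"
proof -
  have "bounded_linear (\<lambda>x. (A x, B x))"
    by (intro bounded_linear_Pair bounded_clinear_imp_bounded_linear A B)
  then obtain K where "\<And>x. norm (A x, B x) \<le> norm x * K" using bounded_linear.bounded by blast
  then show ?thesis using A B
    by (intro bounded_clinearI[of _ K]) (simp_all add: bounded_clinear_def mult.commute)
qed

lemma bounded_clinear_map_prod:
  assumes A: "bounded_clinear A" and B: "bounded_clinear B"
  shows "bounded_clinear (map_prod A B)"
  unfolding map_prod_def split_beta
  by (intro bounded_clinear_Pair bounded_clinear_comp[OF A bounded_clinear_fst]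
      bounded_clinear_comp[OF B bounded_clinear_snd])

lemma adj_map_prod:
  assumes A: "bounded_clinear A" and B: "bounded_clinear B"
  shows "adj (map_prod A B) = map_prod (adj A) (adj B)"
  by (rule ext, rule adj_eqI[OF bounded_clinear_map_prod[OF A B]])
    (simp add: cinner_prod_def cinner_adj_right[OF A] cinner_adj_right[OF B])

lemma bounded_clinear_comp_sub:
  assumes "bounded_clinear v" "bounded_clinear w"
  shows "bounded_clinear (\<lambda>x. x - v (w x))"
  by (rule bounded_clinear_sub[OF bounded_clinear_ident bounded_clinear_comp[OF assms]])

text \<open>The Halmos dilation of a partial isometry \<open>v\<close> with adjoint \<open>w\<close>; it extends \<open>v\<close> from its initial
  space to a unitary without leaving the von Neumann algebra generated by \<open>v\<close>, which is what
  keeps everything in the commutant.\<close>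

definition halmos :: "('a::chilbert_space \<Rightarrow> 'a) \<Rightarrow> ('a \<Rightarrow> 'a) \<Rightarrow> 'a \<times> 'a \<Rightarrow> 'a \<times> 'a" where
  "halmos v w = (\<lambda>(p, q). (v p + (q - v (w q)), (p - w (v p)) + w q))"

text \<open>The same matrix with \<open>v\<close> and \<open>w\<close> exchanged, which is the
  adjoint matrix when \<open>w = adj v\<close>. For a partial isometry \<open>v\<close> the two
  defect operators are projections, which is why no square roots occur.\<close>

definition halmos_inv :: "('a::chilbert_space \<Rightarrow> 'a) \<Rightarrow> ('a \<Rightarrow> 'a) \<Rightarrow> 'a \<times> 'a \<Rightarrow> 'a \<times> 'a" where
  "halmos_inv v w = (\<lambda>(p, q). (w p + (q - w (v q)), (p - v (w p)) + v q))"

lemma bounded_clinear_halmos: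
  assumes v: "bounded_clinear v" and w: "bounded_clinear w"
  shows "bounded_clinear (halmos v w)"
  unfolding halmos_def split_beta
  by (intro bounded_clinear_Pair bounded_clinear_plus
      bounded_clinear_comp[OF v bounded_clinear_fst] bounded_clinear_comp[OF w bounded_clinear_snd]
      bounded_clinear_comp[OF bounded_clinear_comp_sub[OF v w] bounded_clinear_snd]
      bounded_clinear_comp[OF bounded_clinear_comp_sub[OF w v] bounded_clinear_fst])

lemma bounded_clinear_halmos_inv:
  assumes v: "bounded_clinear v" and w: "bounded_clinear w"
  shows "bounded_clinear (halmos_inv v w)"
  using bounded_clinear_halmos[OF w v] by (simp add: halmos_def halmos_inv_def)

lemma halmos_inverse:
  assumes v: "bounded_clinear v" and w: "bounded_clinear w"
    and "\<And>y. v (w (v y)) = v y" "\<And>y. w (v (w y)) = w y"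
  shows "halmos v w (halmos_inv v w x) = x" "halmos_inv v w (halmos v w x) = x"
  by (cases x, simp add: halmos_def halmos_inv_def bounded_clinear_add[OF v] bounded_clinear_add[OF w]
      bounded_clinear_diff[OF v] bounded_clinear_diff[OF w] assms(3,4))+

text \<open>The adjoint matrix is a two-sided inverse, so both matrices preserve the inner product.
  The inverse property needs \<open>vvv\<close> and the relation obtained from it by taking
  adjoints.\<close>

lemma norm_halmos:
  assumes v: "bounded_clinear v" and vvv: "\<And>y. v (adj v (v y)) = v y"
  shows "norm (halmos v (adj v) x) = norm x" "norm (halmos_inv v (adj v) x) = norm x"
    "halmos v (adj v) (halmos_inv v (adj v) x) = x" "halmos_inv v (adj v) (halmos v (adj v) x) = x"
proof -
  note w = bounded_clinear_adj[OF v]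
  have www: "adj v (v (adj v y)) = adj v y" for y
    by (rule cinner_eqI) (simp add: cinner_adj_right[OF v] cinner_adj_left[OF v] vvv
        flip: cinner_adj_left[OF v])
  note inv = halmos_inverse[OF v w vvv www]
  show "halmos v (adj v) (halmos_inv v (adj v) x) = x" "halmos_inv v (adj v) (halmos v (adj v) x) = x"
    by (rule inv)+
  have vw: "cinner (v (adj v x)) y = cinner x (v (adj v y))" for x y
    using cinner_adj_right[OF v] cinner_adj_left[OF v] by metis
  have adj: "cinner (halmos v (adj v) x) y = cinner x (halmos_inv v (adj v) y)" for x y
    by (cases x, cases y)
      (simp add: halmos_def halmos_inv_def cinner_add_left cinner_add_right cinner_diff_left
        cinner_diff_right cinner_adj_left[OF v] cinner_adj_right[OF v] vw)
  have iso: "norm (halmos v (adj v) x) = norm x" for x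
  proof -
    have "cinner (halmos v (adj v) x) (halmos v (adj v) x) = cinner x x"
      by (simp add: adj inv)
    then have "complex_of_real ((norm (halmos v (adj v) x))\<^sup>2) = complex_of_real ((norm x)\<^sup>2)"
      by (simp only: cinner_self)
    then show ?thesis unfolding of_real_eq_iff by (simp add: power2_eq_iff_nonneg)
  qed
  show "norm (halmos v (adj v) x) = norm x" by (rule iso)
  show "norm (halmos_inv v (adj v) x) = norm x" using iso[of "halmos_inv v (adj v) x"] by (simp add: inv)
qed

lemma halmos_commute:
  assumes B: "bounded_clinear B" and v: "\<And>y. v (B y) = B (v y)" and w: "\<And>y. w (B y) = B (w y)"
  shows "halmos v w (map_prod B B z) = map_prod B B (halmos v w z)"
    "halmos_inv v w (map_prod B B z) = map_prod B B (halmos_inv v w z)"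
  by (cases z, simp add: halmos_def halmos_inv_def v w bounded_clinear_add[OF B] bounded_clinear_diff[OF B])+

text \<open>A block \<open>((h1, h3), (h2, h4))\<close> stands for four consecutive entries \<open>h1, h2, h3, h4\<close> of the
  sequences in Ando's construction; the pairs \<open>(h1, h3)\<close> and \<open>(h2, h4)\<close> are what the Halmos unitary
  acts on.  The map \<open>ando_shift\<close> moves all entries by two places and puts \<open>y, 0\<close> in front.\<close>

definition ando_shift :: "'x::chilbert_space \<Rightarrow> (('x \<times> 'x) \<times> ('x \<times> 'x)) ell2 \<Rightarrow> (('x \<times> 'x) \<times> ('x \<times> 'x)) ell2" where
  "ando_shift y f = Abs_ell2 (\<lambda>k. let g = (case k of 0 \<Rightarrow> ((0, y), (0, 0)) | Suc j \<Rightarrow> Rep_ell2 f j); h = Rep_ell2 f k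
     in ((snd (fst g), fst (fst h)), (snd (snd g), fst (snd h))))"

lemma ando_shift_sums:
  "(\<lambda>k. (norm (let g = (case k of 0 \<Rightarrow> ((0, y), (0, 0)) | Suc j \<Rightarrow> Rep_ell2 f j); h = Rep_ell2 f k
     in ((snd (fst g), fst (fst h)), (snd (snd g), fst (snd h)))))\<^sup>2) sums ((norm y)\<^sup>2 + (norm f)\<^sup>2)"
proof -
  \<comment> \<open>\<open>\<alpha>\<close> collects the entries \<open>h3, h4\<close>, which pass
    to the next block, and \<open>\<beta>\<close> the entries \<open>h1, h2\<close>, which stay in
    their block.\<close>
  define \<alpha> where "\<alpha> k = (norm (snd (fst (Rep_ell2 f k))))\<^sup>2 + (norm (snd (snd (Rep_ell2 f k))))\<^sup>2" for k
  define \<beta> where "\<beta> k = (norm (fst (fst (Rep_ell2 f k))))\<^sup>2 + (norm (fst (snd (Rep_ell2 f k))))\<^sup>2" for k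
  define \<alpha>' where "\<alpha>' k = (case k of 0 \<Rightarrow> (norm y)\<^sup>2 | Suc j \<Rightarrow> \<alpha> j)" for k
  have ab: "(norm (Rep_ell2 f k))\<^sup>2 = \<alpha> k + \<beta> k" for k
    by (simp add: \<alpha>_def \<beta>_def norm_prod_sq)
  have s\<alpha>: "summable \<alpha>" and s\<beta>: "summable \<beta>"
    by (rule summable_comparison_test'[OF summable_Rep_ell2[of f]], simp add: ab, simp add: \<alpha>_def \<beta>_def)+
  have nf: "(norm f)\<^sup>2 = suminf \<alpha> + suminf \<beta>"
    by (simp add: norm_ell2_sq ab suminf_add[OF s\<alpha> s\<beta>])
  have "\<alpha>' sums (suminf \<alpha> + (norm y)\<^sup>2)"
    using sums_Suc[of \<alpha>' "suminf \<alpha>"] s\<alpha> by (simp add: \<alpha>'_def summable_sums)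
  then have "(\<lambda>k. \<alpha>' k + \<beta> k) sums (suminf \<alpha> + (norm y)\<^sup>2 + suminf \<beta>)"
    by (intro sums_add summable_sums s\<beta>)
  then have "(\<lambda>k. \<alpha>' k + \<beta> k) sums ((norm y)\<^sup>2 + (norm f)\<^sup>2)" by (simp add: nf algebra_simps)
  moreover have "(norm (let g = (case k of 0 \<Rightarrow> ((0, y), (0, 0)) | Suc j \<Rightarrow> Rep_ell2 f j); h = Rep_ell2 f k
     in ((snd (fst g), fst (fst h)), (snd (snd g), fst (snd h)))))\<^sup>2 = \<alpha>' k + \<beta> k" for k
    by (cases k) (simp_all add: \<alpha>'_def \<alpha>_def \<beta>_def norm_prod_sq Let_def)
  ultimately show ?thesis by simp
qed

lemma Rep_ando_shift:
  "Rep_ell2 (ando_shift y f) k = (let g = (case k of 0 \<Rightarrow> ((0, y), (0, 0)) | Suc j \<Rightarrow> Rep_ell2 f j); h = Rep_ell2 f k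
     in ((snd (fst g), fst (fst h)), (snd (snd g), fst (snd h))))"
  unfolding ando_shift_def by (simp only: Rep_ell2_Abs[OF sums_summable[OF ando_shift_sums]])

lemma norm_ando_shift: "(norm (ando_shift y f))\<^sup>2 = (norm y)\<^sup>2 + (norm f)\<^sup>2"
  unfolding norm_ell2_sq[of "ando_shift y f"] Rep_ando_shift
  by (rule sums_unique[OF ando_shift_sums, symmetric])

lemma ando_shift_add: "ando_shift (y + y') (f + f') = ando_shift y f + ando_shift y' f'"
  by (rule ell2_eqI) (simp add: Rep_ando_shift Rep_add Let_def plus_prod_def split: nat.split)

lemma ando_shift_scaleC: "ando_shift (c *\<^sub>C y) (c *\<^sub>C f) = c *\<^sub>C ando_shift y f"
  by (rule ell2_eqI) (simp add: Rep_ando_shift Rep_scaleC Let_def split: nat.split)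

text \<open>Two shifts by two entries move everything by exactly one block, so products of two steps
  can differ only in block 0.\<close>

lemma Rep_ando_shift_twice:
  "Rep_ell2 (ando_shift y (ando_shift y' f)) k = (case k of 0 \<Rightarrow> ((y, y'), (0, 0)) | Suc j \<Rightarrow> Rep_ell2 f j)"
  by (simp add: Rep_ando_shift Let_def split: nat.split)

definition amplify4 :: "('x \<Rightarrow> 'y) \<Rightarrow> ('x \<times> 'x) \<times> ('x \<times> 'x) \<Rightarrow> ('y \<times> 'y) \<times> ('y \<times> 'y)" where
  "amplify4 C = map_prod (map_prod C C) (map_prod C C)"

text \<open>The diagonal action of \<open>C\<close> on Ando's space. Amplifying \<open>W p\<close>
  gives the representation on the dilation space, and amplifying the projection \<open>E\<close>
  cuts that space out.\<close>

definition amplify :: "('x::chilbert_space \<Rightarrow> 'x) \<Rightarrow> 'x \<times> (('x \<times> 'x) \<times> ('x \<times> 'x)) ell2 \<Rightarrow> 'x \<times> (('x \<times> 'x) \<times> ('x \<times> 'x)) ell2" where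
  "amplify C = map_prod C (ell2_map (amplify4 C))"

lemma bounded_clinear_amplify4: "bounded_clinear C \<Longrightarrow> bounded_clinear (amplify4 C)"
  unfolding amplify4_def by (intro bounded_clinear_map_prod)

lemma bounded_clinear_amplify: "bounded_clinear C \<Longrightarrow> bounded_clinear (amplify C)"
  unfolding amplify_def by (intro bounded_clinear_map_prod bounded_clinear_ell2_map bounded_clinear_amplify4)

lemma adj_amplify: "bounded_clinear C \<Longrightarrow> adj (amplify C) = amplify (adj C)"
  by (simp add: amplify_def adj_map_prod bounded_clinear_ell2_map bounded_clinear_amplify4 adj_ell2_map)
    (simp add: amplify4_def adj_map_prod bounded_clinear_map_prod)

lemma amplify_comp:
  assumes C: "bounded_clinear C" and D: "bounded_clinear D"
  shows "amplify C (amplify D z) = amplify (\<lambda>x. C (D x)) z"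
proof -
  have "(\<lambda>x. amplify4 C (amplify4 D x)) = amplify4 (\<lambda>x. C (D x))"
    by (auto simp: amplify4_def fun_eq_iff)
  then show ?thesis
    by (simp add: amplify_def map_prod_def split_beta ell2_map_comp bounded_clinear_amplify4 C D)
qed

lemma fst_amplify [simp]: "fst (amplify C z) = C (fst z)"
  by (simp add: amplify_def)

lemma ando_shift_amplify:
  assumes C: "bounded_clinear C"
  shows "ando_shift (C y) (ell2_map (amplify4 C) f) = ell2_map (amplify4 C) (ando_shift y f)"
  by (rule ell2_eqI, simp only: Rep_ando_shift Rep_ell2_map[OF bounded_clinear_amplify4[OF C]])
    (simp add: Let_def bounded_clinear_0[OF C] amplify4_def split: nat.split)

text \<open>\<open>A x\<close> and \<open>D x\<close> together have the norm of \<open>x\<close>: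
  this is Schaeffer's isometric dilation of \<open>A\<close>, with a shift by two entries instead of
  one.\<close>

lemma isometric_ando_step:
  assumes A: "bounded_clinear A" and D: "bounded_clinear D"
    and eq: "\<And>x. (norm (D x))\<^sup>2 = (norm x)\<^sup>2 - (norm (A x))\<^sup>2"
  shows "isometric_embedding (\<lambda>z. (A (fst z), ando_shift (D (fst z)) (snd z))) UNIV"
proof -
  have "(norm (A (fst z), ando_shift (D (fst z)) (snd z)))\<^sup>2 = (norm z)\<^sup>2" for z
    by (simp add: norm_prod_sq norm_ando_shift eq)
  then have "norm (A (fst z), ando_shift (D (fst z)) (snd z)) = norm z" for z
    by (metis norm_ge_zero power2_eq_iff_nonneg)
  then show ?thesis
    unfolding isometric_embedding_def
    by (simp add: bounded_clinear_add[OF A] bounded_clinear_add[OF D] bounded_clinear_scaleC[OF A]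
        bounded_clinear_scaleC[OF D] ando_shift_add ando_shift_scaleC)
qed

text \<open>The uncorrected steps \<open>W1\<close>, \<open>W2\<close> fail to commute only in block
  0, where the two orders give \<open>a x\<close> and \<open>b x\<close>. Both have squared norm
  \<open>(norm x)\<^sup>2 - (norm (A1 (A2 x)))\<^sup>2\<close>. With \<open>V1 = U W1\<close> and
  \<open>V2 = W2 U'\<close> the products become \<open>U W1 W2 U'\<close> and \<open>W2 W1\<close>,
  so a unitary \<open>U\<close> taking \<open>a x\<close> to \<open>b x\<close> suffices.\<close>

lemma ando_dilation:
  fixes A1 A2 :: "'x::chilbert_space \<Rightarrow> 'x"
  assumes A1: "bounded_clinear A1" "\<And>x. norm (A1 x) \<le> norm x"
    and A2: "bounded_clinear A2" "\<And>x. norm (A2 x) \<le> norm x"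
    and comm: "\<And>x. A1 (A2 x) = A2 (A1 x)"
  obtains V1 V2 where "isometric_embedding V1 UNIV" "isometric_embedding V2 UNIV"
    "\<And>z. V1 (V2 z) = V2 (V1 z)" "\<And>z. fst (V1 z) = A1 (fst z)" "\<And>z. fst (V2 z) = A2 (fst z)"
    "\<And>C z. \<lbrakk>bounded_clinear C; \<And>x. C (A1 x) = A1 (C x); \<And>x. C (A2 x) = A2 (C x);
       \<And>x. C (adj A1 x) = adj A1 (C x); \<And>x. C (adj A2 x) = adj A2 (C x)\<rbrakk> \<Longrightarrow>
       V1 (amplify C z) = amplify C (V1 z) \<and> V2 (amplify C z) = amplify C (V2 z)"
proof -
  obtain D1 where D1: "bounded_clinear D1" "\<And>x. (norm (D1 x))\<^sup>2 = (norm x)\<^sup>2 - (norm (A1 x))\<^sup>2"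
    and D1_comm: "\<And>C x. \<lbrakk>bounded_clinear C; \<And>y. C (A1 y) = A1 (C y); \<And>y. C (adj A1 y) = adj A1 (C y)\<rbrakk>
      \<Longrightarrow> C (D1 x) = D1 (C x)"
    by (rule defect_operator_exists[OF A1]) blast
  obtain D2 where D2: "bounded_clinear D2" "\<And>x. (norm (D2 x))\<^sup>2 = (norm x)\<^sup>2 - (norm (A2 x))\<^sup>2"
    and D2_comm: "\<And>C x. \<lbrakk>bounded_clinear C; \<And>y. C (A2 y) = A2 (C y); \<And>y. C (adj A2 y) = adj A2 (C y)\<rbrakk>
      \<Longrightarrow> C (D2 x) = D2 (C x)"
    by (rule defect_operator_exists[OF A2]) blast
  define a where "a x = (D1 (A2 x), D2 x)" for x
  define b where "b x = (D2 (A1 x), D1 x)" for x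
  have a: "bounded_clinear a" unfolding a_def[abs_def]
    by (rule bounded_clinear_Pair[OF bounded_clinear_comp[OF D1(1) A2(1)] D2(1)])
  have b: "bounded_clinear b" unfolding b_def[abs_def]
    by (rule bounded_clinear_Pair[OF bounded_clinear_comp[OF D2(1) A1(1)] D1(1)])
  have "(norm (a x))\<^sup>2 = (norm (b x))\<^sup>2" for x
    by (simp add: a_def b_def norm_prod_sq D1(2) D2(2) comm)
  then have eq: "norm (a x) = norm (b x)" for x by (metis norm_ge_zero power2_eq_iff_nonneg)
  obtain v where v: "bounded_clinear v" "\<And>x. v (a x) = b x" "\<And>x. adj v (b x) = a x" "\<And>y. v (adj v (v y)) = v y"
    and v_comm: "\<And>C C' C'' y. \<lbrakk>bounded_clinear C; \<And>x. C (a x) = a (C' x); \<And>x. C (b x) = b (C' x);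
       \<And>x. adj C (a x) = a (C'' x)\<rbrakk> \<Longrightarrow> v (C y) = C (v y)"
    by (rule partial_isometry_exists[OF a b eq]) blast
  note w = bounded_clinear_adj[OF v(1)]
  define U where "U = halmos v (adj v)"
  define U' where "U' = halmos_inv v (adj v)"
  have U: "bounded_clinear U" "bounded_clinear U'"
    unfolding U_def U'_def by (intro bounded_clinear_halmos bounded_clinear_halmos_inv v w)+
  have nU: "norm (U x) = norm x" "norm (U' x) = norm x" "U (U' x) = x" "U' (U x) = x" for x
    unfolding U_def U'_def by (intro norm_halmos v)+
  \<comment> \<open>The second pair is \<open>a x - adj v (v (a x))\<close>, which vanishes because
    \<open>adj v (b x) = a x\<close>.\<close>
  have Uab: "U ((D1 (A2 x), D2 x), (0, 0)) = ((D2 (A1 x), D1 x), (0, 0))" for x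
    using v(2,3)[of x] by (simp add: U_def halmos_def a_def b_def bounded_clinear_0[OF v(1)]
        bounded_clinear_0[OF w] flip: zero_prod_def)
  define W1 where "W1 z = (A1 (fst z), ando_shift (D1 (fst z)) (snd z))" for z
  define W2 where "W2 z = (A2 (fst z), ando_shift (D2 (fst z)) (snd z))" for z
  have W1: "isometric_embedding W1 UNIV" unfolding W1_def[abs_def] by (rule isometric_ando_step[OF A1(1) D1])
  have W2: "isometric_embedding W2 UNIV" unfolding W2_def[abs_def] by (rule isometric_ando_step[OF A2(1) D2])
  have G: "isometric_embedding (map_prod id (ell2_map B)) UNIV"
    if B: "bounded_clinear B" "\<And>x. norm (B x) = norm x" for B :: "('x \<times> 'x) \<times> ('x \<times> 'x) \<Rightarrow> _"
    using bounded_clinear_ell2_map[OF B(1)] norm_ell2_map[OF B]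
    by (auto simp: isometric_embedding_def bounded_clinear_def norm_prod_def)
  define V1 where "V1 z = map_prod id (ell2_map U) (W1 z)" for z
  define V2 where "V2 z = W2 (map_prod id (ell2_map U') z)" for z
  have "isometric_embedding V1 UNIV" unfolding V1_def[abs_def]
    by (rule isometric_embedding_comp[OF G[OF U(1) nU(1)] W1])
  moreover have "isometric_embedding V2 UNIV" unfolding V2_def[abs_def]
    by (rule isometric_embedding_comp[OF W2 G[OF U(2) nU(2)]])
  moreover have "V1 (V2 z) = V2 (V1 z)" for z
  proof -
    have "ell2_map U (ando_shift (D1 (A2 (fst z))) (ando_shift (D2 (fst z)) (ell2_map U' (snd z))))
        = ando_shift (D2 (A1 (fst z))) (ando_shift (D1 (fst z)) (snd z))"
      by (rule ell2_eqI) (simp add: Rep_ell2_map[OF U(1)] Rep_ell2_map[OF U(2)] Rep_ando_shift_twice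
          Uab nU split: nat.split)
    moreover have "ell2_map U' (ell2_map U f) = f" for f
      by (rule ell2_eqI) (simp add: Rep_ell2_map[OF U(1)] Rep_ell2_map[OF U(2)] nU)
    ultimately show ?thesis by (simp add: V1_def V2_def W1_def W2_def comm)
  qed
  moreover have "fst (V1 z) = A1 (fst z)" "fst (V2 z) = A2 (fst z)" for z
    by (simp_all add: V1_def V2_def W1_def W2_def)
  moreover have "V1 (amplify C z) = amplify C (V1 z) \<and> V2 (amplify C z) = amplify C (V2 z)"
    if C: "bounded_clinear C" and C1: "\<And>x. C (A1 x) = A1 (C x)" and C2: "\<And>x. C (A2 x) = A2 (C x)"
      and C1': "\<And>x. C (adj A1 x) = adj A1 (C x)" and C2': "\<And>x. C (adj A2 x) = adj A2 (C x)" for C z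
  proof -
    note C' = bounded_clinear_adj[OF C]
    \<comment> \<open>Commutation with \<open>v\<close> requires control of \<open>adj C\<close>
      too, so all relations are passed to adjoints first and then on to the defect
      operators.\<close>
    have d1: "adj C (A1 x) = A1 (adj C x)" for x
      using adj_commute[OF C bounded_clinear_adj[OF A1(1)] C1'] by (simp add: adj_adj[OF A1(1)])
    have d2: "adj C (A2 x) = A2 (adj C x)" for x
      using adj_commute[OF C bounded_clinear_adj[OF A2(1)] C2'] by (simp add: adj_adj[OF A2(1)])
    have d1': "adj C (adj A1 x) = adj A1 (adj C x)" for x by (rule adj_commute[OF C A1(1) C1])
    have d2': "adj C (adj A2 x) = adj A2 (adj C x)" for x by (rule adj_commute[OF C A2(1) C2])
    have e1: "C (D1 x) = D1 (C x)" and e2: "C (D2 x) = D2 (C x)" for x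
      by (rule D1_comm[OF C C1 C1'], rule D2_comm[OF C C2 C2'])
    have f1: "adj C (D1 x) = D1 (adj C x)" and f2: "adj C (D2 x) = D2 (adj C x)" for x
      by (rule D1_comm[OF C' d1 d1'], rule D2_comm[OF C' d2 d2'])
    let ?C = "map_prod C C" and ?C' = "map_prod (adj C) (adj C)"
    have CC: "bounded_clinear ?C" "bounded_clinear ?C'" by (intro bounded_clinear_map_prod C C')+
    have adjC: "adj ?C = ?C'" "adj ?C' = ?C"
      by (simp_all only: adj_map_prod[OF C C] adj_map_prod[OF C' C'] adj_adj[OF C])
    have g: "?C (a x) = a (C x)" "?C (b x) = b (C x)" "?C' (a x) = a (adj C x)" "?C' (b x) = b (adj C x)" for x
      by (simp_all add: a_def b_def e1 e2 f1 f2 C1 C2 d1 d2)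
    have vC: "v (?C y) = ?C (v y)" for y
      by (rule v_comm[OF CC(1) g(1,2), of "adj C"]) (simp only: adjC g)
    have vC': "v (?C' y) = ?C' (v y)" for y
      by (rule v_comm[OF CC(2) g(3,4), of C]) (simp only: adjC g)
    have wC: "adj v (?C y) = ?C (adj v y)" for y
      using adj_commute[OF v(1) CC(2) vC'] by (simp only: adjC)
    have UC: "U (amplify4 C z) = amplify4 C (U z)" "U' (amplify4 C z) = amplify4 C (U' z)" for z
      unfolding U_def U'_def amplify4_def by (rule halmos_commute[where B = ?C, OF CC(1)], rule vC, rule wC)+
    have M: "ell2_map U (ell2_map (amplify4 C) f) = ell2_map (amplify4 C) (ell2_map U f)"
      "ell2_map U' (ell2_map (amplify4 C) f) = ell2_map (amplify4 C) (ell2_map U' f)" for f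
      by (simp_all add: ell2_map_comp U bounded_clinear_amplify4[OF C] UC)
    show ?thesis
      by (simp add: V1_def V2_def W1_def W2_def amplify_def M ando_shift_amplify[OF C]
          flip: C1 C2 e1 e2)
  qed
  ultimately show ?thesis by (rule that[of V1 V2])
qed

section \<open>Principal right ideals\<close>

lemma l_coset_carrier_iff: "r \<in> p <#\<^bsub>P\<^esub> carrier P \<longleftrightarrow> (\<exists>s\<in>carrier P. r = p \<otimes>\<^bsub>P\<^esub> s)"
  by (auto simp: l_coset_def)

context right_LCM_monoid
begin

lemma lquot_eqI:
  assumes "p \<in> carrier P" "s \<in> carrier P" "p \<otimes> s = r"
  shows "lquot P p r = s"
  unfolding lquot_def using assms left_cancel by (intro the_equality) auto

lemma lquot:
  assumes "p \<in> carrier P" "r \<in> (p <# carrier P)"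
  shows "lquot P p r \<in> carrier P" "p \<otimes> lquot P p r = r"
  using assms lquot_eqI[of p _ r] by (auto simp: l_coset_carrier_iff)

lemma mem_ideal_self: "p \<in> carrier P \<Longrightarrow> p \<in> (p <# carrier P)"
  unfolding l_coset_carrier_iff by (rule bexI[of _ \<one>]) auto

lemma ideal_mult_subset:
  assumes "p \<in> carrier P" "s \<in> carrier P"
  shows "((p \<otimes> s) <# carrier P) \<subseteq> (p <# carrier P)"
  using assms by (fastforce simp: l_coset_carrier_iff m_assoc)

lemma ideal_eq_subset:
  assumes "r \<in> carrier P" "(p <# carrier P) \<inter> (q <# carrier P) = (r <# carrier P)"
  shows "r \<in> (p <# carrier P)" "r \<in> (q <# carrier P)"
  using mem_ideal_self[OF assms(1)] assms(2) by auto

lemma ideal_Int_mult: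
  assumes "p \<in> carrier P" "q \<in> carrier P" "q' \<in> carrier P"
  shows "((p \<otimes> q) <# carrier P) \<inter> ((p \<otimes> q') <# carrier P) = (\<otimes>) p ` ((q <# carrier P) \<inter> (q' <# carrier P))"
proof (intro equalityI subsetI)
  fix x assume "x \<in> ((p \<otimes> q) <# carrier P) \<inter> ((p \<otimes> q') <# carrier P)"
  then obtain s t where s: "s \<in> carrier P" "x = (p \<otimes> q) \<otimes> s" and t: "t \<in> carrier P" "x = (p \<otimes> q') \<otimes> t"
    unfolding Int_iff l_coset_carrier_iff by blast
  have xs: "x = p \<otimes> (q \<otimes> s)" unfolding s(2) by (rule m_assoc[OF assms(1,2) s(1)])
  have "x = p \<otimes> (q' \<otimes> t)" unfolding t(2) by (rule m_assoc[OF assms(1,3) t(1)])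
  with xs have "p \<otimes> (q \<otimes> s) = p \<otimes> (q' \<otimes> t)" by (rule subst)
  then have "q \<otimes> s = q' \<otimes> t"
    by (rule left_cancel[OF assms(1) m_closed[OF assms(2) s(1)] m_closed[OF assms(3) t(1)]])
  then have "q \<otimes> s \<in> (q <# carrier P) \<inter> (q' <# carrier P)"
    unfolding Int_iff l_coset_carrier_iff using s(1) t(1) by blast
  with xs show "x \<in> (\<otimes>) p ` ((q <# carrier P) \<inter> (q' <# carrier P))" by blast
next
  fix x assume "x \<in> (\<otimes>) p ` ((q <# carrier P) \<inter> (q' <# carrier P))"
  then obtain y where y: "x = p \<otimes> y" "y \<in> q <# carrier P" "y \<in> q' <# carrier P" by blast
  obtain s t where "s \<in> carrier P" "y = q \<otimes> s" "t \<in> carrier P" "y = q' \<otimes> t"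
    using y(2,3) unfolding l_coset_carrier_iff by blast
  moreover from this have "x = (p \<otimes> q) \<otimes> s" "x = (p \<otimes> q') \<otimes> t"
    using assms y(1) m_assoc by metis+
  ultimately show "x \<in> ((p \<otimes> q) <# carrier P) \<inter> ((p \<otimes> q') <# carrier P)"
    unfolding Int_iff l_coset_carrier_iff by blast
qed

lemma image_mult_ideal:
  assumes "p \<in> carrier P" "r \<in> carrier P"
  shows "(\<otimes>) p ` (r <# carrier P) = ((p \<otimes> r) <# carrier P)"
  using ideal_Int_mult[OF assms assms(2)] by (simp only: Int_absorb)

text \<open>The ideal of \<open>p \<otimes> s\<close> lies in that of \<open>p\<close>, so
  intersecting with the ideal of \<open>q\<close> is intersecting with the ideal of
  \<open>r = p \<otimes> lquot P p r\<close>; then \<open>p\<close> factors out of both.\<close>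

lemma ideal_Int_translate:
  assumes "p \<in> carrier P" "q \<in> carrier P" "r \<in> carrier P" "s \<in> carrier P"
    and r: "(p <# carrier P) \<inter> (q <# carrier P) = (r <# carrier P)"
  shows "((p \<otimes> s) <# carrier P) \<inter> (q <# carrier P) = (\<otimes>) p ` ((lquot P p r <# carrier P) \<inter> (s <# carrier P))"
proof -
  note a = lquot[OF assms(1) ideal_eq_subset(1)[OF assms(3) r]]
  have "((p \<otimes> s) <# carrier P) \<inter> (q <# carrier P) = (r <# carrier P) \<inter> ((p \<otimes> s) <# carrier P)"
    using ideal_mult_subset[OF assms(1,4)] r by blast
  also have "\<dots> = (\<otimes>) p ` ((lquot P p r <# carrier P) \<inter> (s <# carrier P))"
    using ideal_Int_mult[OF assms(1) a(1) assms(4)] unfolding a(2) .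
  finally show ?thesis .
qed

lemma LCM_cases:
  assumes "p \<in> carrier P" "q \<in> carrier P"
  obtains (empty) "(p <# carrier P) \<inter> (q <# carrier P) = {}"
  | (lcm) r where "r \<in> carrier P" "(p <# carrier P) \<inter> (q <# carrier P) = (r <# carrier P)"
  using right_LCM[OF assms] by blast

end

declare carrier_DirProd [simp del]

lemma carrier_nat_add [simp]: "carrier nat_add = UNIV"
  and mult_nat_add [simp]: "n \<otimes>\<^bsub>nat_add\<^esub> m = n + m"
  by (simp_all add: nat_add_def)

lemma mem_carrier_nat_times [simp]: "(n, p) \<in> carrier (nat_add \<times>\<times> P) \<longleftrightarrow> p \<in> carrier P"
  by (simp add: DirProd_def nat_add_def)

lemma nat_times_mult [simp]:
  "(n, p) \<otimes>\<^bsub>nat_add \<times>\<times> P\<^esub> (m, q) = (n + m, p \<otimes>\<^bsub>P\<^esub> q)"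
  by (simp add: DirProd_def nat_add_def)

lemma nat_times_one: "\<one>\<^bsub>nat_add \<times>\<times> P\<^esub> = (0, \<one>\<^bsub>P\<^esub>)"
  by (simp add: DirProd_def nat_add_def)

lemma nat_times_ideal:
  "(n, p) <#\<^bsub>nat_add \<times>\<times> P\<^esub> carrier (nat_add \<times>\<times> P) = {n..} \<times> (p <#\<^bsub>P\<^esub> carrier P)"
proof (intro equalityI subsetI)
  fix x assume "x \<in> (n, p) <#\<^bsub>nat_add \<times>\<times> P\<^esub> carrier (nat_add \<times>\<times> P)"
  then obtain s where "s \<in> carrier (nat_add \<times>\<times> P)" "x = (n, p) \<otimes>\<^bsub>nat_add \<times>\<times> P\<^esub> s"
    unfolding l_coset_carrier_iff by blast
  then show "x \<in> {n..} \<times> (p <#\<^bsub>P\<^esub> carrier P)"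
    by (cases s) (auto simp: l_coset_carrier_iff)
next
  fix x assume "x \<in> {n..} \<times> (p <#\<^bsub>P\<^esub> carrier P)"
  then obtain l t where lt: "n \<le> l" "t \<in> carrier P" "x = (l, p \<otimes>\<^bsub>P\<^esub> t)"
    by (auto simp: l_coset_carrier_iff)
  then have "(l - n, t) \<in> carrier (nat_add \<times>\<times> P)" "x = (n, p) \<otimes>\<^bsub>nat_add \<times>\<times> P\<^esub> (l - n, t)"
    by simp_all
  then show "x \<in> (n, p) <#\<^bsub>nat_add \<times>\<times> P\<^esub> carrier (nat_add \<times>\<times> P)"
    unfolding l_coset_carrier_iff by blast
qed

lemma nat_times_ideal_Int:
  "((n, p) <#\<^bsub>nat_add \<times>\<times> P\<^esub> carrier (nat_add \<times>\<times> P)) \<inter> ((m, q) <#\<^bsub>nat_add \<times>\<times> P\<^esub> carrier (nat_add \<times>\<times> P))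
    = {max n m..} \<times> ((p <#\<^bsub>P\<^esub> carrier P) \<inter> (q <#\<^bsub>P\<^esub> carrier P))"
  unfolding nat_times_ideal by auto

lemma (in right_LCM_monoid) lquot_nat_times:
  assumes "p \<in> carrier P" "r \<in> (p <# carrier P)" "n \<le> l"
  shows "lquot (nat_add \<times>\<times> P) (n, p) (l, r) = (l - n, lquot P p r)"
  unfolding lquot_def[of "nat_add \<times>\<times> P"]
proof (rule the_equality)
  show "(l - n, lquot P p r) \<in> carrier (nat_add \<times>\<times> P) \<and>
      (n, p) \<otimes>\<^bsub>nat_add \<times>\<times> P\<^esub> (l - n, lquot P p r) = (l, r)"
    using lquot[OF assms(1,2)] assms(3) by simp
next
  fix s assume s: "s \<in> carrier (nat_add \<times>\<times> P) \<and> (n, p) \<otimes>\<^bsub>nat_add \<times>\<times> P\<^esub> s = (l, r)"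
  obtain k t where st: "s = (k, t)" by (cases s)
  then have "t \<in> carrier P" "p \<otimes> t = r" "n + k = l" using s by auto
  then show "s = (l - n, lquot P p r)" using lquot_eqI[OF assms(1)] st by auto
qed

section \<open>Adjoints and compressions on subspaces\<close>

lemma adj_on_UNIV: "adj_on UNIV A = adj A"
  by (simp add: adj_on_def adj_def fun_eq_iff)

lemma subspace_projection:
  assumes K: "hilbert_subspace K"
  obtains E where "bounded_clinear E" "\<And>x. norm (E x) \<le> norm x" "\<And>x. x \<in> K \<Longrightarrow> E x = x" "\<And>x. E x \<in> K"
    "\<And>x. adj E x = E x"
proof -
  obtain E where E: "bounded_clinear E" "\<And>x. norm (E x) \<le> norm x" "\<And>x. x \<in> K \<Longrightarrow> E x = x"
    "\<And>x. (\<And>i. i \<in> K \<Longrightarrow> cinner i x = 0) \<Longrightarrow> E x = 0" "\<And>x. adj E x = E x"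
    by (rule projection_onto_span[of K "\<lambda>x. x"]) blast
  have "E x \<in> K" for x
  proof -
    obtain y where y: "y \<in> K" "\<And>z. z \<in> K \<Longrightarrow> cinner (x - y) z = 0"
      using orthogonal_projection_exists[OF K] by metis
    have "E (x - y) = 0" using y(2) by (intro E(4)) (metis cinner_commute complex_cnj_zero)
    then show ?thesis using y(1) by (simp add: bounded_clinear_diff[OF E(1)] E(3))
  qed
  from that[OF E(1-3) this E(5)] show ?thesis .
qed

text \<open>Values of \<open>A\<close> outside \<open>K\<close> are arbitrary. Precomposing with a
  map into \<open>K\<close> yields an operator on the whole type, to which \<open>adj\<close>
  applies.\<close>

lemma bounded_op_on_extend:
  assumes A: "bounded_op_on K A" and E: "bounded_clinear E" "\<And>x. E x \<in> K" "\<And>x. norm (E x) \<le> norm x"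
  shows "bounded_clinear (\<lambda>x. A (E x))"
proof -
  obtain b where b: "\<And>x. x \<in> K \<Longrightarrow> norm (A x) \<le> b * norm x"
    using A unfolding bounded_op_on_def by blast
  have "norm (A (E x)) \<le> max b 0 * norm x" for x
  proof -
    have "norm (A (E x)) \<le> max b 0 * norm (E x)"
      by (rule order_trans[OF b[OF E(2)] mult_right_mono]) auto
    also have "\<dots> \<le> max b 0 * norm x" by (intro mult_left_mono E) simp
    finally show ?thesis .
  qed
  then show ?thesis
    using A E(2) by (intro bounded_clinearI[of _ "max b 0"])
      (simp_all add: bounded_op_on_def bounded_clinear_add[OF E(1)] bounded_clinear_scaleC[OF E(1)])
qed

lemma adj_on_eqI:
  fixes K :: "'a::chilbert_space set"
  assumes "complex_vector.subspace K" "x \<in> K" "\<And>z. z \<in> K \<Longrightarrow> cinner z x = cinner (A z) y"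
  shows "adj_on K A y = x"
  unfolding adj_on_def
proof (rule the_equality)
  fix x' assume x': "x' \<in> K \<and> (\<forall>z\<in>K. cinner z x' = cinner (A z) y)"
  then have "x - x' \<in> K" using assms by (intro complex_vector.subspace_diff) auto
  then have "cinner (x - x') x - cinner (x - x') x' = 0" using x' assms by simp
  then have "cinner (x - x') (x - x') = 0" by (simp only: cinner_diff_right)
  then show "x' = x" by simp
qed (use assms in auto)

lemma cinner_adj_on:
  assumes K: "hilbert_subspace K" and A: "bounded_op_on K A" and "z \<in> K"
  shows "cinner z (adj_on K A y) = cinner (A z) y"
proof -
  obtain E where E: "bounded_clinear E" "\<And>x. norm (E x) \<le> norm x" "\<And>x. x \<in> K \<Longrightarrow> E x = x" "\<And>x. E x \<in> K"
    "\<And>x. adj E x = E x" by (rule subspace_projection[OF K]) blast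
  note AE = bounded_op_on_extend[OF A E(1,4,2)]
  \<comment> \<open>The projection of the global adjoint back to \<open>K\<close> satisfies the
    description of \<open>adj_on\<close>, which settles existence.\<close>
  have "cinner z (E (adj (\<lambda>x. A (E x)) y)) = cinner (A z) y" if "z \<in> K" for z
    using cinner_adj_right[OF E(1)] cinner_adj_right[OF AE] by (metis E(3,5) that)
  moreover from this have "adj_on K A y = E (adj (\<lambda>x. A (E x)) y)"
    using K by (intro adj_on_eqI E(4)) (auto simp: hilbert_subspace_def)
  ultimately show ?thesis using assms(3) by simp
qed

lemma subspace_range_embedding:
  assumes J: "isometric_embedding J K"
  shows "complex_vector.subspace (range J)"
  unfolding complex_vector.subspace_def
proof (intro conjI ballI allI)
  note bJ = isometric_embedding_imp_bounded_clinear[OF J]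
  show "0 \<in> range J" using bounded_clinear_0[OF bJ] by (metis rangeI)
  show "x + y \<in> range J" if "x \<in> range J" "y \<in> range J" for x y
    using that by (auto simp flip: bounded_clinear_add[OF bJ])
  show "c *\<^sub>C x \<in> range J" if "x \<in> range J" for c x
    using that by (auto simp flip: bounded_clinear_scaleC[OF bJ])
qed

lemma cinner_embedding:
  assumes "isometric_embedding J K" shows "cinner (J x) (J y) = cinner x y"
  using norm_eq_imp_cinner_eq[OF isometric_embedding_imp_bounded_clinear[OF assms] bounded_clinear_ident] assms
  by (auto simp: isometric_embedding_def)

lemma oproj_range:
  assumes J: "isometric_embedding J K"
  shows "oproj (range J) x = J (adj J x)"
  using cinner_adj_left[OF isometric_embedding_imp_bounded_clinear[OF J]]
  by (intro oproj_eqI subspace_range_embedding[OF J]) (auto simp: cinner_diff_left cinner_embedding[OF J])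

lemma inj_embedding:
  assumes J: "isometric_embedding J K" and "J x = J y" shows "x = y"
proof -
  have "J (x - y) = 0"
    using assms(2) by (simp add: bounded_clinear_diff[OF isometric_embedding_imp_bounded_clinear[OF J]])
  then have "norm (x - y) = 0" using J by (metis isometric_embedding_def norm_zero)
  then show ?thesis by simp
qed

text \<open>For the two combinations \<open>u\<close> and \<open>x\<close>, the hypothesis gives
  \<open>cinner u u = cinner (V u) x\<close>, and Cauchy-Schwarz cancels one factor
  \<open>norm u\<close>. Here \<open>V\<close> will come from the additional generator of the
  monoid.\<close>

lemma norm_sum_le_of_compression:
  assumes V: "bounded_clinear V" "\<And>x. norm (V x) \<le> norm x"
    and eq: "\<And>i j. i \<in> F \<Longrightarrow> j \<in> F \<Longrightarrow> cinner (V (b i)) (a j) = cinner (b i) (b j)"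
  shows "norm (\<Sum>i\<in>F. c i *\<^sub>C b i) \<le> norm (\<Sum>i\<in>F. c i *\<^sub>C a i)"
proof -
  define u where "u = (\<Sum>i\<in>F. c i *\<^sub>C b i)"
  define x where "x = (\<Sum>i\<in>F. c i *\<^sub>C a i)"
  have "cinner u u = cinner (V u) x"
    unfolding u_def x_def bounded_clinear_sum[OF V(1)] bounded_clinear_scaleC[OF V(1)]
      cinner_sum_left cinner_sum_right cinner_scaleC_left cinner_scaleC_right
    using eq by (intro sum.cong refl) simp
  then have "cmod (cinner u u) = cmod (cinner (V u) x)" by simp
  then have "(norm u)\<^sup>2 = cmod (cinner (V u) x)" by (simp add: cinner_self norm_power)
  also have "\<dots> \<le> norm (V u) * norm x" by (rule norm_cinner_le)
  also have "\<dots> \<le> norm u * norm x" by (intro mult_right_mono V) simp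
  finally show ?thesis
    unfolding u_def[symmetric] x_def[symmetric] by (cases "u = 0") (simp_all add: power2_eq_square)
qed

section \<open>The kernel of a *-regular dilation\<close>

text \<open>Positive definiteness of the kernel is encoded by a factorization: the vectors
  \<open>L p x\<close> form a Kolmogorov decomposition, in a space left open so that different
  dilations can be compared.\<close>

definition lcm_kernel :: "('p, 'm) monoid_scheme \<Rightarrow> ('p \<Rightarrow> 'h \<Rightarrow> 'h::chilbert_space) \<Rightarrow> ('p \<Rightarrow> 'h \<Rightarrow> 'x::chilbert_space) \<Rightarrow> bool"
  where "lcm_kernel P T L \<longleftrightarrow>
    (\<forall>p\<in>carrier P. bounded_clinear (L p)) \<and>
    (\<forall>p\<in>carrier P. \<forall>q\<in>carrier P. \<forall>r\<in>carrier P.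
       (p <#\<^bsub>P\<^esub> carrier P) \<inter> (q <#\<^bsub>P\<^esub> carrier P) = r <#\<^bsub>P\<^esub> carrier P \<longrightarrow>
       (\<forall>x y. cinner (L p x) (L q y) = cinner x (T (lquot P p r) (adj (T (lquot P q r)) y)))) \<and>
    (\<forall>p\<in>carrier P. \<forall>q\<in>carrier P.
       (p <#\<^bsub>P\<^esub> carrier P) \<inter> (q <#\<^bsub>P\<^esub> carrier P) = {} \<longrightarrow> (\<forall>x y. cinner (L p x) (L q y) = 0))"

lemma lcm_kernelD:
  assumes "lcm_kernel P T L"
  shows "p \<in> carrier P \<Longrightarrow> bounded_clinear (L p)"
    "\<lbrakk>p \<in> carrier P; q \<in> carrier P; r \<in> carrier P;
      (p <#\<^bsub>P\<^esub> carrier P) \<inter> (q <#\<^bsub>P\<^esub> carrier P) = r <#\<^bsub>P\<^esub> carrier P\<rbrakk>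
      \<Longrightarrow> cinner (L p x) (L q y) = cinner x (T (lquot P p r) (adj (T (lquot P q r)) y))"
    "\<lbrakk>p \<in> carrier P; q \<in> carrier P; (p <#\<^bsub>P\<^esub> carrier P) \<inter> (q <#\<^bsub>P\<^esub> carrier P) = {}\<rbrakk>
      \<Longrightarrow> cinner (L p x) (L q y) = 0"
  using assms unfolding lcm_kernel_def by blast+

text \<open>The kernel depends on \<open>T\<close> alone. This links the dilations for the two
  contractions, which live on unrelated spaces.\<close>

lemma (in right_LCM_monoid) lcm_kernel_unique:
  assumes "lcm_kernel P T L" "lcm_kernel P T L'" "p \<in> carrier P" "q \<in> carrier P"
  shows "cinner (L p x) (L q y) = cinner (L' p x) (L' q y)"
  using assms(3,4)
proof (cases rule: LCM_cases)
  case empty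
  then show ?thesis using lcm_kernelD(3)[OF assms(1)] lcm_kernelD(3)[OF assms(2)] assms(3,4) by simp
next
  case (lcm r)
  then show ?thesis using lcm_kernelD(2)[OF assms(1)] lcm_kernelD(2)[OF assms(2)] assms(3,4) by simp
qed

text \<open>The part of the dilation in degree 0 gives the kernel, and a single step in the
  natural-number direction gives the domination by \<open>S\<close>.\<close>

lemma (in right_LCM_monoid) lcm_kernel_of_star_regular:
  fixes S :: "'h::chilbert_space \<Rightarrow> 'h" and V :: "nat \<times> 'a \<Rightarrow> 'k::chilbert_space \<Rightarrow> 'k"
  assumes V: "star_regular_dilation (nat_add \<times>\<times> P) (rep_times S T) K J V"
    and S: "bounded_clinear S" and T: "\<forall>p\<in>carrier P. bounded_clinear (T p)"
  shows "lcm_kernel P T (\<lambda>p x. V (0, p) (J x))"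
    "\<And>p x. p \<in> carrier P \<Longrightarrow> norm (V (0, p) (J x)) = norm x"
    "\<And>F c. finite F \<Longrightarrow> F \<subseteq> carrier P \<times> UNIV \<Longrightarrow>
      norm (\<Sum>(p, x)\<in>F. c (p, x) *\<^sub>C V (0, p) (J (adj S x))) \<le> norm (\<Sum>(p, x)\<in>F. c (p, x) *\<^sub>C V (0, p) (J x))"
proof -
  have K: "hilbert_subspace K" and J: "isometric_embedding J K"
    and rep: "representation_on (nat_add \<times>\<times> P) K V"
    using V unfolding star_regular_dilation_def isometric_dilation_def isometric_rep_def by blast+
  have iso: "isometry_on K (V (n, p))" if "p \<in> carrier P" for n p
    using V that unfolding star_regular_dilation_def isometric_dilation_def isometric_rep_def
    by (auto dest!: bspec[of _ _ "(n, p)"])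
  have reg: "oproj (range J) (adj_on K (V (n, p)) (V (m, q) (J h))) =
          J (rep_times S T (lquot (nat_add \<times>\<times> P) (n, p) (l, r))
            (adj_on UNIV (rep_times S T (lquot (nat_add \<times>\<times> P) (m, q) (l, r))) h))"
    if "p \<in> carrier P" "q \<in> carrier P" "r \<in> carrier P"
        "((n, p) <#\<^bsub>nat_add \<times>\<times> P\<^esub> carrier (nat_add \<times>\<times> P)) \<inter> ((m, q) <#\<^bsub>nat_add \<times>\<times> P\<^esub> carrier (nat_add \<times>\<times> P))
          = (l, r) <#\<^bsub>nat_add \<times>\<times> P\<^esub> carrier (nat_add \<times>\<times> P)" for n p m q l r h
    using V[unfolded star_regular_dilation_def, THEN conjunct2, THEN conjunct1, rule_format, OF _ _ _ that(4)]
    that(1-3) by simp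
  have reg0: "oproj (range J) (adj_on K (V (n, p)) (V (m, q) (J h))) = 0"
    if "p \<in> carrier P" "q \<in> carrier P"
        "((n, p) <#\<^bsub>nat_add \<times>\<times> P\<^esub> carrier (nat_add \<times>\<times> P)) \<inter> ((m, q) <#\<^bsub>nat_add \<times>\<times> P\<^esub> carrier (nat_add \<times>\<times> P))
          = {}" for n p m q h
    using V[unfolded star_regular_dilation_def, THEN conjunct2, THEN conjunct2, rule_format, OF _ _ that(3)]
    that(1,2) by simp
  note bJ = isometric_embedding_imp_bounded_clinear[OF J]
  have JK: "J x \<in> K" for x using J by (simp add: isometric_embedding_def)
  have VK: "V (n, p) x \<in> K" if "p \<in> carrier P" "x \<in> K" for n p x
    using iso[OF that(1), of n] that(2) by (auto simp: isometry_on_def bounded_op_on_def)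
  have bV: "bounded_op_on K (V (n, p))" if "p \<in> carrier P" for n p
    using iso[OF that, of n] by (simp add: isometry_on_def)
  have gram: "cinner (V (n, p) (J x)) (V (m, q) (J y)) = cinner x v"
    if p: "p \<in> carrier P" and "q \<in> carrier P"
      and "oproj (range J) (adj_on K (V (n, p)) (V (m, q) (J y))) = J v" for n p m q x y v
  proof -
    have "adj J (adj_on K (V (n, p)) (V (m, q) (J y))) = v"
      using that(3) unfolding oproj_range[OF J] by (rule inj_embedding[OF J])
    then have "cinner (J x) (adj_on K (V (n, p)) (V (m, q) (J y))) = cinner x v"
      using cinner_adj_right[OF bJ] by metis
    then show ?thesis using cinner_adj_on[OF K bV[OF p] JK] by simp
  qed
  have g0: "cinner (V (n, p) (J x)) (V (0, q) (J y)) = 0"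
    if "p \<in> carrier P" "q \<in> carrier P" "(p <# carrier P) \<inter> (q <# carrier P) = {}" for n p q x y
    using gram[of p q n 0 y 0 x] reg0[of p q n 0 y] that
    by (simp add: nat_times_ideal_Int bounded_clinear_0[OF bJ])
  have g1: "cinner (V (n, p) (J x)) (V (0, q) (J y)) =
      cinner x (rep_times S T (0, lquot P p r) (adj (rep_times S T (n, lquot P q r)) y))"
    if "p \<in> carrier P" "q \<in> carrier P" "r \<in> carrier P" "(p <# carrier P) \<inter> (q <# carrier P) = (r <# carrier P)"
    for n p q r x y
  proof -
    \<comment> \<open>The least common multiple of (n, p) and (0, q) is (n, r), so all n copies of
      \<open>S\<close> fall to the quotient of the second element.\<close>
    have "lquot (nat_add \<times>\<times> P) (n, p) (n, r) = (0, lquot P p r)"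
      "lquot (nat_add \<times>\<times> P) (0, q) (n, r) = (n, lquot P q r)"
      using lquot_nat_times[OF that(1) ideal_eq_subset(1)[OF that(3,4)], of n n]
        lquot_nat_times[OF that(2) ideal_eq_subset(2)[OF that(3,4)], of 0 n] by simp_all
    moreover have "((n, p) <#\<^bsub>nat_add \<times>\<times> P\<^esub> carrier (nat_add \<times>\<times> P)) \<inter>
      ((0, q) <#\<^bsub>nat_add \<times>\<times> P\<^esub> carrier (nat_add \<times>\<times> P)) = (n, r) <#\<^bsub>nat_add \<times>\<times> P\<^esub> carrier (nat_add \<times>\<times> P)"
      unfolding nat_times_ideal_Int unfolding nat_times_ideal that(4) by simp
    ultimately show ?thesis
      using reg[OF that(1-3), of n 0 n y] by (intro gram that) (simp add: adj_on_UNIV)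
  qed
  have rt: "rep_times S T (0, s) = T s" "rep_times S T (Suc 0, s) = (\<lambda>x. S (T s x))" for s
    by (simp_all add: rep_times_def fun_eq_iff)
  show ker: "lcm_kernel P T (\<lambda>p x. V (0, p) (J x))"
    unfolding lcm_kernel_def
  proof (intro conjI ballI impI allI)
    fix p assume p: "p \<in> carrier P"
    have "norm (V (0, p) (J x)) = norm x" for x
      using iso[OF p, of 0] J by (auto simp: isometry_on_def isometric_embedding_def)
    then show "bounded_clinear (\<lambda>x. V (0, p) (J x))"
      using bV[OF p, of 0] JK
      by (intro bounded_clinearI[of _ 1])
        (simp_all add: bounded_op_on_def bounded_clinear_add[OF bJ] bounded_clinear_scaleC[OF bJ])
  qed (use g0[where n = 0] g1[where n = 0] in \<open>simp_all add: rt\<close>)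
  show "norm (V (0, p) (J x)) = norm x" if "p \<in> carrier P" for p x
    using iso[OF that, of 0] J by (auto simp: isometry_on_def isometric_embedding_def)
  obtain E where E: "bounded_clinear E" "\<And>x. norm (E x) \<le> norm x" "\<And>x. x \<in> K \<Longrightarrow> E x = x" "\<And>x. E x \<in> K"
    "\<And>x. adj E x = E x" by (rule subspace_projection[OF K]) blast
  \<comment> \<open>The isometry of the additional generator, made into a contraction on the whole
    type.\<close>
  define V1 where "V1 x = V (Suc 0, \<one>) (E x)" for x
  have V1: "bounded_clinear V1" "norm (V1 x) \<le> norm x" for x
    unfolding V1_def[abs_def] using bounded_op_on_extend[OF bV E(1,4,2)] iso[of \<one> "Suc 0"] E(2,4)
    by (auto simp: isometry_on_def)
  have key: "cinner (V1 (V (0, p) (J (adj S x)))) (V (0, q) (J y)) =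
      cinner (V (0, p) (J (adj S x))) (V (0, q) (J (adj S y)))"
    if pq: "p \<in> carrier P" "q \<in> carrier P" for p q x y
  proof -
    have "V ((Suc 0, \<one>) \<otimes>\<^bsub>nat_add \<times>\<times> P\<^esub> (0, p)) (J z) = V (Suc 0, \<one>) (V (0, p) (J z))" for z
      using rep that JK unfolding representation_on_def by (metis mem_carrier_nat_times one_closed)
    then have "V1 (V (0, p) (J z)) = V (Suc 0, p) (J z)" for z
      using that by (simp add: V1_def E(3) VK JK)
    moreover have "cinner (V (Suc 0, p) (J z)) (V (0, q) (J y)) = cinner (V (0, p) (J z)) (V (0, q) (J (adj S y)))" for z
      using pq
    proof (cases rule: LCM_cases)
      case empty
      then show ?thesis using g0 pq by simp
    next
      case (lcm r)
      have s: "lquot P q r \<in> carrier P" using lquot[OF pq(2) ideal_eq_subset(2)[OF lcm]] by simp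
      show ?thesis
        using g1[OF pq lcm, of "Suc 0"] g1[OF pq lcm, of 0] by (simp add: rt adj_comp[OF S bspec[OF T s]])
    qed
    ultimately show ?thesis by simp
  qed
  fix F :: "('a \<times> 'h) set" and c
  assume "finite F" and F: "F \<subseteq> carrier P \<times> UNIV"
  show "norm (\<Sum>(p, x)\<in>F. c (p, x) *\<^sub>C V (0, p) (J (adj S x))) \<le> norm (\<Sum>(p, x)\<in>F. c (p, x) *\<^sub>C V (0, p) (J x))"
    unfolding split_beta prod.collapse
  proof (rule norm_sum_le_of_compression[OF V1])
    fix i j assume "i \<in> F" "j \<in> F"
    then have "fst i \<in> carrier P" "fst j \<in> carrier P" using F by auto
    then show "cinner (V1 (V (0, fst i) (J (adj S (snd i))))) (V (0, fst j) (J (snd j))) =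
        cinner (V (0, fst i) (J (adj S (snd i)))) (V (0, fst j) (J (adj S (snd j))))" by (rule key)
  qed
qed

lemma (in right_LCM_monoid) norm_sum_lcm_kernel:
  assumes "lcm_kernel P T L" "lcm_kernel P T M" "F \<subseteq> carrier P \<times> UNIV"
  shows "norm (\<Sum>i\<in>F. c i *\<^sub>C L (fst i) (f (snd i))) = norm (\<Sum>i\<in>F. c i *\<^sub>C M (fst i) (f (snd i)))"
  using assms(3) by (intro norm_sum_eq_of_Gram_eq lcm_kernel_unique[OF assms(1,2)]) auto

text \<open>\<open>L\<close> is a copy of the kernel of the first dilation; the inequality for
  \<open>S2\<close>, proved on the space of the second, transfers because norms of combinations
  depend only on the common kernel.\<close>

lemma (in right_LCM_monoid) lcm_kernel_in_ell2:
  fixes S1 S2 :: "'h::chilbert_space \<Rightarrow> 'h"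
    and K1 :: "'k1::chilbert_space set" and K2 :: "'k2::chilbert_space set"
  assumes V1: "star_regular_dilation (nat_add \<times>\<times> P) (rep_times S1 T) K1 J1 V1"
    and V2: "star_regular_dilation (nat_add \<times>\<times> P) (rep_times S2 T) K2 J2 V2"
    and S1: "bounded_clinear S1" and S2: "bounded_clinear S2"
    and T: "\<forall>p\<in>carrier P. bounded_clinear (T p)" and "countable (carrier P)"
  obtains L :: "'a \<Rightarrow> 'h \<Rightarrow> 'h ell2" where "lcm_kernel P T L"
    "\<And>S F c. \<lbrakk>S = S1 \<or> S = S2; finite F; F \<subseteq> carrier P \<times> UNIV\<rbrakk> \<Longrightarrow>
      norm (\<Sum>i\<in>F. c i *\<^sub>C L (fst i) (adj S (snd i))) \<le> norm (\<Sum>i\<in>F. c i *\<^sub>C L (fst i) (snd i))"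
proof -
  note M1 = lcm_kernel_of_star_regular[OF V1 S1 T] and M2 = lcm_kernel_of_star_regular[OF V2 S2 T]
  obtain L :: "'a \<Rightarrow> 'h \<Rightarrow> 'h ell2" where L: "\<And>p. p \<in> carrier P \<Longrightarrow> bounded_clinear (L p)"
    "\<And>p q x y. p \<in> carrier P \<Longrightarrow> q \<in> carrier P \<Longrightarrow> cinner (L p x) (L q y) = cinner (V1 (0, p) (J1 x)) (V1 (0, q) (J1 y))"
    by (rule realize_Gram_in_ell2[of "carrier P" "\<lambda>p x. V1 (0, p) (J1 x)"])
      (use \<open>countable (carrier P)\<close> lcm_kernelD(1)[OF M1(1)] M1(2) in auto)
  have ker: "lcm_kernel P T L"
    using M1(1) L unfolding lcm_kernel_def by simp
  have "norm (\<Sum>i\<in>F. c i *\<^sub>C L (fst i) (adj S (snd i))) \<le> norm (\<Sum>i\<in>F. c i *\<^sub>C L (fst i) (snd i))"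
    if "S = S1 \<or> S = S2" "finite F" "F \<subseteq> carrier P \<times> UNIV" for S F c
    using that(1)
  proof
    assume "S = S1"
    then show ?thesis
      using M1(3)[OF that(2,3), of c] 
        norm_sum_lcm_kernel[OF ker M1(1) that(3), of c "adj S"] norm_sum_lcm_kernel[OF ker M1(1) that(3), of c "\<lambda>x. x"]
      by (simp add: split_beta)
  next
    assume "S = S2"
    then show ?thesis
      using M2(3)[OF that(2,3), of c] 
        norm_sum_lcm_kernel[OF ker M2(1) that(3), of c "adj S"] norm_sum_lcm_kernel[OF ker M2(1) that(3), of c "\<lambda>x. x"]
      by (simp add: split_beta)
  qed
  with ker show ?thesis by (rule that)
qed

section \<open>The minimal isometric Nica-covariant co-extension\<close>

context right_LCM_monoid
begin

context
  fixes T :: "'a \<Rightarrow> 'h::chilbert_space \<Rightarrow> 'h" and L :: "'a \<Rightarrow> 'h \<Rightarrow> 'x::chilbert_space"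
  assumes ker: "lcm_kernel P T L"
    and T: "\<And>p. p \<in> carrier P \<Longrightarrow> bounded_clinear (T p)"
    and T_one: "\<And>x. T \<one> x = x"
    and T_mult: "\<And>p q x. p \<in> carrier P \<Longrightarrow> q \<in> carrier P \<Longrightarrow> T (p \<otimes> q) x = T p (T q x)"
begin

lemma adj_T_mult:
  assumes p: "p \<in> carrier P" and q: "q \<in> carrier P"
  shows "adj (T (p \<otimes> q)) x = adj (T q) (adj (T p) x)"
proof -
  have "T (p \<otimes> q) = (\<lambda>x. T p (T q x))" using T_mult[OF p q] by blast
  then show ?thesis by (simp only: adj_comp[OF T[OF p] T[OF q]])
qed

lemma adj_T_one: "adj (T \<one>) x = x"
  by (rule adj_eqI[OF T[OF one_closed]]) (simp add: T_one)

text \<open>Left translation preserves emptiness of intersections and all quotients. This is what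
  makes \<open>L q h \<mapsto> L (p \<otimes> q) h\<close> isometric.\<close>

lemma cinner_L_translate:
  assumes p: "p \<in> carrier P" and q: "q \<in> carrier P" and q': "q' \<in> carrier P"
  shows "cinner (L (p \<otimes> q) x) (L (p \<otimes> q') y) = cinner (L q x) (L q' y)"
  using q q'
proof (cases rule: LCM_cases)
  case empty
  then have "((p \<otimes> q) <# carrier P) \<inter> ((p \<otimes> q') <# carrier P) = {}"
    using ideal_Int_mult[OF p q q'] by simp
  then show ?thesis
    using lcm_kernelD(3)[OF ker m_closed[OF p q] m_closed[OF p q']] lcm_kernelD(3)[OF ker q q' empty] by simp
next
  case (lcm r)
  note a = lquot[OF q ideal_eq_subset(1)[OF lcm]] and b = lquot[OF q' ideal_eq_subset(2)[OF lcm]]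
  have "((p \<otimes> q) <# carrier P) \<inter> ((p \<otimes> q') <# carrier P) = (p \<otimes> r) <# carrier P"
    using ideal_Int_mult[OF p q q'] unfolding lcm(2) image_mult_ideal[OF p lcm(1)] .
  moreover have "lquot P (p \<otimes> q) (p \<otimes> r) = lquot P q r"
    by (rule lquot_eqI[OF m_closed[OF p q] a(1)]) (simp only: m_assoc[OF p q a(1)] a(2))
  moreover have "lquot P (p \<otimes> q') (p \<otimes> r) = lquot P q' r"
    by (rule lquot_eqI[OF m_closed[OF p q'] b(1)]) (simp only: m_assoc[OF p q' b(1)] b(2))
  ultimately show ?thesis
    using lcm_kernelD(2)[OF ker m_closed[OF p q] m_closed[OF p q'] m_closed[OF p lcm(1)], of x y]
      lcm_kernelD(2)[OF ker q q' lcm, of x y] by simp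
qed

text \<open>Yields the adjoint of \<open>W p\<close> on \<open>L q h\<close>. If \<open>t\<close> is
  a least common multiple of \<open>s\<close> and \<open>lquot P p r\<close>, then
  \<open>p \<otimes> t\<close> is one of \<open>p \<otimes> s\<close> and \<open>q\<close>, and its
  quotient by \<open>q\<close> splits through \<open>r\<close>; the adjoints of \<open>T\<close>
  multiply accordingly.\<close>

lemma cinner_L_shift:
  assumes p: "p \<in> carrier P" and q: "q \<in> carrier P" and r: "r \<in> carrier P" and s: "s \<in> carrier P"
    and lcm: "(p <# carrier P) \<inter> (q <# carrier P) = r <# carrier P"
  shows "cinner (L (p \<otimes> s) g) (L q h) = cinner (L s g) (L (lquot P p r) (adj (T (lquot P q r)) h))"
proof -
  note a = lquot[OF p ideal_eq_subset(1)[OF r lcm]] and b = lquot[OF q ideal_eq_subset(2)[OF r lcm]]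
  note ps = m_closed[OF p s]
  have int: "((p \<otimes> s) <# carrier P) \<inter> (q <# carrier P) = (\<otimes>) p ` ((lquot P p r <# carrier P) \<inter> (s <# carrier P))"
    by (rule ideal_Int_translate[OF p q r s lcm])
  show ?thesis
    using s a(1)
  proof (cases rule: LCM_cases)
    case empty
    then have "((p \<otimes> s) <# carrier P) \<inter> (q <# carrier P) = {}" using int by blast
    then show ?thesis using lcm_kernelD(3)[OF ker ps q] lcm_kernelD(3)[OF ker s a(1) empty] by simp
  next
    case (lcm t)
    note \<beta> = lquot[OF s ideal_eq_subset(1)[OF lcm]] and \<alpha> = lquot[OF a(1) ideal_eq_subset(2)[OF lcm]]
    have "((p \<otimes> s) <# carrier P) \<inter> (q <# carrier P) = (p \<otimes> t) <# carrier P"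
      using int unfolding Int_commute[of "lquot P p r <# carrier P"] lcm(2) image_mult_ideal[OF p lcm(1)] .
    moreover have "lquot P (p \<otimes> s) (p \<otimes> t) = lquot P s t"
      by (rule lquot_eqI[OF ps \<beta>(1)]) (simp only: m_assoc[OF p s \<beta>(1)] \<beta>(2))
    moreover have "lquot P q (p \<otimes> t) = lquot P q r \<otimes> lquot P (lquot P p r) t"
    proof (rule lquot_eqI[OF q m_closed[OF b(1) \<alpha>(1)]])
      have "q \<otimes> (lquot P q r \<otimes> lquot P (lquot P p r) t) = r \<otimes> lquot P (lquot P p r) t"
        using m_assoc[OF q b(1) \<alpha>(1)] unfolding b(2) by simp
      also have "\<dots> = (p \<otimes> lquot P p r) \<otimes> lquot P (lquot P p r) t" by (simp only: a(2))
      also have "\<dots> = p \<otimes> t" by (simp only: m_assoc[OF p a(1) \<alpha>(1)] \<alpha>(2))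
      finally show "q \<otimes> (lquot P q r \<otimes> lquot P (lquot P p r) t) = p \<otimes> t" .
    qed
    ultimately show ?thesis
      using lcm_kernelD(2)[OF ker ps q m_closed[OF p lcm(1)], of g h]
        lcm_kernelD(2)[OF ker s a(1) lcm, of g "adj (T (lquot P q r)) h"]
      by (simp add: adj_T_mult[OF b(1) \<alpha>(1)])
  qed
qed

lemma cinner_L_shift_empty:
  assumes p: "p \<in> carrier P" and q: "q \<in> carrier P" and s: "s \<in> carrier P"
    and empty: "(p <# carrier P) \<inter> (q <# carrier P) = {}"
  shows "cinner (L (p \<otimes> s) g) (L q h) = 0"
proof (rule lcm_kernelD(3)[OF ker m_closed[OF p s] q])
  show "((p \<otimes> s) <# carrier P) \<inter> (q <# carrier P) = {}"
    using ideal_mult_subset[OF p s] empty by blast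
qed

lemma norm_L_one: "norm (L \<one> x) = norm x"
proof -
  have "lquot P \<one> \<one> = \<one>" by (rule lquot_eqI) auto
  then have "cinner (L \<one> x) (L \<one> x) = cinner x x"
    using lcm_kernelD(2)[OF ker one_closed one_closed one_closed Int_absorb, of x x]
    by (simp add: T_one adj_T_one)
  then have "complex_of_real ((norm (L \<one> x))\<^sup>2) = complex_of_real ((norm x)\<^sup>2)" by (simp only: cinner_self)
  then show ?thesis unfolding of_real_eq_iff by (simp add: power2_eq_iff_nonneg)
qed

text \<open>\<open>R\<^sub>i\<close> is the map \<open>L p h \<mapsto> L p (S\<^sub>i\<^sup>* h)\<close>.  It commutes with \<open>W(p)\<^sup>*\<close> as well as with \<open>W(p)\<close> because
  \<open>W(p)\<^sup>* L q h = L (p\<^sup>-\<^sup>1r) (T(q\<^sup>-\<^sup>1r)\<^sup>* h)\<close> and \<open>S\<^sub>i\<^sup>*\<close> commutes with every \<open>T(s)\<^sup>*\<close>.\<close>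

lemma minimal_Nica_coextension:
  fixes S1 S2 :: "'h \<Rightarrow> 'h"
  assumes S: "\<And>S. S = S1 \<or> S = S2 \<Longrightarrow> bounded_clinear S"
    and ST: "\<And>S p x. S = S1 \<or> S = S2 \<Longrightarrow> p \<in> carrier P \<Longrightarrow> S (T p x) = T p (S x)"
    and S12: "\<And>x. S1 (S2 x) = S2 (S1 x)"
    and contr: "\<And>S F c. \<lbrakk>S = S1 \<or> S = S2; finite F; F \<subseteq> carrier P \<times> UNIV\<rbrakk> \<Longrightarrow>
      norm (\<Sum>i\<in>F. c i *\<^sub>C L (fst i) (adj S (snd i))) \<le> norm (\<Sum>i\<in>F. c i *\<^sub>C L (fst i) (snd i))"
  obtains E W R1 R2 where
    "bounded_clinear E" "\<And>x. E (E x) = E x" "\<And>x. adj E x = E x"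
    "\<And>p. p \<in> carrier P \<Longrightarrow> bounded_clinear (W p)"
    "\<And>p x. p \<in> carrier P \<Longrightarrow> E (W p x) = W p x" "\<And>p x. p \<in> carrier P \<Longrightarrow> W p (E x) = W p x"
    "\<And>p x. p \<in> carrier P \<Longrightarrow> adj (W p) (W p x) = E x"
    "\<And>x. W \<one> x = E x" "\<And>p q x. p \<in> carrier P \<Longrightarrow> q \<in> carrier P \<Longrightarrow> W (p \<otimes> q) x = W p (W q x)"
    "\<And>p q r x. \<lbrakk>p \<in> carrier P; q \<in> carrier P; r \<in> carrier P;
      (p <# carrier P) \<inter> (q <# carrier P) = r <# carrier P\<rbrakk> \<Longrightarrow>
      W p (adj (W p) (W q (adj (W q) x))) = W r (adj (W r) x)"
    "\<And>p q x. \<lbrakk>p \<in> carrier P; q \<in> carrier P; (p <# carrier P) \<inter> (q <# carrier P) = {}\<rbrakk> \<Longrightarrow>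
      W p (adj (W p) (W q (adj (W q) x))) = 0"
    "\<And>h. E (L \<one> h) = L \<one> h" "\<And>p h. p \<in> carrier P \<Longrightarrow> adj (W p) (L \<one> h) = L \<one> (adj (T p) h)"
    "\<And>R. R = R1 \<or> R = R2 \<Longrightarrow> bounded_clinear R" "\<And>R x. R = R1 \<or> R = R2 \<Longrightarrow> norm (R x) \<le> norm x"
    "\<And>R x. R = R1 \<or> R = R2 \<Longrightarrow> R (E x) = E (R x)"
    "\<And>R p x. R = R1 \<or> R = R2 \<Longrightarrow> p \<in> carrier P \<Longrightarrow> R (W p x) = W p (R x)"
    "\<And>R p x. R = R1 \<or> R = R2 \<Longrightarrow> p \<in> carrier P \<Longrightarrow> R (adj (W p) x) = adj (W p) (R x)"
    "\<And>x. R1 (R2 x) = R2 (R1 x)"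
    "\<And>h. R1 (L \<one> h) = L \<one> (adj S1 h)" "\<And>h. R2 (L \<one> h) = L \<one> (adj S2 h)"
proof -
  let ?I = "carrier P \<times> (UNIV :: 'h set)" and ?L = "\<lambda>i. L (fst i) (snd i)"
  obtain E where E: "bounded_clinear E" "\<And>x. norm (E x) \<le> norm x" and E_L': "\<And>i. i \<in> ?I \<Longrightarrow> E (?L i) = ?L i"
    and E_orth: "\<And>x. (\<And>i. i \<in> ?I \<Longrightarrow> cinner (?L i) x = 0) \<Longrightarrow> E x = 0"
    and EE: "\<And>x. E (E x) = E x" and E_adj: "\<And>x. adj E x = E x"
    by (rule projection_onto_span[of ?I ?L]) blast
  have E_L: "E (L q h) = L q h" if "q \<in> carrier P" for q h using E_L'[of "(q, h)"] that by simp
  have E0: "E 0 = 0" by (rule bounded_clinear_0[OF E(1)])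
  \<comment> \<open>Invariance under precomposition with \<open>E\<close> means vanishing on the
    complement of the generating vectors, so agreement on those vectors suffices.\<close>
  have op_eqI: "A x = B x"
    if "bounded_clinear A" "bounded_clinear B" "\<And>x. A (E x) = A x" "\<And>x. B (E x) = B x"
      "\<And>q h. q \<in> carrier P \<Longrightarrow> A (L q h) = B (L q h)" for A B :: "'x \<Rightarrow> 'x" and x
  proof (rule bounded_clinear_eqI[OF that(1,2), of ?I ?L])
    show "A (?L i) = B (?L i)" if "i \<in> ?I" for i
      using that \<open>\<And>q h. q \<in> carrier P \<Longrightarrow> A (L q h) = B (L q h)\<close>[of "fst i" "snd i"] by auto
    fix x assume "\<And>i. i \<in> ?I \<Longrightarrow> cinner (?L i) x = 0"
    then have "E x = 0" by (rule E_orth)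
    then show "A x = B x"
      using that(3)[of x] that(4)[of x] bounded_clinear_0[OF that(1)] bounded_clinear_0[OF that(2)] by simp
  qed
  have vec_eqI: "u = v" if "E u = u" "E v = v" "\<And>s g. s \<in> carrier P \<Longrightarrow> cinner (L s g) u = cinner (L s g) v" for u v
  proof -
    have "E (u - v) = 0" by (rule E_orth) (use that(3) in \<open>auto simp: cinner_diff_right\<close>)
    then show ?thesis using that(1,2) by (simp add: bounded_clinear_diff[OF E(1)])
  qed

  have "\<exists>A. bounded_clinear A \<and> (\<forall>x. E (A x) = A x) \<and> (\<forall>x. A (E x) = A x) \<and>
      (\<forall>q\<in>carrier P. \<forall>h. A (L q h) = L (p \<otimes> q) h)" if p: "p \<in> carrier P" for p
  proof -
    have le: "norm (\<Sum>i\<in>F. c i *\<^sub>C L (p \<otimes> fst i) (snd i)) \<le> norm (\<Sum>i\<in>F. c i *\<^sub>C ?L i)"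
      if F: "F \<subseteq> ?I" for F c
      by (rule eq_refl, rule norm_sum_eq_of_Gram_eq, rule cinner_L_translate[OF p]) (use F in auto)
    have "\<exists>A. bounded_clinear A \<and> (\<forall>i\<in>?I. A (?L i) = L (p \<otimes> fst i) (snd i)) \<and>
        (\<forall>x. (\<forall>i\<in>?I. cinner (?L i) x = 0) \<longrightarrow> A x = 0)"
      by (rule contraction_extension[of ?I "\<lambda>i. L (p \<otimes> fst i) (snd i)" ?L, OF le]) (assumption, blast)
    then obtain A where A: "bounded_clinear A" "\<And>i. i \<in> ?I \<Longrightarrow> A (?L i) = L (p \<otimes> fst i) (snd i)"
      "\<And>x. (\<And>i. i \<in> ?I \<Longrightarrow> cinner (?L i) x = 0) \<Longrightarrow> A x = 0" by blast
    have AL: "A (L q h) = L (p \<otimes> q) h" if "q \<in> carrier P" for q h using A(2)[of "(q, h)"] that by simp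
    have AE: "A (E x) = A x" for x
      by (rule bounded_clinear_eqI[OF bounded_clinear_comp[OF A(1) E(1)] A(1), of ?I ?L])
        (simp_all add: E_L' E_orth A(3) bounded_clinear_0[OF A(1)])
    have "E (A x) = A x" for x
      by (rule op_eqI[OF bounded_clinear_comp[OF E(1) A(1)] A(1)]) (simp_all add: AE AL E_L p)
    then show ?thesis using A(1) AE AL by blast
  qed
  then have "\<forall>p\<in>carrier P. \<exists>A. bounded_clinear A \<and> (\<forall>x. E (A x) = A x) \<and> (\<forall>x. A (E x) = A x) \<and>
      (\<forall>q\<in>carrier P. \<forall>h. A (L q h) = L (p \<otimes> q) h)" by blast
  from bchoice[OF this] obtain W where W': "\<forall>p\<in>carrier P. bounded_clinear (W p) \<and> (\<forall>x. E (W p x) = W p x) \<and>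
      (\<forall>x. W p (E x) = W p x) \<and> (\<forall>q\<in>carrier P. \<forall>h. W p (L q h) = L (p \<otimes> q) h)" by blast
  have W: "bounded_clinear (W p)" and EW: "\<And>x. E (W p x) = W p x" and WE: "\<And>x. W p (E x) = W p x"
    and WL: "\<And>q h. q \<in> carrier P \<Longrightarrow> W p (L q h) = L (p \<otimes> q) h" if "p \<in> carrier P" for p
    using W' that by blast+
  note aW = bounded_clinear_adj[OF W]
  have aWE: "adj (W p) (E x) = adj (W p) x" if p: "p \<in> carrier P" for p x
    using EW[OF p] by (intro cinner_eqI) (metis cinner_adj_right[OF W[OF p]] cinner_adj_right[OF E(1)] E_adj)
  have EaW: "E (adj (W p) x) = adj (W p) x" if p: "p \<in> carrier P" for p x
    using WE[OF p] by (intro cinner_eqI) (metis cinner_adj_right[OF W[OF p]] cinner_adj_right[OF E(1)] E_adj)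
  \<comment> \<open>Both sides are fixed by \<open>E\<close>; tested against \<open>L s g\<close>,
    the claim is \<open>cinner_L_shift\<close>.\<close>
  have aWL: "adj (W p) (L q h) = L (lquot P p r) (adj (T (lquot P q r)) h)"
    if p: "p \<in> carrier P" and q: "q \<in> carrier P" and r: "r \<in> carrier P" "(p <# carrier P) \<inter> (q <# carrier P) = r <# carrier P"
    for p q r h
  proof (rule vec_eqI)
    show "E (L (lquot P p r) (adj (T (lquot P q r)) h)) = L (lquot P p r) (adj (T (lquot P q r)) h)"
      by (rule E_L[OF lquot(1)[OF p ideal_eq_subset(1)[OF r]]])
    show "cinner (L s g) (adj (W p) (L q h)) = cinner (L s g) (L (lquot P p r) (adj (T (lquot P q r)) h))"
      if "s \<in> carrier P" for s g
      unfolding cinner_adj_right[OF W[OF p]] WL[OF p that] by (rule cinner_L_shift[OF p q r(1) that r(2)])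
  qed (rule EaW[OF p])
  have aWL0: "adj (W p) (L q h) = 0"
    if p: "p \<in> carrier P" and q: "q \<in> carrier P" and e: "(p <# carrier P) \<inter> (q <# carrier P) = {}" for p q h
  proof (rule vec_eqI)
    show "cinner (L s g) (adj (W p) (L q h)) = cinner (L s g) 0" if "s \<in> carrier P" for s g
      unfolding cinner_adj_right[OF W[OF p]] WL[OF p that] by (simp add: cinner_L_shift_empty[OF p q that e])
  qed (simp_all add: EaW[OF p] E0)
  have W0: "W p 0 = 0" "adj (W p) 0 = 0" if "p \<in> carrier P" for p
    using bounded_clinear_0[OF W[OF that]] bounded_clinear_0[OF aW[OF that]] .
  \<comment> \<open>The range projection of \<open>W p\<close> moves \<open>L q h\<close> to the
    index of the least common multiple, by a formula in which \<open>p\<close> enters only through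
    \<open>r\<close>. This reduces both Nica relations to intersections of ideals.\<close>
  have PL: "W p (adj (W p) (L q h)) = L r (adj (T (lquot P q r)) h)"
    if "p \<in> carrier P" "q \<in> carrier P" "r \<in> carrier P" "(p <# carrier P) \<inter> (q <# carrier P) = r <# carrier P" for p q r h
    using lquot[OF that(1) ideal_eq_subset(1)[OF that(3,4)]] by (simp add: aWL[OF that] WL[OF that(1)])
  have PL0: "W p (adj (W p) (L q h)) = 0"
    if "p \<in> carrier P" "q \<in> carrier P" "(p <# carrier P) \<inter> (q <# carrier P) = {}" for p q h
    by (simp add: aWL0[OF that] W0 that)

  have 7: "adj (W p) (W p x) = E x" if p: "p \<in> carrier P" for p x
  proof (rule op_eqI[OF bounded_clinear_comp[OF aW[OF p] W[OF p]] E(1)])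
    fix q h assume q: "q \<in> carrier P"
    have pq: "p \<otimes> q \<in> carrier P" using p q by simp
    have "(p <# carrier P) \<inter> ((p \<otimes> q) <# carrier P) = (p \<otimes> q) <# carrier P"
      using ideal_mult_subset[OF p q] by blast
    moreover have "lquot P p (p \<otimes> q) = q" by (rule lquot_eqI[OF p q refl])
    moreover have "lquot P (p \<otimes> q) (p \<otimes> q) = \<one>" by (rule lquot_eqI[OF pq one_closed r_one[OF pq]])
    ultimately show "adj (W p) (W p (L q h)) = E (L q h)"
      using aWL[OF p pq pq] by (simp add: WL[OF p q] E_L[OF q] adj_T_one)
  qed (simp_all add: WE[OF p] EE)
  have 8: "W \<one> x = E x" for x
    by (rule op_eqI[OF W[OF one_closed] E(1)]) (simp_all add: WE EE WL E_L)
  have 9: "W (p \<otimes> q) x = W p (W q x)" if p: "p \<in> carrier P" and q: "q \<in> carrier P" for p q x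
    by (rule op_eqI[OF W[OF m_closed[OF p q]] bounded_clinear_comp[OF W[OF p] W[OF q]]])
      (simp_all add: WE WL p q m_assoc)
  have PP: "bounded_clinear (\<lambda>x. W p (adj (W p) x))" if "p \<in> carrier P" for p
    by (rule bounded_clinear_comp[OF W[OF that] aW[OF that]])
  have 10: "W p (adj (W p) (W q (adj (W q) x))) = W r (adj (W r) x)"
    if p: "p \<in> carrier P" and q: "q \<in> carrier P" and r: "r \<in> carrier P" "(p <# carrier P) \<inter> (q <# carrier P) = r <# carrier P"
    for p q r x
  proof (rule op_eqI[OF bounded_clinear_comp[OF PP[OF p] PP[OF q]] PP[OF r(1)]])
    fix s h assume s: "s \<in> carrier P"
    show "W p (adj (W p) (W q (adj (W q) (L s h)))) = W r (adj (W r) (L s h))"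
      using q s
    proof (cases rule: LCM_cases)
      case empty
      then have "(r <# carrier P) \<inter> (s <# carrier P) = {}" using r(2) by blast
      then show ?thesis using PL0[OF q s empty] PL0[OF r(1) s] by (simp add: W0 p)
    next
      case (lcm u)
      note u = lcm
      \<comment> \<open>Both sides are the intersection of the three ideals of \<open>p\<close>,
        \<open>q\<close> and \<open>s\<close>.\<close>
      have eq: "(p <# carrier P) \<inter> (u <# carrier P) = (r <# carrier P) \<inter> (s <# carrier P)"
        using u(2) r(2) by blast
      show ?thesis using r(1) s
      proof (cases rule: LCM_cases)
        case empty
        then have "(p <# carrier P) \<inter> (u <# carrier P) = {}" using eq by simp
        then show ?thesis using PL[OF q s u] PL0[OF p u(1)] PL0[OF r(1) s empty] by simp
      next
        case (lcm v)
        have pu: "(p <# carrier P) \<inter> (u <# carrier P) = v <# carrier P" using eq lcm(2) by simp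
        note su = lquot[OF s ideal_eq_subset(2)[OF u]]
        note uv = lquot[OF u(1) ideal_eq_subset(2)[OF lcm(1) pu]]
        \<comment> \<open>Quotients along \<open>s\<close>, \<open>u\<close>, \<open>v\<close>
          compose, so two successive adjoints on the left merge into the single one on the
          right.\<close>
        have "lquot P s v = lquot P s u \<otimes> lquot P u v"
          by (rule lquot_eqI[OF s m_closed[OF su(1) uv(1)]])
            (simp only: m_assoc[OF s su(1) uv(1), symmetric] su(2) uv(2))
        then show ?thesis
          using PL[OF q s u] PL[OF p u(1) lcm(1) pu] PL[OF r(1) s lcm] adj_T_mult[OF su(1) uv(1)] by simp
      qed
    qed
  qed (simp_all add: aWE p q r)
  have 11: "W p (adj (W p) (W q (adj (W q) x))) = 0"
    if p: "p \<in> carrier P" and q: "q \<in> carrier P" and e: "(p <# carrier P) \<inter> (q <# carrier P) = {}" for p q x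
  proof (rule op_eqI[OF bounded_clinear_comp[OF PP[OF p] PP[OF q]] bounded_clinear_zero])
    fix s h assume s: "s \<in> carrier P"
    show "W p (adj (W p) (W q (adj (W q) (L s h)))) = 0"
      using q s
    proof (cases rule: LCM_cases)
      case empty
      then show ?thesis using PL0[OF q s empty] by (simp add: W0 p)
    next
      case (lcm u)
      then have "(p <# carrier P) \<inter> (u <# carrier P) = {}" using e by blast
      then show ?thesis using PL[OF q s lcm] PL0[OF p lcm(1)] by simp
    qed
  qed (simp_all add: aWE p q)
  have 13: "adj (W p) (L \<one> h) = L \<one> (adj (T p) h)" if p: "p \<in> carrier P" for p h
  proof -
    have "(p <# carrier P) \<inter> (\<one> <# carrier P) = p <# carrier P"
      using ideal_mult_subset[OF one_closed p] p by auto
    moreover have "lquot P p p = \<one>" by (rule lquot_eqI[OF p one_closed r_one[OF p]])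
    moreover have "lquot P \<one> p = p" by (rule lquot_eqI[OF one_closed p l_one[OF p]])
    ultimately show ?thesis using aWL[OF p one_closed p] by simp
  qed

  have "\<exists>R. bounded_clinear R \<and> (\<forall>x. norm (R x) \<le> norm x) \<and> (\<forall>x. E (R x) = R x) \<and> (\<forall>x. R (E x) = R x) \<and>
      (\<forall>q\<in>carrier P. \<forall>h. R (L q h) = L q (adj S h))" if S': "S = S1 \<or> S = S2" for S
  proof -
    have "\<exists>R. bounded_clinear R \<and> (\<forall>x. norm (R x) \<le> norm x) \<and> (\<forall>i\<in>?I. R (?L i) = L (fst i) (adj S (snd i))) \<and>
        (\<forall>x. (\<forall>i\<in>?I. cinner (?L i) x = 0) \<longrightarrow> R x = 0)"
      by (rule contraction_extension[of ?I "\<lambda>i. L (fst i) (adj S (snd i))" ?L, OF contr[OF S']])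
        (assumption, assumption, blast)
    then obtain R where R: "bounded_clinear R" "\<And>x. norm (R x) \<le> norm x" "\<And>i. i \<in> ?I \<Longrightarrow> R (?L i) = L (fst i) (adj S (snd i))"
      "\<And>x. (\<And>i. i \<in> ?I \<Longrightarrow> cinner (?L i) x = 0) \<Longrightarrow> R x = 0" by blast
    have RL: "R (L q h) = L q (adj S h)" if "q \<in> carrier P" for q h using R(3)[of "(q, h)"] that by simp
    have RE: "R (E x) = R x" for x
      by (rule bounded_clinear_eqI[OF bounded_clinear_comp[OF R(1) E(1)] R(1), of ?I ?L])
        (simp_all add: E_L' E_orth R(4) bounded_clinear_0[OF R(1)])
    have "E (R x) = R x" for x
      by (rule op_eqI[OF bounded_clinear_comp[OF E(1) R(1)] R(1)]) (simp_all add: RE RL E_L)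
    then show ?thesis using R(1,2) RE RL by blast
  qed
  from this[of S1] this[of S2] obtain R1 R2 where
    R1: "bounded_clinear R1" "\<And>x. norm (R1 x) \<le> norm x" "\<And>x. E (R1 x) = R1 x" "\<And>x. R1 (E x) = R1 x"
      "\<forall>q\<in>carrier P. \<forall>h. R1 (L q h) = L q (adj S1 h)" and
    R2: "bounded_clinear R2" "\<And>x. norm (R2 x) \<le> norm x" "\<And>x. E (R2 x) = R2 x" "\<And>x. R2 (E x) = R2 x"
      "\<forall>q\<in>carrier P. \<forall>h. R2 (L q h) = L q (adj S2 h)" by blast
  have RW: "R (W p x) = W p (R x)" and RaW: "R (adj (W p) x) = adj (W p) (R x)"
    if S': "S = S1 \<or> S = S2" and R: "bounded_clinear R" "\<And>x. E (R x) = R x" "\<And>x. R (E x) = R x"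
      "\<forall>q\<in>carrier P. \<forall>h. R (L q h) = L q (adj S h)" and p: "p \<in> carrier P" for R S p x
  proof -
    show "R (W p x) = W p (R x)"
      by (rule op_eqI[OF bounded_clinear_comp[OF R(1) W[OF p]] bounded_clinear_comp[OF W[OF p] R(1)]])
        (simp_all add: WE p R(3,4) WL)
    show "R (adj (W p) x) = adj (W p) (R x)"
    proof (rule op_eqI[OF bounded_clinear_comp[OF R(1) aW[OF p]] bounded_clinear_comp[OF aW[OF p] R(1)]])
      fix q h assume q: "q \<in> carrier P"
      show "R (adj (W p) (L q h)) = adj (W p) (R (L q h))"
        using p q
      proof (cases rule: LCM_cases)
        case empty
        then show ?thesis by (simp add: R(4)[rule_format, OF q] aWL0[OF p q] bounded_clinear_0[OF R(1)])
      next
        case (lcm r)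
        note a = lquot(1)[OF p ideal_eq_subset(1)[OF lcm]] and b = lquot(1)[OF q ideal_eq_subset(2)[OF lcm]]
        show ?thesis
          by (simp add: R(4)[rule_format, OF q] R(4)[rule_format, OF a] aWL[OF p q lcm] adj_commute[OF S[OF S'] T[OF b] ST[OF S' b]])
      qed
    qed (simp_all add: aWE p R(3))
  qed
  have R12: "R1 (R2 x) = R2 (R1 x)" for x
    by (rule op_eqI[OF bounded_clinear_comp[OF R1(1) R2(1)] bounded_clinear_comp[OF R2(1) R1(1)]])
      (simp_all add: R1(4,5) R2(4,5) adj_commute[OF S[of S1] S[of S2] S12])
  note RW1 = RW[OF disjI1[OF refl] R1(1,3-5)] and RW2 = RW[OF disjI2[OF refl] R2(1,3-5)]
  note RaW1 = RaW[OF disjI1[OF refl] R1(1,3-5)] and RaW2 = RaW[OF disjI2[OF refl] R2(1,3-5)]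
  show ?thesis
  proof (rule that[of E W R1 R2])
    show "bounded_clinear R" if "R = R1 \<or> R = R2" for R using that R1(1) R2(1) by blast
    show "norm (R x) \<le> norm x" if "R = R1 \<or> R = R2" for R x using that R1(2) R2(2) by blast
    show "R (E x) = E (R x)" if "R = R1 \<or> R = R2" for R x using that R1(3,4) R2(3,4) by auto
    show "R (W p x) = W p (R x)" if "R = R1 \<or> R = R2" "p \<in> carrier P" for R p x
      using that(1) RW1[OF that(2)] RW2[OF that(2)] by blast
    show "R (adj (W p) x) = adj (W p) (R x)" if "R = R1 \<or> R = R2" "p \<in> carrier P" for R p x
      using that(1) RaW1[OF that(2)] RaW2[OF that(2)] by blast
  qed (fact E(1) EE E_adj W EW WE 7 8 9 10 11 13 R12 E_L[OF one_closed] R1(5)[rule_format, OF one_closed] R2(5)[rule_format, OF one_closed])+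
qed

end

end

section \<open>Isometries on a reducing subspace\<close>

text \<open>\<open>V\<close> acts on the whole type and may fail to be isometric off
  \<open>K\<close>, so isometry is stated as a left inverse on \<open>K\<close>. Invariance under
  \<open>adj V\<close> makes the adjoint relative to \<open>K\<close> a restriction of the global
  one.\<close>

definition reducing_isometry :: "'a::chilbert_space set \<Rightarrow> ('a \<Rightarrow> 'a) \<Rightarrow> bool" where
  "reducing_isometry K V \<longleftrightarrow> bounded_clinear V \<and> (\<forall>x\<in>K. V x \<in> K \<and> adj V x \<in> K \<and> adj V (V x) = x)"

lemma reducing_isometryD:
  assumes "reducing_isometry K V"
  shows "bounded_clinear V" "x \<in> K \<Longrightarrow> V x \<in> K" "x \<in> K \<Longrightarrow> adj V x \<in> K" "x \<in> K \<Longrightarrow> adj V (V x) = x"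
  using assms by (auto simp: reducing_isometry_def)

lemma isometry_on_of_reducing:
  assumes V: "reducing_isometry K V"
  shows "isometry_on K V"
proof -
  note D = reducing_isometryD[OF V]
  obtain b where "\<And>x. norm (V x) \<le> b * norm x" using D(1) unfolding bounded_clinear_def by blast
  then have "bounded_op_on K V"
    using D(2) bounded_clinear_add[OF D(1)] bounded_clinear_scaleC[OF D(1)]
    unfolding bounded_op_on_def by blast
  moreover have "norm (V x) = norm x" if "x \<in> K" for x
  proof -
    have "cinner (V x) (V x) = cinner x x" using D(4)[OF that] by (metis cinner_adj_right D(1))
    then have "complex_of_real ((norm (V x))\<^sup>2) = complex_of_real ((norm x)\<^sup>2)" by (simp only: cinner_self)
    then show ?thesis unfolding of_real_eq_iff by (simp add: power2_eq_iff_nonneg)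
  qed
  ultimately show ?thesis by (simp add: isometry_on_def)
qed

lemma reducing_isometry_comp:
  assumes V: "reducing_isometry K V" and W: "reducing_isometry K W"
  shows "reducing_isometry K (V \<circ> W)"
proof -
  have "reducing_isometry K (\<lambda>x. V (W x))"
    using reducing_isometryD[OF V] reducing_isometryD[OF W]
    by (simp add: reducing_isometry_def bounded_clinear_comp adj_comp)
  then show ?thesis by (simp add: comp_def)
qed

lemma reducing_isometry_funpow:
  assumes V: "reducing_isometry K V"
  shows "reducing_isometry K (V ^^ n)"
proof (induction n)
  case 0
  have "adj (\<lambda>x. x) y = y" for y :: 'a by (rule adj_eqI) simp_all
  then show ?case by (simp add: reducing_isometry_def id_def)
next
  case (Suc n)
  then show ?case by (simp only: funpow.simps reducing_isometry_comp[OF V])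
qed

lemma adj_funpow:
  fixes V :: "'a::chilbert_space \<Rightarrow> 'a"
  assumes V: "bounded_clinear V"
  shows "adj (V ^^ n) x = (adj V ^^ n) x"
proof (induction n arbitrary: x)
  case 0
  have "adj (\<lambda>x. x) x = x" for x :: 'a by (rule adj_eqI) simp_all
  then show ?case by (simp add: id_def)
next
  case (Suc n)
  have "adj (V ^^ Suc n) x = adj (V ^^ n) (adj V x)"
    using adj_comp[OF V bounded_clinear_funpow[OF V, of n], of x] by (simp add: comp_def)
  also have "\<dots> = (adj V ^^ n) (adj V x)" by (rule Suc.IH)
  also have "\<dots> = (adj V ^^ Suc n) x" by (simp add: funpow_swap1)
  finally show ?case .
qed

lemma adj_on_reducing:
  assumes "hilbert_subspace K" "reducing_isometry K V" "x \<in> K"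
  shows "adj_on K V x = adj V x"
  using assms cinner_adj_right[OF reducing_isometryD(1)[OF assms(2)]] reducing_isometryD(3)[OF assms(2,3)]
  by (intro adj_on_eqI) (auto simp: hilbert_subspace_def)

lemma funpow_commute_on:
  assumes V: "\<And>x. x \<in> K \<Longrightarrow> V x \<in> K" and "\<And>x. x \<in> K \<Longrightarrow> V (B x) = B (V x)" and "x \<in> K"
  shows "(V ^^ n) x \<in> K" "(V ^^ n) (B x) = B ((V ^^ n) x)"
proof -
  have *: "(V ^^ n) x \<in> K" for n by (induction n) (simp_all add: V assms(3))
  show "(V ^^ n) x \<in> K" by (rule *)
  show "(V ^^ n) (B x) = B ((V ^^ n) x)" by (induction n) (simp_all add: assms(2)[OF *])
qed

text \<open>The intertwining of adjoints by \<open>J\<close> gives two things at once: the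
  compression of \<open>V p\<close> is \<open>T p\<close>, and the range of \<open>J\<close> is
  co-invariant.\<close>

lemma coextension_of_reducing:
  assumes K: "hilbert_subspace K" and J: "isometric_embedding J K"
    and V: "\<And>p. p \<in> carrier Q \<Longrightarrow> reducing_isometry K (V p)"
    and one: "\<And>x. x \<in> K \<Longrightarrow> V \<one>\<^bsub>Q\<^esub> x = x"
    and mult: "\<And>p q x. p \<in> carrier Q \<Longrightarrow> q \<in> carrier Q \<Longrightarrow> x \<in> K \<Longrightarrow> V (p \<otimes>\<^bsub>Q\<^esub> q) x = V p (V q x)"
    and T: "\<And>p. p \<in> carrier Q \<Longrightarrow> bounded_clinear (T p)"
    and adjJ: "\<And>p h. p \<in> carrier Q \<Longrightarrow> adj (V p) (J h) = J (adj (T p) h)"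
  shows "coextension Q T K J V"
proof -
  note bJ = isometric_embedding_imp_bounded_clinear[OF J]
  have JK: "J h \<in> K" for h using J by (simp add: isometric_embedding_def)
  have "isometric_rep Q K V"
    using isometry_on_of_reducing[OF V] one mult
    by (simp add: isometric_rep_def representation_on_def isometry_on_def)
  moreover have "oproj (range J) (V p (J h)) = J (T p h)" if p: "p \<in> carrier Q" for p h
  proof (rule oproj_eqI[OF subspace_range_embedding[OF J] rangeI])
    fix z assume "z \<in> range J"
    then obtain g where z: "z = J g" by blast
    have "cinner (V p (J h)) (J g) = cinner (J h) (J (adj (T p) g))"
      using adjJ[OF p] cinner_adj_right[OF reducing_isometryD(1)[OF V[OF p]]] by metis
    then show "cinner (V p (J h) - J (T p h)) z = 0"
      by (simp add: z cinner_diff_left cinner_embedding[OF J] cinner_adj_right[OF T[OF p]])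
  qed
  moreover have "adj_on K (V p) (J h) \<in> range J" if p: "p \<in> carrier Q" for p h
    using adj_on_reducing[OF K V[OF p] JK] adjJ[OF p] by simp
  ultimately show ?thesis using K J by (simp add: coextension_def isometric_dilation_def)
qed

section \<open>Doubly commuting isometries\<close>

text \<open>The third and fourth relations are the adjoints of the second and first; all four are
  recorded because they are used pointwise on \<open>K\<close>.\<close>

definition doubly_commute_on :: "'a::chilbert_space set \<Rightarrow> ('a \<Rightarrow> 'a) \<Rightarrow> ('a \<Rightarrow> 'a) \<Rightarrow> bool" where
  "doubly_commute_on K V W \<longleftrightarrow> (\<forall>x\<in>K. V (W x) = W (V x) \<and> V (adj W x) = adj W (V x) \<and>
     adj V (W x) = W (adj V x) \<and> adj V (adj W x) = adj W (adj V x))"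

text \<open>The ranges of the powers of an isometry decrease, so the product of two range
  projections is the one with the larger exponent. This is Nica covariance over the
  naturals.\<close>

lemma range_projection_funpow:
  assumes V: "reducing_isometry K V" and x: "x \<in> K"
  shows "(V ^^ n) ((adj V ^^ n) ((V ^^ m) ((adj V ^^ m) x))) = (V ^^ max n m) ((adj V ^^ max n m) x)"
proof -
  note D = reducing_isometryD[OF V]
  have VK: "(V ^^ k) y \<in> K" and aVK: "(adj V ^^ k) y \<in> K" if "y \<in> K" for k y
    using that by (induction k) (simp_all add: D(2,3))
  have cancel: "(adj V ^^ k) ((V ^^ k) y) = y" if "y \<in> K" for k y
    using that
  proof (induction k)
    case (Suc k)
    have "(adj V ^^ Suc k) ((V ^^ Suc k) y) = (adj V ^^ k) (adj V (V ((V ^^ k) y)))"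
      by (simp add: funpow_swap1)
    then show ?case using Suc by (simp add: D(4) VK)
  qed simp
  show ?thesis
  proof (cases "n \<le> m")
    case True
    then obtain d where d: "m = n + d" using le_Suc_ex by blast
    have "(adj V ^^ n) ((V ^^ m) y) = (V ^^ d) y" if "y \<in> K" for y
      using cancel[OF VK[OF that], of n d] by (simp add: d funpow_add)
    then show ?thesis using True aVK[OF x] by (simp add: max_def) (simp add: d funpow_add)
  next
    case False
    then obtain d where d: "n = d + m" by (metis add.commute le_Suc_ex nat_le_linear)
    have "(adj V ^^ n) ((V ^^ m) y) = (adj V ^^ d) y" if "y \<in> K" for y
      using cancel[OF that, of m] by (simp add: d funpow_add)
    then show ?thesis using False aVK[OF x] by (simp add: max_def) (simp add: d funpow_add)
  qed
qed

lemma rep_times_apply: "rep_times S T (n, p) = (S ^^ n) \<circ> T p"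
  by (simp add: rep_times_def)

lemma bounded_clinear_comp': "bounded_clinear A \<Longrightarrow> bounded_clinear B \<Longrightarrow> bounded_clinear (A \<circ> B)"
  using bounded_clinear_comp[of A B] by (simp add: comp_def)

lemma adj_comp': "bounded_clinear A \<Longrightarrow> bounded_clinear B \<Longrightarrow> adj (A \<circ> B) x = adj B (adj A x)"
  using adj_comp[of A B x] by (simp add: comp_def)

lemma funpow_intertwine:
  assumes "\<And>h. A (J h) = J (B h)"
  shows "(A ^^ n) (J h) = J ((B ^^ n) h)"
  by (induction n) (simp_all add: assms)

context right_LCM_monoid
begin

context
  fixes K :: "'z::chilbert_space set" and J :: "'h::chilbert_space \<Rightarrow> 'z" and W :: "'a \<Rightarrow> 'z \<Rightarrow> 'z"
    and T :: "'a \<Rightarrow> 'h \<Rightarrow> 'h"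
  assumes K: "hilbert_subspace K" and J: "isometric_embedding J K"
    and W: "\<And>p. p \<in> carrier P \<Longrightarrow> reducing_isometry K (W p)"
    and W_one: "\<And>x. x \<in> K \<Longrightarrow> W \<one> x = x"
    and W_mult: "\<And>p q x. p \<in> carrier P \<Longrightarrow> q \<in> carrier P \<Longrightarrow> x \<in> K \<Longrightarrow> W (p \<otimes> q) x = W p (W q x)"
    and Nica: "\<And>p q r x. \<lbrakk>p \<in> carrier P; q \<in> carrier P; r \<in> carrier P; x \<in> K;
      (p <# carrier P) \<inter> (q <# carrier P) = r <# carrier P\<rbrakk> \<Longrightarrow>
      W p (adj (W p) (W q (adj (W q) x))) = W r (adj (W r) x)"
    and Nica0: "\<And>p q x. \<lbrakk>p \<in> carrier P; q \<in> carrier P; x \<in> K; (p <# carrier P) \<inter> (q <# carrier P) = {}\<rbrakk> \<Longrightarrow>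
      W p (adj (W p) (W q (adj (W q) x))) = 0"
    and T: "\<And>p. p \<in> carrier P \<Longrightarrow> bounded_clinear (T p)"
    and W_J: "\<And>p h. p \<in> carrier P \<Longrightarrow> adj (W p) (J h) = J (adj (T p) h)"
begin

text \<open>By double commutation the range projection of \<open>(V ^^ n) \<circ> W p\<close> on
  \<open>K\<close> is the product of the commuting range projections of \<open>V ^^ n\<close> and
  \<open>W p\<close>. The two factors are then treated separately, with \<open>max n m\<close> on
  one side and the relations of \<open>W\<close> on the other.\<close>

lemma rep_times_Nica_coextension:
  assumes V: "reducing_isometry K V" and VW: "\<And>p. p \<in> carrier P \<Longrightarrow> doubly_commute_on K V (W p)"
    and S: "bounded_clinear S" and V_J: "\<And>h. adj V (J h) = J (adj S h)"
  shows "isometric_Nica_coextension (nat_add \<times>\<times> P) (rep_times S T) K J (rep_times V W)"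
proof -
  note VD = reducing_isometryD[OF V] and WD = reducing_isometryD[OF W]
  note Vn = reducing_isometry_funpow[OF V]
  have VnK: "(V ^^ n) x \<in> K" and aVnK: "(adj V ^^ n) x \<in> K" if "x \<in> K" for n x
    using that by (induction n) (simp_all add: VD(2,3))
  have c1: "(V ^^ n) (W p x) = W p ((V ^^ n) x)" if "p \<in> carrier P" "x \<in> K" for n p x
    by (rule funpow_commute_on(2)[of K V]) (use VD(2) VW[OF that(1)] that(2) in \<open>auto simp: doubly_commute_on_def\<close>)
  have c2: "(V ^^ n) (adj (W p) x) = adj (W p) ((V ^^ n) x)" if "p \<in> carrier P" "x \<in> K" for n p x
    by (rule funpow_commute_on(2)[of K V]) (use VD(2) VW[OF that(1)] that(2) in \<open>auto simp: doubly_commute_on_def\<close>)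
  have c3: "(adj V ^^ n) (W p x) = W p ((adj V ^^ n) x)" if "p \<in> carrier P" "x \<in> K" for n p x
    by (rule funpow_commute_on(2)[of K "adj V"]) (use VD(3) VW[OF that(1)] that(2) in \<open>auto simp: doubly_commute_on_def\<close>)
  have c4: "(adj V ^^ n) (adj (W p) x) = adj (W p) ((adj V ^^ n) x)" if "p \<in> carrier P" "x \<in> K" for n p x
    by (rule funpow_commute_on(2)[of K "adj V"]) (use VD(3) VW[OF that(1)] that(2) in \<open>auto simp: doubly_commute_on_def\<close>)
  have red: "reducing_isometry K (rep_times V W (n, p))" if "p \<in> carrier P" for n p
    unfolding rep_times_apply by (rule reducing_isometry_comp[OF Vn W[OF that]])
  have adjVW: "adj (rep_times V W (n, p)) x = adj (W p) ((adj V ^^ n) x)" if "p \<in> carrier P" for n p x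
    unfolding rep_times_apply
    by (simp add: adj_comp'[OF bounded_clinear_funpow[OF VD(1)] WD(1)[OF that]] adj_funpow[OF VD(1)])
  have coext: "coextension (nat_add \<times>\<times> P) (rep_times S T) K J (rep_times V W)"
  proof (rule coextension_of_reducing[OF K J])
    fix a assume "a \<in> carrier (nat_add \<times>\<times> P)"
    then obtain n p where a: "a = (n, p)" and p: "p \<in> carrier P" by (cases a) auto
    show "reducing_isometry K (rep_times V W a)" unfolding a by (rule red[OF p])
    show "bounded_clinear (rep_times S T a)"
      unfolding a rep_times_apply by (rule bounded_clinear_comp'[OF bounded_clinear_funpow[OF S] T[OF p]])
    show "adj (rep_times V W a) (J h) = J (adj (rep_times S T a) h)" for h
      unfolding a adjVW[OF p] unfolding rep_times_apply
      by (simp add: adj_comp'[OF bounded_clinear_funpow[OF S] T[OF p]] adj_funpow[OF S]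
          funpow_intertwine[of "adj V" J "adj S", OF V_J] W_J[OF p])
    fix b x assume "b \<in> carrier (nat_add \<times>\<times> P)" and x: "x \<in> K"
    then obtain m q where b: "b = (m, q)" and q: "q \<in> carrier P" by (cases b) auto
    show "rep_times V W (a \<otimes>\<^bsub>nat_add \<times>\<times> P\<^esub> b) x = rep_times V W a (rep_times V W b x)"
      using c1[OF p WD(2)[OF q x], of m]
      by (simp add: a b rep_times_apply funpow_add W_mult[OF p q x])
  next
    show "rep_times V W \<one>\<^bsub>nat_add \<times>\<times> P\<^esub> x = x" if "x \<in> K" for x
      using that unfolding nat_times_one by (simp add: rep_times_apply W_one)
  qed
  have range: "rep_times V W (n, p) (adj_on K (rep_times V W (n, p)) x)
      = W p (adj (W p) ((V ^^ n) ((adj V ^^ n) x)))" if p: "p \<in> carrier P" and x: "x \<in> K" for n p x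
    unfolding adj_on_reducing[OF K red[OF p] x] adjVW[OF p]
    by (simp add: rep_times_apply c1[OF p WD(3)[OF p aVnK[OF x]]] c2[OF p aVnK[OF x]])
  have range2: "rep_times V W (n, p) (adj_on K (rep_times V W (n, p))
        (rep_times V W (m, q) (adj_on K (rep_times V W (m, q)) x)))
      = W p (adj (W p) (W q (adj (W q) ((V ^^ max n m) ((adj V ^^ max n m) x)))))"
    if p: "p \<in> carrier P" and q: "q \<in> carrier P" and x: "x \<in> K" for n p m q x
  proof -
    define y where "y = (V ^^ m) ((adj V ^^ m) x)"
    have y: "y \<in> K" unfolding y_def by (intro VnK aVnK x)
    have ay: "adj (W q) y \<in> K" "W q (adj (W q) y) \<in> K" using WD(2,3)[OF q] y by auto
    have "(V ^^ n) ((adj V ^^ n) (W q (adj (W q) y))) = W q (adj (W q) ((V ^^ n) ((adj V ^^ n) y)))"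
      by (simp add: c3[OF q ay(1)] c4[OF q y] c1[OF q WD(3)[OF q aVnK[OF y]]] c2[OF q aVnK[OF y]])
    also have "(V ^^ n) ((adj V ^^ n) y) = (V ^^ max n m) ((adj V ^^ max n m) x)"
      unfolding y_def by (rule range_projection_funpow[OF V x])
    finally show ?thesis
      unfolding range[OF q x] y_def[symmetric] range[OF p ay(2)] by simp
  qed
  have "Nica_covariant (nat_add \<times>\<times> P) K (rep_times V W)"
    unfolding Nica_covariant_def
  proof (intro conjI ballI impI)
    fix a b c x
    assume "a \<in> carrier (nat_add \<times>\<times> P)" "b \<in> carrier (nat_add \<times>\<times> P)" "c \<in> carrier (nat_add \<times>\<times> P)"
      and e: "(a <#\<^bsub>nat_add \<times>\<times> P\<^esub> carrier (nat_add \<times>\<times> P)) \<inter> (b <#\<^bsub>nat_add \<times>\<times> P\<^esub> carrier (nat_add \<times>\<times> P))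
        = c <#\<^bsub>nat_add \<times>\<times> P\<^esub> carrier (nat_add \<times>\<times> P)" and x: "x \<in> K"
    then obtain n p m q l r where abc: "a = (n, p)" "b = (m, q)" "c = (l, r)"
      and p: "p \<in> carrier P" and q: "q \<in> carrier P" and r: "r \<in> carrier P" by (cases a, cases b, cases c) auto
    have "{max n m..} \<times> ((p <# carrier P) \<inter> (q <# carrier P)) = {l..} \<times> (r <# carrier P)"
      using e unfolding abc nat_times_ideal_Int unfolding nat_times_ideal .
    \<comment> \<open>With a nonempty second factor, equality of the two rectangles determines both
      factors.\<close>
    moreover have "r <# carrier P \<noteq> {}" using mem_ideal_self[OF r] by blast
    ultimately have l: "l = max n m" and pqr: "(p <# carrier P) \<inter> (q <# carrier P) = r <# carrier P"
      by (auto simp: times_eq_iff)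
    show "rep_times V W a (adj_on K (rep_times V W a) (rep_times V W b (adj_on K (rep_times V W b) x)))
        = rep_times V W c (adj_on K (rep_times V W c) x)"
      unfolding abc range2[OF p q x] range[OF r x] l
      by (rule Nica[OF p q r VnK[OF aVnK[OF x]] pqr])
  next
    fix a b x
    assume "a \<in> carrier (nat_add \<times>\<times> P)" "b \<in> carrier (nat_add \<times>\<times> P)"
      and e: "(a <#\<^bsub>nat_add \<times>\<times> P\<^esub> carrier (nat_add \<times>\<times> P)) \<inter> (b <#\<^bsub>nat_add \<times>\<times> P\<^esub> carrier (nat_add \<times>\<times> P))
        = {}" and x: "x \<in> K"
    then obtain n p m q where ab: "a = (n, p)" "b = (m, q)"
      and p: "p \<in> carrier P" and q: "q \<in> carrier P" by (cases a, cases b) auto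
    have pq: "(p <# carrier P) \<inter> (q <# carrier P) = {}"
      using e unfolding ab nat_times_ideal_Int by (auto simp: times_eq_iff)
    show "rep_times V W a (adj_on K (rep_times V W a) (rep_times V W b (adj_on K (rep_times V W b) x))) = 0"
      unfolding ab range2[OF p q x] by (rule Nica0[OF p q VnK[OF aVnK[OF x]] pq])
  qed
  with coext show ?thesis by (simp add: isometric_Nica_coextension_def)
qed

text \<open>The adjoints of \<open>V1\<close>, \<open>V2\<close> and \<open>W p\<close> are all
  intertwined by \<open>J\<close>, so the product is a co-extension, of which the dilation property
  is a part.\<close>

lemma rep_times2_dilation:
  assumes V1: "reducing_isometry K V1" and V1W: "\<And>p. p \<in> carrier P \<Longrightarrow> doubly_commute_on K V1 (W p)"
    and V2: "reducing_isometry K V2" and V2W: "\<And>p. p \<in> carrier P \<Longrightarrow> doubly_commute_on K V2 (W p)"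
    and V12: "\<And>x. x \<in> K \<Longrightarrow> V1 (V2 x) = V2 (V1 x)"
    and S1: "bounded_clinear S1" and V1_J: "\<And>h. adj V1 (J h) = J (adj S1 h)"
    and S2: "bounded_clinear S2" and V2_J: "\<And>h. adj V2 (J h) = J (adj S2 h)"
  shows "isometric_dilation ((nat_add \<times>\<times> nat_add) \<times>\<times> P) (rep_times2 S1 S2 T) K J (rep_times2 V1 V2 W)"
proof -
  note V1D = reducing_isometryD[OF V1] and V2D = reducing_isometryD[OF V2] and WD = reducing_isometryD[OF W]
  have V2K: "(V2 ^^ n) x \<in> K" if "x \<in> K" for n x
    using that by (induction n) (simp_all add: V2D)
  have c1: "(V1 ^^ n) (W p x) = W p ((V1 ^^ n) x)" if "p \<in> carrier P" "x \<in> K" for n p x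
    by (rule funpow_commute_on(2)[of K V1]) (use V1D(2) V1W[OF that(1)] that(2) in \<open>auto simp: doubly_commute_on_def\<close>)
  have c2: "(V2 ^^ n) (W p x) = W p ((V2 ^^ n) x)" if "p \<in> carrier P" "x \<in> K" for n p x
    by (rule funpow_commute_on(2)[of K V2]) (use V2D(2) V2W[OF that(1)] that(2) in \<open>auto simp: doubly_commute_on_def\<close>)
  have V1n: "V2 ((V1 ^^ n) x) = (V1 ^^ n) (V2 x)" if "x \<in> K" for n x
    by (rule funpow_commute_on(2)[of K V1, symmetric]) (use V1D(2) V12 that in auto)
  have V1K: "(V1 ^^ n) x \<in> K" if "x \<in> K" for n x
    using that by (induction n) (simp_all add: V1D)
  have V21: "(V2 ^^ m) ((V1 ^^ n) x) = (V1 ^^ n) ((V2 ^^ m) x)" if "x \<in> K" for n m x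
    by (rule funpow_commute_on(2)[of K V2]) (use V2D(2) V1n that in auto)
  have app': "rep_times2 S1 S2 T ((n, m), p) = (S1 ^^ n) \<circ> ((S2 ^^ m) \<circ> T p)" for n m p
    by (simp add: rep_times2_def comp_assoc)
  have app'': "rep_times2 V1 V2 W ((n, m), p) = (V1 ^^ n) \<circ> ((V2 ^^ m) \<circ> W p)" for n m p
    by (simp add: rep_times2_def comp_assoc)
  have "coextension ((nat_add \<times>\<times> nat_add) \<times>\<times> P) (rep_times2 S1 S2 T) K J (rep_times2 V1 V2 W)"
  proof (rule coextension_of_reducing[OF K J])
    fix a assume "a \<in> carrier ((nat_add \<times>\<times> nat_add) \<times>\<times> P)"
    then obtain n m p where a: "a = ((n, m), p)" and p: "p \<in> carrier P"
      by (cases a) (auto simp: DirProd_def)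
    show "reducing_isometry K (rep_times2 V1 V2 W a)"
      unfolding a app'' by (intro reducing_isometry_comp reducing_isometry_funpow V1 V2 W p)
    have b: "bounded_clinear (S1 ^^ n)" "bounded_clinear ((S2 ^^ m) \<circ> T p)" "bounded_clinear (S2 ^^ m)"
      by (rule bounded_clinear_funpow[OF S1], rule bounded_clinear_comp'[OF bounded_clinear_funpow[OF S2] T[OF p]],
          rule bounded_clinear_funpow[OF S2])
    have b': "bounded_clinear (V1 ^^ n)" "bounded_clinear ((V2 ^^ m) \<circ> W p)" "bounded_clinear (V2 ^^ m)"
      by (rule bounded_clinear_funpow[OF V1D(1)],
          rule bounded_clinear_comp'[OF bounded_clinear_funpow[OF V2D(1)] WD(1)[OF p]],
          rule bounded_clinear_funpow[OF V2D(1)])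
    show "bounded_clinear (rep_times2 S1 S2 T a)"
      unfolding a app' by (rule bounded_clinear_comp'[OF b(1,2)])
    show "adj (rep_times2 V1 V2 W a) (J h) = J (adj (rep_times2 S1 S2 T a) h)" for h
      unfolding a app' app''
      by (simp add: adj_comp'[OF b(1,2)] adj_comp'[OF b(3) T[OF p]] adj_comp'[OF b'(1,2)]
          adj_comp'[OF b'(3) WD(1)[OF p]] adj_funpow[OF S1] adj_funpow[OF S2] adj_funpow[OF V1D(1)]
          adj_funpow[OF V2D(1)] funpow_intertwine[of "adj V1" J "adj S1", OF V1_J]
          funpow_intertwine[of "adj V2" J "adj S2", OF V2_J] W_J[OF p])
    fix b x assume "b \<in> carrier ((nat_add \<times>\<times> nat_add) \<times>\<times> P)" and x: "x \<in> K"
    then obtain n' m' q where b: "b = ((n', m'), q)" and q: "q \<in> carrier P"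
      by (cases b) (auto simp: DirProd_def)
    have ab: "a \<otimes>\<^bsub>(nat_add \<times>\<times> nat_add) \<times>\<times> P\<^esub> b = ((n + n', m + m'), p \<otimes> q)"
      by (simp add: a b DirProd_def nat_add_def)
    have Wx: "W q x \<in> K" by (rule WD(2)[OF q x])
    have "(V1 ^^ n) ((V2 ^^ m) (W p ((V1 ^^ n') ((V2 ^^ m') (W q x)))))
        = (V1 ^^ n) ((V1 ^^ n') ((V2 ^^ m) ((V2 ^^ m') (W p (W q x)))))"
      by (simp add: c1[OF p V2K[OF Wx], symmetric] c2[OF p Wx, symmetric] V21 V2K WD(2)[OF p Wx])
    then show "rep_times2 V1 V2 W (a \<otimes>\<^bsub>(nat_add \<times>\<times> nat_add) \<times>\<times> P\<^esub> b) x
        = rep_times2 V1 V2 W a (rep_times2 V1 V2 W b x)"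
      unfolding ab unfolding a b app'' by (simp add: funpow_add W_mult[OF p q x])
  next
    show "rep_times2 V1 V2 W \<one>\<^bsub>(nat_add \<times>\<times> nat_add) \<times>\<times> P\<^esub> x = x" if "x \<in> K" for x
      using that by (simp add: DirProd_def nat_add_def rep_times2_def W_one)
  qed
  then show ?thesis by (simp add: coextension_def)
qed

end

end

section \<open>Transport along an isometry\<close>

text \<open>Conjugation by an isometry: a linear \<open>A\<close> is carried to the range of
  \<open>\<Theta>\<close> and becomes zero on its orthogonal complement.\<close>

definition transport :: "('y::chilbert_space \<Rightarrow> 'z::chilbert_space) \<Rightarrow> ('y \<Rightarrow> 'y) \<Rightarrow> 'z \<Rightarrow> 'z" where
  "transport \<Theta> A z = \<Theta> (A (adj \<Theta> z))"

context
  fixes \<Theta> :: "'y::chilbert_space \<Rightarrow> 'z::chilbert_space"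
  assumes \<Theta>: "isometric_embedding \<Theta> UNIV"
begin

lemma adj_embedding_cancel: "adj \<Theta> (\<Theta> y) = y"
  using \<Theta> by (intro isometry_adj isometric_embedding_imp_bounded_clinear[OF \<Theta>]) (simp add: isometric_embedding_def)

lemma transport_apply: "transport \<Theta> A (\<Theta> y) = \<Theta> (A y)"
  by (simp add: transport_def adj_embedding_cancel)

lemma bounded_clinear_transport: "bounded_clinear A \<Longrightarrow> bounded_clinear (transport \<Theta> A)"
  unfolding transport_def[abs_def]
  using bounded_clinear_comp[OF isometric_embedding_imp_bounded_clinear[OF \<Theta>]
      bounded_clinear_comp[of A, OF _ bounded_clinear_adj[OF isometric_embedding_imp_bounded_clinear[OF \<Theta>]]]] .

lemma adj_transport:
  assumes A: "bounded_clinear A"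
  shows "adj (transport \<Theta> A) = transport \<Theta> (adj A)"
proof (rule ext, rule adj_eqI[OF bounded_clinear_transport[OF A]])
  note b\<Theta> = isometric_embedding_imp_bounded_clinear[OF \<Theta>]
  show "cinner z (transport \<Theta> (adj A) y) = cinner (transport \<Theta> A z) y" for z y
    using cinner_adj_left[OF b\<Theta>] cinner_adj_right[OF b\<Theta>] cinner_adj_right[OF A]
    unfolding transport_def by metis
qed

lemma reducing_isometry_transport:
  "reducing_isometry K V \<Longrightarrow> reducing_isometry (\<Theta> ` K) (transport \<Theta> V)"
  by (auto simp: reducing_isometry_def bounded_clinear_transport adj_transport transport_apply)

lemma doubly_commute_on_transport:
  assumes "doubly_commute_on K V W" "bounded_clinear V" "bounded_clinear W"
  shows "doubly_commute_on (\<Theta> ` K) (transport \<Theta> V) (transport \<Theta> W)"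
  using assms by (auto simp: doubly_commute_on_def adj_transport transport_apply)

text \<open>The image is the fixed space of the transported operator, hence an equalizer and
  closed.\<close>

lemma hilbert_subspace_transport:
  assumes E: "bounded_clinear E"
  shows "hilbert_subspace (\<Theta> ` {y. E y = y})"
proof -
  have "\<Theta> ` {y. E y = y} = {z. transport \<Theta> E z = z}"
  proof (intro equalityI subsetI)
    fix z assume "z \<in> {z. transport \<Theta> E z = z}"
    then have z: "\<Theta> (E (adj \<Theta> z)) = z" by (simp add: transport_def)
    then have "E (adj \<Theta> z) = adj \<Theta> z" using adj_embedding_cancel by metis
    with z show "z \<in> \<Theta> ` {y. E y = y}" by (metis (mono_tags) imageI mem_Collect_eq)
  qed (auto simp: transport_apply)
  then show ?thesis
    using hilbert_subspace_eq_kernel[OF bounded_clinear_transport[OF E] bounded_clinear_ident] by simp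
qed

end

section \<open>Assembly of the dilation inside \<open>'h ell2\<close>\<close>

lemma reducing_isometry_of_commute:
  assumes V: "isometric_embedding V UNIV" and E: "bounded_clinear E" "\<And>x. adj E x = E x"
    and VE: "\<And>x. V (E x) = E (V x)"
  shows "reducing_isometry {x. E x = x} V"
proof -
  note bV = isometric_embedding_imp_bounded_clinear[OF V]
  have aVE: "adj V (E x) = E (adj V x)" for x
    using adj_commute[OF bV E(1) VE] by (simp add: E(2))
  show ?thesis using bV VE[symmetric] aVE[symmetric] adj_embedding_cancel[OF V]
    unfolding reducing_isometry_def by auto
qed

lemma doubly_commute_onI:
  assumes V: "bounded_clinear V" and W: "bounded_clinear W"
    and "\<And>x. V (W x) = W (V x)" "\<And>x. V (adj W x) = adj W (V x)"
  shows "doubly_commute_on K V W"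
  unfolding doubly_commute_on_def
  using assms(3,4) adj_commute[OF V W assms(3)]
    adj_commute[OF V bounded_clinear_adj[OF W] assms(4), unfolded adj_adj[OF W]] by blast

lemma amplify_zero: "amplify (\<lambda>x. 0) z = 0"
  by (cases z) (simp add: amplify_def zero_prod_def amplify4_def ell2_map_def zero_ell2_def split_beta map_prod_def)

text \<open>Closure of the embeddable spaces under direct sums and sequence spaces brings Ando's
  space back into the type that must contain the dilation.\<close>

lemma ando_space_embeds:
  "\<exists>\<Theta> :: 'h::chilbert_space ell2 \<times> (('h ell2 \<times> 'h ell2) \<times> ('h ell2 \<times> 'h ell2)) ell2 \<Rightarrow> 'h ell2.
     isometric_embedding \<Theta> UNIV"
proof -
  have 1: "isometric_embedding (\<lambda>x :: 'h ell2. x) UNIV" by (simp add: isometric_embedding_def)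
  obtain f where 2: "isometric_embedding (f :: 'h ell2 \<times> 'h ell2 \<Rightarrow> 'h ell2) UNIV"
    using prod_embeds[OF 1 1] by blast
  obtain g where "isometric_embedding (g :: ('h ell2 \<times> 'h ell2) \<times> ('h ell2 \<times> 'h ell2) \<Rightarrow> 'h ell2) UNIV"
    using prod_embeds[OF 2 2] by blast
  then obtain k where "isometric_embedding (k :: (('h ell2 \<times> 'h ell2) \<times> ('h ell2 \<times> 'h ell2)) ell2 \<Rightarrow> 'h ell2) UNIV"
    using ell2_embeds by blast
  from prod_embeds[OF 1 this] show ?thesis .
qed

theorem theorem3p1:
  fixes P :: "('p, 'm) monoid_scheme"
    and T :: "'p \<Rightarrow> 'h::chilbert_space \<Rightarrow> 'h"
    and S\<^sub>1 S\<^sub>2 :: "'h \<Rightarrow> 'h"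
  assumes "right_LCM_monoid P"
    and "countable (carrier P)"
    and "contractive_rep P UNIV T"
    and "contraction_on UNIV S\<^sub>1" and "contraction_on UNIV S\<^sub>2"
    and "commute_on UNIV S\<^sub>1 S\<^sub>2"
    and "\<And>p. p \<in> carrier P \<Longrightarrow> commute_on UNIV S\<^sub>1 (T p)"
    and "\<And>p. p \<in> carrier P \<Longrightarrow> commute_on UNIV S\<^sub>2 (T p)"
    and "\<exists>(K :: 'k1::chilbert_space set) J V.
           star_regular_dilation (nat_add \<times>\<times> P) (rep_times S\<^sub>1 T) K J V"
    and "\<exists>(K :: 'k2::chilbert_space set) J V.
           star_regular_dilation (nat_add \<times>\<times> P) (rep_times S\<^sub>2 T) K J V"
  shows "\<exists>(K :: 'h ell2 set) J V\<^sub>1 V\<^sub>2 W.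
           hilbert_subspace K \<and> isometric_embedding J K \<and>
           isometry_on K V\<^sub>1 \<and> isometry_on K V\<^sub>2 \<and> commute_on K V\<^sub>1 V\<^sub>2 \<and>
           isometric_rep P K W \<and>
           (\<forall>p\<in>carrier P. commute_on K V\<^sub>1 (W p) \<and> commute_on K V\<^sub>2 (W p)) \<and>
           isometric_dilation ((nat_add \<times>\<times> nat_add) \<times>\<times> P)
             (rep_times2 S\<^sub>1 S\<^sub>2 T) K J (rep_times2 V\<^sub>1 V\<^sub>2 W) \<and>
           isometric_Nica_coextension (nat_add \<times>\<times> P) (rep_times S\<^sub>1 T) K J (rep_times V\<^sub>1 W) \<and>
           isometric_Nica_coextension (nat_add \<times>\<times> P) (rep_times S\<^sub>2 T) K J (rep_times V\<^sub>2 W)"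
proof -
  interpret right_LCM_monoid P by (rule assms(1))
  have T: "bounded_clinear (T p)" if "p \<in> carrier P" for p
    using assms(3) that
    by (auto simp: contractive_rep_def representation_on_def bounded_clinear_on_UNIV)
  have T_one: "T \<one>\<^bsub>P\<^esub> x = x" for x
    using assms(3) by (simp add: contractive_rep_def representation_on_def)
  have T_mult: "T (p \<otimes>\<^bsub>P\<^esub> q) x = T p (T q x)" if "p \<in> carrier P" "q \<in> carrier P" for p q x
    using assms(3) that by (simp add: contractive_rep_def representation_on_def)
  have S: "bounded_clinear S\<^sub>1" "bounded_clinear S\<^sub>2"
    using assms(4,5) by (simp_all add: contraction_on_def bounded_clinear_on_UNIV)
  have S': "bounded_clinear S" if "S = S\<^sub>1 \<or> S = S\<^sub>2" for S using that S by blast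
  have ST: "S (T p x) = T p (S x)" if "S = S\<^sub>1 \<or> S = S\<^sub>2" "p \<in> carrier P" for S p x
    using that assms(7,8) by (auto simp: commute_on_def)
  have S12: "S\<^sub>1 (S\<^sub>2 x) = S\<^sub>2 (S\<^sub>1 x)" for x using assms(6) by (simp add: commute_on_def)
  obtain K1 :: "'k1 set" and J1 U1 where reg1: "star_regular_dilation (nat_add \<times>\<times> P) (rep_times S\<^sub>1 T) K1 J1 U1"
    using assms(9) by blast
  obtain K2 :: "'k2 set" and J2 U2 where reg2: "star_regular_dilation (nat_add \<times>\<times> P) (rep_times S\<^sub>2 T) K2 J2 U2"
    using assms(10) by blast
  obtain L :: "'p \<Rightarrow> 'h \<Rightarrow> 'h ell2" where ker: "lcm_kernel P T L"
    and contr: "\<And>S F c. \<lbrakk>S = S\<^sub>1 \<or> S = S\<^sub>2; finite F; F \<subseteq> carrier P \<times> UNIV\<rbrakk> \<Longrightarrow>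
      norm (\<Sum>i\<in>F. c i *\<^sub>C L (fst i) (adj S (snd i))) \<le> norm (\<Sum>i\<in>F. c i *\<^sub>C L (fst i) (snd i))"
    by (rule lcm_kernel_in_ell2[OF reg1 reg2 S _ assms(2)]) (use T in auto)

  show ?thesis
  proof (rule minimal_Nica_coextension[of T L S\<^sub>1 S\<^sub>2, OF ker T T_one T_mult S' ST S12 contr])
    fix E R1 R2 :: "'h ell2 \<Rightarrow> 'h ell2" and W :: "'p \<Rightarrow> 'h ell2 \<Rightarrow> 'h ell2"
    assume E: "bounded_clinear E" "\<And>x. E (E x) = E x" "\<And>x. adj E x = E x"
      and W: "\<And>p. p \<in> carrier P \<Longrightarrow> bounded_clinear (W p)"
      and EW: "\<And>p x. p \<in> carrier P \<Longrightarrow> E (W p x) = W p x" and WE: "\<And>p x. p \<in> carrier P \<Longrightarrow> W p (E x) = W p x"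
      and W_iso: "\<And>p x. p \<in> carrier P \<Longrightarrow> adj (W p) (W p x) = E x"
      and W_one: "\<And>x. W \<one>\<^bsub>P\<^esub> x = E x"
      and W_mult: "\<And>p q x. p \<in> carrier P \<Longrightarrow> q \<in> carrier P \<Longrightarrow> W (p \<otimes>\<^bsub>P\<^esub> q) x = W p (W q x)"
      and Nica: "\<And>p q r x. \<lbrakk>p \<in> carrier P; q \<in> carrier P; r \<in> carrier P;
        (p <#\<^bsub>P\<^esub> carrier P) \<inter> (q <#\<^bsub>P\<^esub> carrier P) = r <#\<^bsub>P\<^esub> carrier P\<rbrakk> \<Longrightarrow>
        W p (adj (W p) (W q (adj (W q) x))) = W r (adj (W r) x)"
      and Nica0: "\<And>p q x. \<lbrakk>p \<in> carrier P; q \<in> carrier P; (p <#\<^bsub>P\<^esub> carrier P) \<inter> (q <#\<^bsub>P\<^esub> carrier P) = {}\<rbrakk> \<Longrightarrow>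
        W p (adj (W p) (W q (adj (W q) x))) = 0"
      and E_L: "\<And>h. E (L \<one>\<^bsub>P\<^esub> h) = L \<one>\<^bsub>P\<^esub> h"
      and W_L: "\<And>p h. p \<in> carrier P \<Longrightarrow> adj (W p) (L \<one>\<^bsub>P\<^esub> h) = L \<one>\<^bsub>P\<^esub> (adj (T p) h)"
      and R: "\<And>R. R = R1 \<or> R = R2 \<Longrightarrow> bounded_clinear R" "\<And>R x. R = R1 \<or> R = R2 \<Longrightarrow> norm (R x) \<le> norm x"
      and RE: "\<And>R x. R = R1 \<or> R = R2 \<Longrightarrow> R (E x) = E (R x)"
      and RW: "\<And>R p x. R = R1 \<or> R = R2 \<Longrightarrow> p \<in> carrier P \<Longrightarrow> R (W p x) = W p (R x)"
      and RaW: "\<And>R p x. R = R1 \<or> R = R2 \<Longrightarrow> p \<in> carrier P \<Longrightarrow> R (adj (W p) x) = adj (W p) (R x)"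
      and R12: "\<And>x. R1 (R2 x) = R2 (R1 x)"
      and R_L: "\<And>h. R1 (L \<one>\<^bsub>P\<^esub> h) = L \<one>\<^bsub>P\<^esub> (adj S\<^sub>1 h)" "\<And>h. R2 (L \<one>\<^bsub>P\<^esub> h) = L \<one>\<^bsub>P\<^esub> (adj S\<^sub>2 h)"
    have R1: "bounded_clinear R1" "norm (R1 x) \<le> norm x" and R2: "bounded_clinear R2" "norm (R2 x) \<le> norm x" for x
      using R by blast+

    \<comment> \<open>Ando's construction is applied to the adjoints: since the first coordinate of
      \<open>U1 z\<close> is \<open>adj R1 (fst z)\<close>, the operator \<open>adj U1\<close> acts
      as \<open>R1\<close> on vectors with only a first coordinate. Likewise for
      \<open>U2\<close>.\<close>
    obtain U1 U2 where U: "isometric_embedding U1 UNIV" "isometric_embedding U2 UNIV"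
      and U12: "\<And>z. U1 (U2 z) = U2 (U1 z)"
      and fst_U: "\<And>z. fst (U1 z) = adj R1 (fst z)" "\<And>z. fst (U2 z) = adj R2 (fst z)"
      and U_comm: "\<And>C z. \<lbrakk>bounded_clinear C; \<And>x. C (adj R1 x) = adj R1 (C x); \<And>x. C (adj R2 x) = adj R2 (C x);
         \<And>x. C (adj (adj R1) x) = adj (adj R1) (C x); \<And>x. C (adj (adj R2) x) = adj (adj R2) (C x)\<rbrakk> \<Longrightarrow>
         U1 (amplify C z) = amplify C (U1 z) \<and> U2 (amplify C z) = amplify C (U2 z)"
      by (rule ando_dilation[OF bounded_clinear_adj[OF R1(1)] contraction_adj[OF R1]
            bounded_clinear_adj[OF R2(1)] contraction_adj[OF R2] adj_commute[OF R1(1) R2(1) R12]]) blast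
    note bU = U[THEN isometric_embedding_imp_bounded_clinear]
    \<comment> \<open>The conditions from Ando's construction concern \<open>adj R\<close> and
      \<open>adj (adj R)\<close>; they are rephrased as commutation of \<open>R\<close> with
      \<open>C\<close> and with \<open>adj C\<close>.\<close>
    have comm: "U1 (amplify C z) = amplify C (U1 z) \<and> U2 (amplify C z) = amplify C (U2 z)"
      if C: "bounded_clinear C" and RC: "\<And>R x. R = R1 \<or> R = R2 \<Longrightarrow> R (C x) = C (R x)"
        and RaC: "\<And>R x. R = R1 \<or> R = R2 \<Longrightarrow> R (adj C x) = adj C (R x)" for C z
    proof (rule U_comm[OF C])
      have *: "C (adj R x) = adj R (C x)" if "R = R1 \<or> R = R2" for R x
        using adj_commute[OF R(1)[OF that] bounded_clinear_adj[OF C] RaC[OF that]] by (simp add: adj_adj[OF C])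
      show "C (adj R1 x) = adj R1 (C x)" "C (adj R2 x) = adj R2 (C x)" for x by (simp_all add: *)
      show "C (adj (adj R1) x) = adj (adj R1) (C x)" "C (adj (adj R2) x) = adj (adj R2) (C x)" for x
        by (simp_all add: RC adj_adj[OF R1(1)] adj_adj[OF R2(1)])
    qed
    have adjE: "adj E = E" by (rule ext) (rule E(3))
    have UE: "U1 (amplify E z) = amplify E (U1 z)" "U2 (amplify E z) = amplify E (U2 z)" for z
      using comm[OF E(1), of z] RE by (simp_all add: adjE)
    have UW: "U1 (amplify (W p) z) = amplify (W p) (U1 z)" "U2 (amplify (W p) z) = amplify (W p) (U2 z)"
      if p: "p \<in> carrier P" for p z
      using comm[OF W[OF p], of z] RW[OF _ p] RaW[OF _ p] by simp_all
    have UaW: "U1 (amplify (adj (W p)) z) = amplify (adj (W p)) (U1 z)"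
      "U2 (amplify (adj (W p)) z) = amplify (adj (W p)) (U2 z)" if p: "p \<in> carrier P" for p z
      using comm[OF bounded_clinear_adj[OF W[OF p]], of z] RW[OF _ p] RaW[OF _ p] by (simp_all add: adj_adj[OF W[OF p]])

    \<comment> \<open>The fixed space of this projection is the dilation space before transport; the
      operators \<open>amplify (W p)\<close> are isometric there.\<close>
    define A where "A = amplify E"
    have A: "bounded_clinear A" "adj A x = A x" for x
      by (simp_all add: A_def bounded_clinear_amplify E(1) adj_amplify adjE)
    define M where "M p = amplify (W p)" for p
    have M: "bounded_clinear (M p)" and adjM: "adj (M p) = amplify (adj (W p))" if "p \<in> carrier P" for p
      using that by (simp_all add: M_def bounded_clinear_amplify W adj_amplify)
    have aE: "E (adj (W p) x) = adj (W p) x" if p: "p \<in> carrier P" for p x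
      using WE[OF p] by (intro cinner_eqI) (metis cinner_adj_right[OF W[OF p]] cinner_adj_right[OF E(1)] E(3))
    have redM: "reducing_isometry {x. A x = x} (M p)" if p: "p \<in> carrier P" for p
      unfolding reducing_isometry_def
    proof (intro conjI ballI)
      note w = W[OF p] bounded_clinear_adj[OF W[OF p]]
      fix x assume "x \<in> {x. A x = x}"
      then have x: "amplify E x = x" by (simp add: A_def)
      show "M p x \<in> {x. A x = x}" "adj (M p) x \<in> {x. A x = x}"
        unfolding mem_Collect_eq adjM[OF p] unfolding A_def M_def amplify_comp[OF E(1) w(1)] amplify_comp[OF E(1) w(2)]
          EW[OF p] aE[OF p] by (rule refl)+
      show "adj (M p) (M p x) = x"
        unfolding adjM[OF p] unfolding M_def amplify_comp[OF w(2,1)] W_iso[OF p] by (rule x)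
    qed (rule M[OF p])
    have redU: "reducing_isometry {x. A x = x} U1" "reducing_isometry {x. A x = x} U2"
      using A UE by (auto simp: A_def intro!: reducing_isometry_of_commute U)
    have dcU: "doubly_commute_on {x. A x = x} U1 (M p)" "doubly_commute_on {x. A x = x} U2 (M p)" if p: "p \<in> carrier P" for p
      by (rule doubly_commute_onI[OF bU(1) M[OF p]], simp add: M_def UW[OF p], simp add: adjM[OF p] UaW[OF p])
        (rule doubly_commute_onI[OF bU(2) M[OF p]], simp add: M_def UW[OF p], simp add: adjM[OF p] UaW[OF p])
    \<comment> \<open>H sits in the first coordinate through \<open>L \<one>\<close>, where the
      adjoint of \<open>W p\<close> acts as that of \<open>T p\<close>, and \<open>R1\<close>,
      \<open>R2\<close> act as the adjoints of \<open>S\<^sub>1\<close>,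
      \<open>S\<^sub>2\<close>.\<close>
    define J where "J h = (L \<one>\<^bsub>P\<^esub> h, 0 :: (('h ell2 \<times> 'h ell2) \<times> 'h ell2 \<times> 'h ell2) ell2)" for h
    note L1 = lcm_kernelD(1)[OF ker one_closed]
    have J: "isometric_embedding J {x. A x = x}"
      using bounded_clinear_add[OF L1] bounded_clinear_scaleC[OF L1] E_L
        norm_L_one[OF ker T T_one T_mult]
        bounded_clinear_0[OF bounded_clinear_ell2_map[OF bounded_clinear_amplify4[OF E(1)]]]
      by (simp add: isometric_embedding_def J_def A_def amplify_def norm_Pair)
    have MJ: "adj (M p) (J h) = J (adj (T p) h)" if p: "p \<in> carrier P" for p h
      using bounded_clinear_0[OF bounded_clinear_ell2_map[OF bounded_clinear_amplify4[OF bounded_clinear_adj[OF W[OF p]]]]]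
      by (simp add: adjM[OF p] J_def amplify_def W_L[OF p])
    have UJ: "adj U1 (J h) = J (adj S\<^sub>1 h)" "adj U2 (J h) = J (adj S\<^sub>2 h)" for h
    proof -
      have "cinner z (J (adj S\<^sub>1 h)) = cinner (U1 z) (J h)" for z
        by (simp add: cinner_prod_def J_def fst_U cinner_adj_left[OF R1(1)] R_L)
      then show "adj U1 (J h) = J (adj S\<^sub>1 h)" by (rule adj_eqI[OF bU(1)])
      have "cinner z (J (adj S\<^sub>2 h)) = cinner (U2 z) (J h)" for z
        by (simp add: cinner_prod_def J_def fst_U cinner_adj_left[OF R2(1)] R_L)
      then show "adj U2 (J h) = J (adj S\<^sub>2 h)" by (rule adj_eqI[OF bU(2)])
    qed

    obtain \<Theta> :: "'h ell2 \<times> (('h ell2 \<times> 'h ell2) \<times> 'h ell2 \<times> 'h ell2) ell2 \<Rightarrow> 'h ell2"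
      where \<Theta>: "isometric_embedding \<Theta> UNIV" using ando_space_embeds by blast
    define K where "K = \<Theta> ` {x. A x = x}"
    define V1 where "V1 = transport \<Theta> U1"
    define V2 where "V2 = transport \<Theta> U2"
    define N where "N p = transport \<Theta> (M p)" for p
    define I where "I h = \<Theta> (J h)" for h
    note app = transport_apply[OF \<Theta>]
    have K: "hilbert_subspace K" unfolding K_def by (rule hilbert_subspace_transport[OF \<Theta> A(1)])
    have I: "isometric_embedding I K"
      using J \<Theta> unfolding isometric_embedding_def I_def K_def by (simp del: split_paired_All)
    have redN: "reducing_isometry K (N p)" if "p \<in> carrier P" for p
      unfolding K_def N_def by (rule reducing_isometry_transport[OF \<Theta> redM[OF that]])
    have redV: "reducing_isometry K V1" "reducing_isometry K V2"
      unfolding K_def V1_def V2_def by (rule reducing_isometry_transport[OF \<Theta> redU(1)],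
          rule reducing_isometry_transport[OF \<Theta> redU(2)])
    have dcV: "doubly_commute_on K V1 (N p)" "doubly_commute_on K V2 (N p)" if p: "p \<in> carrier P" for p
      unfolding K_def V1_def V2_def N_def
      by (rule doubly_commute_on_transport[OF \<Theta> dcU(1)[OF p] bU(1) M[OF p]],
          rule doubly_commute_on_transport[OF \<Theta> dcU(2)[OF p] bU(2) M[OF p]])
    have N_one: "N \<one>\<^bsub>P\<^esub> x = x" if "x \<in> K" for x
    proof -
      have "W \<one>\<^bsub>P\<^esub> = E" by (rule ext) (rule W_one)
      then show ?thesis using that by (auto simp: K_def N_def app M_def A_def)
    qed
    have N_mult: "N (p \<otimes>\<^bsub>P\<^esub> q) x = N p (N q x)" if "p \<in> carrier P" "q \<in> carrier P" "x \<in> K" for p q x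
    proof -
      have "W (p \<otimes>\<^bsub>P\<^esub> q) = (\<lambda>x. W p (W q x))" using W_mult[OF that(1,2)] by blast
      then show ?thesis using that by (auto simp: K_def N_def app M_def amplify_comp W)
    qed
    have range: "N p (adj (N p) (\<Theta> y)) = \<Theta> (amplify (\<lambda>x. W p (adj (W p) x)) y)" if p: "p \<in> carrier P" for p y
      by (simp add: N_def adj_transport[OF \<Theta> M[OF p]] app adjM[OF p])
        (simp add: M_def amplify_comp W[OF p] bounded_clinear_adj[OF W[OF p]])
    have bWW: "bounded_clinear (\<lambda>x. W p (adj (W p) x))" if "p \<in> carrier P" for p
      by (rule bounded_clinear_comp[OF W[OF that] bounded_clinear_adj[OF W[OF that]]])
    have N_Nica: "N p (adj (N p) (N q (adj (N q) x))) = N r (adj (N r) x)"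
      if "p \<in> carrier P" "q \<in> carrier P" "r \<in> carrier P" "x \<in> K"
        "(p <#\<^bsub>P\<^esub> carrier P) \<inter> (q <#\<^bsub>P\<^esub> carrier P) = r <#\<^bsub>P\<^esub> carrier P" for p q r x
    proof -
      from that(4) obtain y where x: "x = \<Theta> y" unfolding K_def by blast
      show ?thesis
        unfolding x range[OF that(2)] range[OF that(1)] range[OF that(3)]
          amplify_comp[OF bWW[OF that(1)] bWW[OF that(2)]] Nica[OF that(1-3,5)] ..
    qed
    have N_Nica0: "N p (adj (N p) (N q (adj (N q) x))) = 0"
      if "p \<in> carrier P" "q \<in> carrier P" "x \<in> K" "(p <#\<^bsub>P\<^esub> carrier P) \<inter> (q <#\<^bsub>P\<^esub> carrier P) = {}" for p q x
    proof -
      from that(3) obtain y where x: "x = \<Theta> y" unfolding K_def by blast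
      show ?thesis
        unfolding x range[OF that(2)] range[OF that(1)]
          amplify_comp[OF bWW[OF that(1)] bWW[OF that(2)]] Nica0[OF that(1,2,4)] amplify_zero
        by (rule bounded_clinear_0[OF isometric_embedding_imp_bounded_clinear[OF \<Theta>]])
    qed
    have N_I: "adj (N p) (I h) = I (adj (T p) h)" if p: "p \<in> carrier P" for p h
      by (simp add: N_def adj_transport[OF \<Theta> M[OF p]] I_def app MJ[OF p])
    have V_I: "adj V1 (I h) = I (adj S\<^sub>1 h)" "adj V2 (I h) = I (adj S\<^sub>2 h)" for h
      by (simp_all add: V1_def V2_def adj_transport[OF \<Theta> bU(1)] adj_transport[OF \<Theta> bU(2)] I_def app UJ)
    have V12: "V1 (V2 x) = V2 (V1 x)" if "x \<in> K" for x
      using that by (auto simp: K_def V1_def V2_def app U12)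
    note ctxt = K I redN N_one N_mult N_Nica N_Nica0 T N_I
    have "isometric_rep P K N"
      using isometry_on_of_reducing[OF redN] N_one N_mult
      by (simp add: isometric_rep_def representation_on_def isometry_on_def)
    moreover have "commute_on K V1 (N p) \<and> commute_on K V2 (N p)" if "p \<in> carrier P" for p
      using dcV[OF that] by (simp add: doubly_commute_on_def commute_on_def)
    moreover have "commute_on K V1 V2" using V12 by (simp add: commute_on_def)
    moreover have "isometric_dilation ((nat_add \<times>\<times> nat_add) \<times>\<times> P) (rep_times2 S\<^sub>1 S\<^sub>2 T) K I (rep_times2 V1 V2 N)"
      by (rule rep_times2_dilation[OF ctxt redV(1) dcV(1) redV(2) dcV(2) V12 S(1) V_I(1) S(2) V_I(2)])
    moreover have "isometric_Nica_coextension (nat_add \<times>\<times> P) (rep_times S\<^sub>1 T) K I (rep_times V1 N)"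
      by (rule rep_times_Nica_coextension[OF ctxt redV(1) dcV(1) S(1) V_I(1)])
    moreover have "isometric_Nica_coextension (nat_add \<times>\<times> P) (rep_times S\<^sub>2 T) K I (rep_times V2 N)"
      by (rule rep_times_Nica_coextension[OF ctxt redV(2) dcV(2) S(2) V_I(2)])
    ultimately show ?thesis
      using K I isometry_on_of_reducing[OF redV(1)] isometry_on_of_reducing[OF redV(2)] by blast
  qed
qed

end
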